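(* Let $0<H<\frac12$ be such that $\frac1H$ is an integer, and let $n=\frac1H$. Let $(X_t)_{t\ge0}$ be fractional Brownian motion with Hurst parameter $H$ taking values in $\mathbf{R}^n$. Then $X$ does not hit points: for every $z\in\mathbf{R}^n$, $$P\left(X_t=z\text{ for some }t>0\right)=0.$$
   Context: Fractional Brownian motion in $\mathbf{R}^n$ with Hurst parameter $H\in(0,1]$ is the process $(X_t)_{t\ge0}$ specified by: (1) $X_0=0$ with probability 1; (2) $X$ is a Gaussian process with stationary increments; (3) for $c>0$, $X_{ct}\stackrel{\mathcal{D}}{=}c^HX_t$ (equality in distribution as processes in $t$); (4) $X_1$ has the standard normal distribution in $\mathbf{R}^n$. The components are independent; that is, $X$ is centered Gaussian with $E[X^i_sX^j_t]=\frac{\delta_{ij}}{2}\left(s^{2H}+t^{2H}-|t-s|^{2H}\right)$. The version with continuous sample paths is used. *)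

theory Defs
  imports "HOL-Probability.Probability"
begin

(* A real Gaussian variable may be degenerate, i.e. almost surely constant; the library's
   normal_density only covers positive variance. *)
definition gaussian_rv :: "'a measure \<Rightarrow> ('a \<Rightarrow> real) \<Rightarrow> bool" where
  "gaussian_rv M Y \<longleftrightarrow>
     (\<exists>\<mu> \<sigma>. 0 < \<sigma> \<and> distributed M lborel Y (normal_density \<mu> \<sigma>)) \<or>
     (\<exists>\<mu>. Y \<in> borel_measurable M \<and> (AE \<omega> in M. Y \<omega> = \<mu>))"

(* Processes are indexed by t \<ge> 0; their values at negative times are ignored throughout. *)
definition gaussian_process :: "'a measure \<Rightarrow> (real \<Rightarrow> 'a \<Rightarrow> 'b::euclidean_space) \<Rightarrow> bool" where
  "gaussian_process M X \<longleftrightarrow>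
     (\<forall>T a. finite T \<and> T \<subseteq> {0..} \<longrightarrow> gaussian_rv M (\<lambda>\<omega>. \<Sum>t\<in>T. a t \<bullet> X t \<omega>))"

abbreviation path_space :: "(real \<Rightarrow> 'b::topological_space) measure" where
  "path_space \<equiv> PiM {0..} (\<lambda>_. borel)"

(* Equality of these laws on the product sigma-algebra is equality of all
   finite-dimensional distributions. *)
definition process_law ::
    "'a measure \<Rightarrow> (real \<Rightarrow> 'a \<Rightarrow> 'b::topological_space) \<Rightarrow> (real \<Rightarrow> 'b) measure" where
  "process_law M X = distr M path_space (\<lambda>\<omega>. \<lambda>t\<in>{0..}. X t \<omega>)"

(* Centredness and the covariance formula
     E[X^i_s X^j_t] = (if i = j then (s^(2H) + t^(2H) - |t - s|^(2H)) / 2 else 0)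
   are not assumed separately: self-similarity and the law of X_1 give the mean and the
   variances, stationarity of the increments gives the covariance within a component, and
   independence of the components makes the mixed terms vanish. *)
locale fractional_brownian_motion = prob_space M
  for M :: "'a measure" and H :: real and X :: "real \<Rightarrow> 'a \<Rightarrow> real ^ 'n::finite" +
  assumes hurst: "0 < H" "H \<le> 1"
    and measurable_X: "\<And>t. 0 \<le> t \<Longrightarrow> X t \<in> borel_measurable M"
    and start_zero: "AE \<omega> in M. X 0 \<omega> = 0"
    and gaussian: "gaussian_process M X"
    and stationary_increments:
      "\<And>s. 0 \<le> s \<Longrightarrow>
        process_law M (\<lambda>t \<omega>. X (s + t) \<omega> - X s \<omega>) = process_law M (\<lambda>t \<omega>. X t \<omega> - X 0 \<omega>)"
    and self_similar:
      "\<And>c. 0 < c \<Longrightarrow>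
        process_law M (\<lambda>t. X (c * t)) = process_law M (\<lambda>t \<omega>. (c powr H) *\<^sub>R X t \<omega>)"
    and standard_normal_at_1:
      "distributed M lborel (X 1) (\<lambda>x. \<Prod>i\<in>UNIV. std_normal_density (x $ i))"
    and independent_components:
      "indep_vars (\<lambda>_. path_space) (\<lambda>i \<omega>. \<lambda>t\<in>{0..}. X t \<omega> $ i) (UNIV :: 'n set)"
    and continuous_paths: "\<And>\<omega>. \<omega> \<in> space M \<Longrightarrow> continuous_on {0..} (\<lambda>t. X t \<omega>)"

end

theory Submission
  imports Defs
begin

text \<open>Write \<open>n = 1/H\<close> and let \<open>m\<close> be Lebesgue measure on \<open>\<real>\<^sup>n\<close>. By self-similarity
  \<open>E m(X[0,c]) = c E m(X[0,1])\<close>, and by stationarity of the increments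
  \<open>E m(X[a,c]) = E m(X[0,c-a])\<close>. As these are finite, \<open>X[0,a]\<close> and \<open>X[a,c]\<close> overlap in a null
  set (Levy's argument), so for almost every \<open>z\<close> the process almost surely does not hit \<open>z\<close> in both
  time intervals.

  For \<open>H < 1/2\<close>, on \<open>[0,c]\<close> the covariance of \<open>X\<close> dominates a multiple of the covariance of
  Brownian motion, because \<open>x\<^bsup>2H\<^esup> - \<beta>x\<close> is concave and increasing there for a suitable \<open>\<beta> > 0\<close>.
  Hence the piecewise linear function \<open>g\<close> with \<open>g = 0\<close> on \<open>[0,a]\<close> and \<open>g = 1\<close> on \<open>[b,c]\<close> lies in
  the Cameron-Martin space of \<open>X\<close>, and null events remain null if \<open>X\<close> is replaced by \<open>X + yg\<close>.
  Applied to the event above, with all \<open>y\<close>, this gives \<open>m(X[0,a]) m(X[b,c]) = 0\<close> almost surely for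
  all \<open>a < b < c\<close>, which forces \<open>m(X[0,c]) = 0\<close>. So almost every point is not hit, and shifting once
  more by \<open>yg\<close> transfers this from one point to all points.\<close>

section \<open>Uniqueness of laws from characteristic functions\<close>

text \<open>The dimension \<open>1 / H\<close> is critical: cutting [0, 1] into \<open>N\<close>
  equal pieces bounds the expected volume of the range by \<open>N\<close> times
  \<open>1 / N\<close> of itself, so covering estimates give finiteness but never 0. Levy's argument
  turns this exact additivity into information about overlaps. A null overlap is still compatible
  with positive volume, as for a space-filling curve, and for this reason the later piece of the
  path is moved relative to the earlier one. The mover has to be constant on each piece, so a gap
  between \<open>a\<close> and \<open>b\<close> is left in which it rises, and the outcome is a
  dichotomy about two separated pieces. Membership of the mover in the Cameron-Martin space comes
  from a comparison with Brownian motion, without a description of that space;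
  \<open>2 * H < 1\<close> enters through the concavity of \<open>x powr (2 * H)\<close>. The
  hypotheses give laws on a product sigma-algebra, where an event depends on countably many times
  only. Hence hitting is expressed through rational times.\<close>

lemma integrable_bounded_mult:
  fixes w f :: "'a \<Rightarrow> real"
  assumes "integrable M w" "f \<in> borel_measurable M" "\<And>x. \<bar>f x\<bar> \<le> B"
  shows "integrable M (\<lambda>x. w x * f x)"
proof (rule Bochner_Integration.integrable_bound)
  show "integrable M (\<lambda>x. B * w x)" using assms(1) by simp
  show "(\<lambda>x. w x * f x) \<in> borel_measurable M" using assms(1,2) by measurable
  have "0 \<le> B" using assms(3)[of undefined] by linarith
  then show "AE x in M. norm (w x * f x) \<le> norm (B * w x)"
    using assms(3) by (auto simp: abs_mult mult.commute intro!: mult_right_mono)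
qed

text \<open>Normalising the weight gives a probability law, to which Levy's uniqueness theorem
  applies. Both parts of the characteristic function are written as cosines with a phase, the sine
  being \<open>cos (u - pi/2)\<close>, so that a hypothesis about phase-shifted cosines alone can be
  fed in.\<close>

lemma normalized_density_char:
  fixes w Y :: "'a \<Rightarrow> real"
  assumes w: "integrable M w" "\<And>x. 0 \<le> w x" and Y: "Y \<in> borel_measurable M"
    and "0 < c" and c: "c = (LINT x|M. w x)" and B: "B \<in> sets borel"
  defines "D \<equiv> distr (density M (\<lambda>x. ennreal (w x / c))) borel Y"
  shows "real_distribution D"
    and "char D t = Complex ((LINT x|M. w x * cos (t * Y x + 0)) / c) ((LINT x|M. w x * cos (t * Y x + (- pi/2))) / c)"
    and "measure D B = (LINT x|M. w x * indicator B (Y x)) / c"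
proof -
    note [measurable] = Y B
    have [measurable]: "w \<in> borel_measurable M" using w(1) by simp
    have 1: "prob_space (density M (\<lambda>x. ennreal (w x / c)))"
    proof
      have "emeasure (density M (\<lambda>x. ennreal (w x / c))) (space M) = (\<integral>\<^sup>+x. ennreal (w x / c) \<partial>M)"
        by (simp add: emeasure_density cong: nn_integral_cong)
      also have "\<dots> = ennreal (LINT x|M. w x / c)"
        using w \<open>0 < c\<close> by (intro nn_integral_eq_integral) auto
      also have "\<dots> = 1" using c \<open>0 < c\<close> by simp
      finally show "emeasure (density M (\<lambda>x. ennreal (w x / c))) (space (density M (\<lambda>x. ennreal (w x / c)))) = 1"
        by simp
    qed
    have 2: "real_distribution (D)"
      unfolding D_def using 1 by (intro prob_space.real_distribution_distr) auto
    have i1: "integrable M (\<lambda>x. w x * cos (t * Y x))" "integrable M (\<lambda>x. w x * sin (t * Y x))"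
      by (auto intro!: integrable_bounded_mult[where B=1] w)
    have 3: "char (D) t
        = (CLINT x|M. (w x / c) *\<^sub>R iexp (t * Y x))"
      unfolding char_def D_def using w \<open>0 < c\<close>
      by (subst integral_distr) (auto simp: integral_density)
    have ci: "complex_integrable M (\<lambda>x. (w x / c) *\<^sub>R iexp (t * Y x))"
    proof (rule Bochner_Integration.integrable_bound)
      show "integrable M (\<lambda>x. w x / c)" using w by simp
    qed (use \<open>0 < c\<close> w in auto)
    have "char (D) t
        = Complex (LINT x|M. w x * cos (t * Y x) / c) (LINT x|M. w x * sin (t * Y x) / c)"
      unfolding 3 complex_eq_iff
      using ci by (simp add: integral_Re[symmetric] integral_Im[symmetric] Re_exp Im_exp)
    moreover have "measure (D) B
        = (LINT x|M. w x * indicator B (Y x)) / c"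
    proof -
      have "measure (D) B
        = (LINT y|D. indicator B y)"
        by (simp add: D_def)
      also have "\<dots> = (LINT x|M. (w x / c) *\<^sub>R indicator B (Y x))"
        unfolding D_def using w \<open>0 < c\<close> by (subst integral_distr) (auto simp: integral_density)
      finally show ?thesis by simp
    qed
    ultimately show "real_distribution D"
      "char D t = Complex ((LINT x|M. w x * cos (t * Y x + 0)) / c) ((LINT x|M. w x * cos (t * Y x + (- pi/2))) / c)"
      "measure D B = (LINT x|M. w x * indicator B (Y x)) / c" using 2 by (simp_all add: cos_diff)
  qed

lemma weighted_indicator_bounds:
  fixes w Y :: "'a \<Rightarrow> real"
  assumes w: "integrable M w" "\<And>x. 0 \<le> w x" and Y: "Y \<in> borel_measurable M" and B: "B \<in> sets borel"
  shows "0 \<le> (LINT x|M. w x * indicator B (Y x))"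
    and "(LINT x|M. w x * indicator B (Y x)) \<le> (LINT x|M. w x)"
proof -
  have [measurable]: "(\<lambda>x. indicator B (Y x) :: real) \<in> borel_measurable M"
    by (rule measurable_compose[OF Y borel_measurable_indicator[OF B]])
  have "integrable M (\<lambda>x. w x * indicator B (Y x))"
    by (rule integrable_bounded_mult[OF w(1), where B=1]) (auto split: split_indicator)
  then show "(LINT x|M. w x * indicator B (Y x)) \<le> (LINT x|M. w x)"
    using w by (intro integral_mono) (auto split: split_indicator)
qed (use w in \<open>simp add: indicator_def\<close>)

lemma weighted_law_eqI_cos:
  fixes w Y :: "'a \<Rightarrow> real" and w' Y' :: "'b \<Rightarrow> real"
  assumes w: "integrable M w" "\<And>x. 0 \<le> w x" and Y: "Y \<in> borel_measurable M"
    and w': "integrable N w'" "\<And>x. 0 \<le> w' x" and Y': "Y' \<in> borel_measurable N"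
    and eq: "\<And>t b. (LINT x|M. w x * cos (t * Y x + b)) = (LINT x|N. w' x * cos (t * Y' x + b))"
    and B: "B \<in> sets borel"
  shows "(LINT x|M. w x * indicator B (Y x)) = (LINT x|N. w' x * indicator B (Y' x))"
proof -
  define c where "c = (LINT x|M. w x)"
  have c': "c = (LINT x|N. w' x)" using eq[of 0 0] by (simp add: c_def)
  have "0 \<le> c" unfolding c_def using w by simp
  show ?thesis
  proof (cases "c = 0")
    \<comment> \<open>Total mass 0 cannot be normalised, but then both integrals are squeezed
      between 0 and 0.\<close>
    case True
    then show ?thesis
      using weighted_indicator_bounds[OF w Y B] weighted_indicator_bounds[OF w' Y' B] c' c_def by linarith
  next
    case False
    then have "0 < c" using \<open>0 \<le> c\<close> by simp
    note k = normalized_density_char[OF w Y \<open>0 < c\<close> c_def B] and k' = normalized_density_char[OF w' Y' \<open>0 < c\<close> c' B]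
    have "distr (density M (\<lambda>x. ennreal (w x / c))) borel Y = distr (density N (\<lambda>x. ennreal (w' x / c))) borel Y'"
      using k(1) k'(1) by (rule Levy_uniqueness) (intro ext, unfold k(2) k'(2) eq, rule refl)
    then show ?thesis using k(3) k'(3) \<open>0 < c\<close> by simp
  qed
qed

text \<open>Indicators replace cosines one coordinate at a time. The product \<open>P\<close> of the
  indicators already present acts as a weight, and the law of the next coordinate under it is
  identified by cosine integrals. Carrying the cosine of the remaining coordinates along is what
  lets the induction continue.\<close>

lemma indicator_cos_eqI:
  fixes Y :: "'i \<Rightarrow> 'a \<Rightarrow> real" and Y' :: "'i \<Rightarrow> 'b \<Rightarrow> real"
  assumes "prob_space M" "prob_space N" and J: "finite J"
    and Y[measurable]: "\<And>j. j \<in> J \<Longrightarrow> Y j \<in> borel_measurable M"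
    and Y'[measurable]: "\<And>j. j \<in> J \<Longrightarrow> Y' j \<in> borel_measurable N"
    and eq: "\<And>a b. (LINT x|M. cos ((\<Sum>j\<in>J. a j * Y j x) + b)) = (LINT x|N. cos ((\<Sum>j\<in>J. a j * Y' j x) + b))"
    and B[measurable]: "\<And>j. j \<in> J \<Longrightarrow> B j \<in> sets borel" and I: "I \<subseteq> J"
  shows "(LINT x|M. (\<Prod>j\<in>I. indicator (B j) (Y j x)) * cos ((\<Sum>j\<in>J - I. a j * Y j x) + b))
       = (LINT x|N. (\<Prod>j\<in>I. indicator (B j) (Y' j x)) * cos ((\<Sum>j\<in>J - I. a j * Y' j x) + b))"
proof -
  interpret M: prob_space M by fact
  interpret N: prob_space N by fact
  have "finite I" using I J finite_subset by blast
  then show ?thesis using I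
  proof (induction I arbitrary: a b)
    case empty
    then show ?case using eq by simp
  next
    case (insert k I)
    then have k: "k \<in> J" and I: "I \<subseteq> J" by auto
    note IH = insert.IH[OF I]
    have P[measurable]: "(\<lambda>x. (\<Prod>j\<in>I. indicator (B j) (Y j x)) :: real) \<in> borel_measurable M"
      "(\<lambda>x. (\<Prod>j\<in>I. indicator (B j) (Y' j x)) :: real) \<in> borel_measurable N"
      using I by (auto intro!: borel_measurable_prod borel_measurable_indicator' simp: subset_eq)
    define P where "P x = (\<Prod>j\<in>I. indicator (B j) (Y j x) :: real)" for x
    define P' where "P' x = (\<Prod>j\<in>I. indicator (B j) (Y' j x) :: real)" for x
    have [measurable]: "P \<in> borel_measurable M" "P' \<in> borel_measurable N"
      using P unfolding P_def P'_def by auto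
    have P01: "0 \<le> P x" "P x \<le> 1" "0 \<le> P' y" "P' y \<le> 1" for x y
      unfolding P_def P'_def by (auto intro!: prod_nonneg prod_le_1)
    have split: "(\<Sum>j\<in>J - I. (a(k := t)) j * Z j) = t * Z k + (\<Sum>j\<in>J - insert k I. a j * Z j)"
      for t a and Z :: "'i \<Rightarrow> real"
    proof -
      obtain D where D: "finite D" "k \<notin> D" "J - I = insert k D" "J - insert k I = D"
        using k insert.hyps J by blast
      have "(\<Sum>j\<in>D. (a(k := t)) j * Z j) = (\<Sum>j\<in>D. a j * Z j)"
        using D(2) by (intro sum.cong) auto
      then show ?thesis unfolding D(3,4) sum.insert[OF D(1,2)] by simp
    qed
    let ?S = "\<lambda>a x. \<Sum>j\<in>J - insert k I. a j * Y j x" and ?S' = "\<lambda>a x. \<Sum>j\<in>J - insert k I. a j * Y' j x"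
    have [measurable]: "?S a \<in> borel_measurable M" "?S' a \<in> borel_measurable N" for a
      by (auto intro!: borel_measurable_sum)
    have IH': "(LINT x|M. P x * cos (t * Y k x + ?S a x + b)) = (LINT x|N. P' x * cos (t * Y' k x + ?S' a x + b))"
      for t a b using IH[of "a(k := t)" b] unfolding split P_def P'_def .
    note [measurable] = Y[OF k] Y'[OF k]
    have iM: "integrable M (\<lambda>x. P x * f x)" if "f \<in> borel_measurable M" "\<And>x. \<bar>f x\<bar> \<le> 2" for f
      by (rule integrable_bounded_mult[OF _ that])
        (rule M.integrable_const_bound[where B=1], use P01 in auto)
    have iN: "integrable N (\<lambda>x. P' x * f x)" if "f \<in> borel_measurable N" "\<And>x. \<bar>f x\<bar> \<le> 2" for f
      by (rule integrable_bounded_mult[OF _ that])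
        (rule N.integrable_const_bound[where B=1], use P01 in auto)
    have le2: "\<bar>1 + cos u\<bar> \<le> 2" "\<bar>cos u\<bar> \<le> 2" for u :: real
      using abs_cos_le_one[of u] by linarith+
    \<comment> \<open>Product-to-sum: multiplied out, every term is \<open>P\<close> times a single
      cosine of a linear combination, and so falls under the induction hypothesis.\<close>
    have prodsum: "P * (1 + cos u) * cos v = P * cos v + (P * cos (v + u) + P * cos (v - u)) / 2" for P u v :: real
      by (simp add: cos_add cos_diff algebra_simps)
    have IH2: "(LINT x|M. P x * cos (t * Y k x + c)) = (LINT x|N. P' x * cos (t * Y' k x + c))" for t c
      using IH'[of t "\<lambda>_. 0" c] by simp
    have IH3: "(LINT x|M. P x * cos ((t * Y k x + c) - (?S a x + b))) = (LINT x|N. P' x * cos ((t * Y' k x + c) - (?S' a x + b)))"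
      for t a b c
      using IH'[of t "\<lambda>j. - a j" "c - b"] by (simp add: sum_negf algebra_simps)
    have IH4: "(LINT x|M. P x * cos ((t * Y k x + c) + (?S a x + b))) = (LINT x|N. P' x * cos ((t * Y' k x + c) + (?S' a x + b)))"
      for t a b c
      using IH'[of t a "c + b"] by (simp add: algebra_simps)
    \<comment> \<open>A weight has to be nonnegative, so \<open>1 + cos\<close> stands in for
      \<open>cos\<close>; the contribution of the 1 is removed at the end.\<close>
    have main: "(LINT x|M. P x * (1 + cos (?S a x + b)) * indicator (B k) (Y k x))
      = (LINT x|N. P' x * (1 + cos (?S' a x + b)) * indicator (B k) (Y' k x))" for a b
    proof (rule weighted_law_eqI_cos[OF _ _ Y[OF k] _ _ Y'[OF k] _ B[OF k]])
      show "integrable M (\<lambda>x. P x * (1 + cos (?S a x + b)))" by (rule iM) (auto simp: le2)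
      show "integrable N (\<lambda>x. P' x * (1 + cos (?S' a x + b)))" by (rule iN) (auto simp: le2)
      have "0 \<le> 1 + cos u" for u :: real using cos_ge_minus_one[of u] by linarith
      then show "0 \<le> P x * (1 + cos (?S a x + b))" "0 \<le> P' y * (1 + cos (?S' a y + b))" for x y
        using P01 by auto
      fix t c
      have "(LINT x|M. P x * (1 + cos (?S a x + b)) * cos (t * Y k x + c))
        = (LINT x|M. P x * cos (t * Y k x + c)) + ((LINT x|M. P x * cos ((t * Y k x + c) + (?S a x + b)))
          + (LINT x|M. P x * cos ((t * Y k x + c) - (?S a x + b)))) / 2"
        unfolding prodsum by (simp add: iM le2)
      moreover have "(LINT x|N. P' x * (1 + cos (?S' a x + b)) * cos (t * Y' k x + c))
        = (LINT x|N. P' x * cos (t * Y' k x + c)) + ((LINT x|N. P' x * cos ((t * Y' k x + c) + (?S' a x + b)))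
          + (LINT x|N. P' x * cos ((t * Y' k x + c) - (?S' a x + b)))) / 2"
        unfolding prodsum by (simp add: iN le2)
      ultimately show "(LINT x|M. P x * (1 + cos (?S a x + b)) * cos (t * Y k x + c))
        = (LINT x|N. P' x * (1 + cos (?S' a x + b)) * cos (t * Y' k x + c))"
        unfolding IH2 IH3 IH4 by simp
    qed
    have iind[measurable]: "(\<lambda>x. indicator (B k) (Y k x) :: real) \<in> borel_measurable M"
      "(\<lambda>x. indicator (B k) (Y' k x) :: real) \<in> borel_measurable N"
      using k by (auto intro!: borel_measurable_indicator')
    have bd: "\<bar>indicator A y * cos u\<bar> \<le> 2" "\<bar>indicator A y :: real\<bar> \<le> 2" for A :: "real set" and y u :: real
      using le2[of u] by (auto simp: indicator_def)
    have "(LINT x|M. P x * (1 + cos (?S a x + b)) * indicator (B k) (Y k x))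
      = (LINT x|M. P x * indicator (B k) (Y k x)) + (LINT x|M. P x * (indicator (B k) (Y k x) * cos (?S a x + b)))"
      by (subst Bochner_Integration.integral_add[symmetric])
        (auto intro!: iM bd Bochner_Integration.integral_cong simp: algebra_simps)
    moreover have "(LINT x|N. P' x * (1 + cos (?S' a x + b)) * indicator (B k) (Y' k x))
      = (LINT x|N. P' x * indicator (B k) (Y' k x)) + (LINT x|N. P' x * (indicator (B k) (Y' k x) * cos (?S' a x + b)))"
      by (subst Bochner_Integration.integral_add[symmetric])
        (auto intro!: iN bd Bochner_Integration.integral_cong simp: algebra_simps)
    \<comment> \<open>Zero coefficients and the phase \<open>pi/2\<close> make the cosine vanish and
      leave the weight \<open>P\<close> alone.\<close>
    moreover have "(LINT x|M. P x * indicator (B k) (Y k x)) = (LINT x|N. P' x * indicator (B k) (Y' k x))"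
      using main[of "\<lambda>_. 0" "pi/2"] by simp
    ultimately show ?case
      using main[of a b] insert.hyps by (simp add: P_def P'_def mult_ac)
  qed
qed

lemma emeasure_distr_cylinder:
  assumes "prob_space M" and Y[measurable]: "\<And>j. j \<in> I \<Longrightarrow> Y j \<in> borel_measurable M"
    and J: "finite J" "J \<subseteq> I" and A: "\<And>i. i \<in> J \<Longrightarrow> A i \<in> sets (borel :: real measure)"
  shows "emeasure (distr M (PiM I (\<lambda>_. borel)) (\<lambda>x. \<lambda>j\<in>I. Y j x)) (prod_emb I (\<lambda>_. borel) J (Pi\<^sub>E J A))
    = ennreal (LINT x|M. (\<Prod>j\<in>J. indicator (A j) (Y j x)))"
proof -
  interpret prob_space M by fact
  have [measurable]: "(\<lambda>x. \<lambda>j\<in>I. Y j x) \<in> M \<rightarrow>\<^sub>M PiM I (\<lambda>_. borel)" by measurable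
  have [measurable]: "prod_emb I (\<lambda>_. borel) J (Pi\<^sub>E J A) \<in> sets (PiM I (\<lambda>_. borel))"
    using J A by (intro sets_PiM_I) auto
  let ?E = "(\<lambda>x. \<lambda>j\<in>I. Y j x) -` prod_emb I (\<lambda>_. borel) J (Pi\<^sub>E J A) \<inter> space M"
  have "emeasure (distr M (PiM I (\<lambda>_. borel)) (\<lambda>x. \<lambda>j\<in>I. Y j x)) (prod_emb I (\<lambda>_. borel) J (Pi\<^sub>E J A))
    = emeasure M ?E"
    by (rule emeasure_distr) measurable
  also have "\<dots> = ennreal (measure M ?E)" by (simp add: emeasure_eq_measure)
  also have "measure M ?E = (LINT x|M. indicator ?E x)"
    by simp
  also have "\<dots> = (LINT x|M. (\<Prod>j\<in>J. indicator (A j) (Y j x)))"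
  proof (rule Bochner_Integration.integral_cong[OF refl])
    fix x assume "x \<in> space M"
    then have "x \<in> ?E \<longleftrightarrow> (\<forall>j\<in>J. Y j x \<in> A j)"
      using J(2) by (auto simp: prod_emb_def PiE_iff)
    then show "indicator ?E x = (\<Prod>j\<in>J. indicator (A j) (Y j x) :: real)"
      using J(1) by (auto simp: indicator_def intro!: prod_zero)
  qed
  finally show ?thesis .
qed

text \<open>A form of the Cramer-Wold device for an arbitrary index set: cylinder sets generate the
  product sigma-algebra, and their measures are integrals of products of indicators, which the
  cosine integrals determine.\<close>

proposition distr_PiM_eqI_cos:
  fixes Y :: "'i \<Rightarrow> 'a \<Rightarrow> real" and Y' :: "'i \<Rightarrow> 'b \<Rightarrow> real"
  assumes M: "prob_space M" and N: "prob_space N"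
    and Y[measurable]: "\<And>j. j \<in> I \<Longrightarrow> Y j \<in> borel_measurable M"
    and Y'[measurable]: "\<And>j. j \<in> I \<Longrightarrow> Y' j \<in> borel_measurable N"
    and eq: "\<And>J a b. finite J \<Longrightarrow> J \<subseteq> I \<Longrightarrow>
      (LINT x|M. cos ((\<Sum>j\<in>J. a j * Y j x) + b)) = (LINT x|N. cos ((\<Sum>j\<in>J. a j * Y' j x) + b))"
  shows "distr M (PiM I (\<lambda>_. borel)) (\<lambda>x. \<lambda>j\<in>I. Y j x) = distr N (PiM I (\<lambda>_. borel)) (\<lambda>x. \<lambda>j\<in>I. Y' j x)"
proof (rule measure_eqI_PiM_infinite)
  interpret M: prob_space M by fact
  interpret N: prob_space N by fact
  show "finite_measure (distr M (PiM I (\<lambda>_. borel)) (\<lambda>x. \<lambda>j\<in>I. Y j x))"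
    by (intro M.finite_measure_distr) measurable
  fix A J assume J: "finite J" "J \<subseteq> I" and A: "\<And>i. i \<in> J \<Longrightarrow> A i \<in> sets (borel :: real measure)"
  show "emeasure (distr M (PiM I (\<lambda>_. borel)) (\<lambda>x. \<lambda>j\<in>I. Y j x)) (prod_emb I (\<lambda>_. borel) J (Pi\<^sub>E J A))
    = emeasure (distr N (PiM I (\<lambda>_. borel)) (\<lambda>x. \<lambda>j\<in>I. Y' j x)) (prod_emb I (\<lambda>_. borel) J (Pi\<^sub>E J A))"
    \<comment> \<open>For \<open>I = J\<close> no coordinate is left inside the cosine, which
      becomes \<open>cos 0 = 1\<close>.\<close>
    using indicator_cos_eqI[OF M N J(1) _ _ eq[OF J], of A J "\<lambda>_. 0" 0] J A Y Y'
    by (subst (1 2) emeasure_distr_cylinder) (auto simp: M N subset_eq)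
qed auto

lemma borel_measurable_vec_lambda:
  fixes f :: "'a \<Rightarrow> 'n::finite \<Rightarrow> real"
  assumes "\<And>i. (\<lambda>x. f x i) \<in> borel_measurable M"
  shows "(\<lambda>x. \<chi> i. f x i) \<in> borel_measurable M"
  unfolding borel_measurable_euclidean_space[of "\<lambda>x. \<chi> i. f x i"]
  using assms by (auto simp: Basis_vec_def inner_axis)

lemma borel_measurable_vec_component [measurable (raw)]:
  fixes f :: "'a \<Rightarrow> real ^ 'n::finite"
  assumes "f \<in> borel_measurable M"
  shows "(\<lambda>x. f x $ i) \<in> borel_measurable M"
  by (rule measurable_compose[OF assms]) simp

text \<open>The components form a scalar family indexed by pairs, from which \<open>?G\<close>
  reassembles the vectors. Scalar coefficients on a finite set of pairs become vectors padded with
  zeros.\<close>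

corollary distr_PiM_vec_eqI_cos:
  fixes Y :: "'i \<Rightarrow> 'a \<Rightarrow> real ^ 'n::finite" and Y' :: "'i \<Rightarrow> 'b \<Rightarrow> real ^ 'n"
  assumes M: "prob_space M" and N: "prob_space N"
    and Y[measurable]: "\<And>j. j \<in> I \<Longrightarrow> Y j \<in> borel_measurable M"
    and Y'[measurable]: "\<And>j. j \<in> I \<Longrightarrow> Y' j \<in> borel_measurable N"
    and eq: "\<And>J a b. finite J \<Longrightarrow> J \<subseteq> I \<Longrightarrow>
      (LINT x|M. cos ((\<Sum>j\<in>J. a j \<bullet> Y j x) + b)) = (LINT x|N. cos ((\<Sum>j\<in>J. a j \<bullet> Y' j x) + b))"
  shows "distr M (PiM I (\<lambda>_. borel)) (\<lambda>x. \<lambda>j\<in>I. Y j x) = distr N (PiM I (\<lambda>_. borel)) (\<lambda>x. \<lambda>j\<in>I. Y' j x)"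
proof -
  let ?K = "I \<times> (UNIV :: 'n set)"
  let ?G = "\<lambda>f :: 'i \<times> 'n \<Rightarrow> real. \<lambda>j\<in>I. \<chi> k. f (j, k)"
  have comp: "(\<lambda>x. Y (fst p) x $ snd p) \<in> borel_measurable M" "(\<lambda>x. Y' (fst p) x $ snd p) \<in> borel_measurable N"
    if "p \<in> ?K" for p
    using that by auto
  have "distr M (PiM ?K (\<lambda>_. borel)) (\<lambda>x. \<lambda>p\<in>?K. Y (fst p) x $ snd p)
    = distr N (PiM ?K (\<lambda>_. borel)) (\<lambda>x. \<lambda>p\<in>?K. Y' (fst p) x $ snd p)"
  proof (rule distr_PiM_eqI_cos[OF M N comp])
    fix J and a :: "'i \<times> 'n \<Rightarrow> real" and b assume J: "finite J" "J \<subseteq> ?K"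
    define a' where "a' j = (\<chi> k. if (j, k) \<in> J then a (j, k) else 0)" for j
    have S: "(\<Sum>p\<in>J. a p * Z (fst p) $ snd p) = (\<Sum>j\<in>fst ` J. a' j \<bullet> Z j)" for Z :: "'i \<Rightarrow> real ^ 'n"
    proof -
      have "(\<Sum>j\<in>fst ` J. a' j \<bullet> Z j) = (\<Sum>j\<in>fst ` J. \<Sum>k\<in>UNIV. if (j, k) \<in> J then a (j, k) * Z j $ k else 0)"
        by (auto simp: inner_vec_def a'_def intro!: sum.cong)
      also have "\<dots> = (\<Sum>p\<in>fst ` J \<times> UNIV. if p \<in> J then a p * Z (fst p) $ snd p else 0)"
        by (simp add: sum.cartesian_product split_beta cong: if_cong)
      also have "\<dots> = (\<Sum>p\<in>J. a p * Z (fst p) $ snd p)"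
        using J(1) by (intro sum.mono_neutral_cong_right) (auto, force)
      finally show ?thesis ..
    qed
    have "finite (fst ` J)" "fst ` J \<subseteq> I" using J by auto
    then show "(LINT x|M. cos ((\<Sum>p\<in>J. a p * Y (fst p) x $ snd p) + b))
      = (LINT x|N. cos ((\<Sum>p\<in>J. a p * Y' (fst p) x $ snd p) + b))"
      using eq[of "fst ` J" a' b] unfolding S[of "\<lambda>j. Y j _"] S[of "\<lambda>j. Y' j _"] by simp
  qed auto
  then have "distr (distr M (PiM ?K (\<lambda>_. borel)) (\<lambda>x. \<lambda>p\<in>?K. Y (fst p) x $ snd p)) (PiM I (\<lambda>_. borel)) ?G
    = distr (distr N (PiM ?K (\<lambda>_. borel)) (\<lambda>x. \<lambda>p\<in>?K. Y' (fst p) x $ snd p)) (PiM I (\<lambda>_. borel)) ?G"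
    by simp
  moreover have G: "?G \<in> PiM ?K (\<lambda>_. borel) \<rightarrow>\<^sub>M PiM I (\<lambda>_. borel)"
    by (intro measurable_restrict borel_measurable_vec_lambda measurable_component_singleton) auto
  moreover have "(\<lambda>x. \<lambda>p\<in>?K. Y (fst p) x $ snd p) \<in> M \<rightarrow>\<^sub>M PiM ?K (\<lambda>_. borel)"
    "(\<lambda>x. \<lambda>p\<in>?K. Y' (fst p) x $ snd p) \<in> N \<rightarrow>\<^sub>M PiM ?K (\<lambda>_. borel)"
    by (intro measurable_restrict comp; assumption)+
  moreover have "?G \<circ> (\<lambda>x. \<lambda>p\<in>?K. Y (fst p) x $ snd p) = (\<lambda>x. \<lambda>j\<in>I. Y j x)"
    "?G \<circ> (\<lambda>x. \<lambda>p\<in>?K. Y' (fst p) x $ snd p) = (\<lambda>x. \<lambda>j\<in>I. Y' j x)"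
    by (auto simp: fun_eq_iff vec_eq_iff)
  ultimately show ?thesis by (simp add: distr_distr)
qed

section \<open>Centred Gaussian variables and product integrals over
  \<open>real ^ 'n\<close>\<close>

lemma char_std_normal_cos:
  "(LINT x|std_normal_distribution. cos (t * x + b)) = cos b * exp (- t\<^sup>2 / 2)"
proof -
  interpret real_distribution std_normal_distribution by (rule real_dist_normal_dist)
  have "complex_integrable std_normal_distribution (\<lambda>x. iexp (t * x))"
    by (intro integrable_iexp) auto
  then have re: "(LINT x|std_normal_distribution. cos (t * x)) = Re (char std_normal_distribution t)"
    and im: "(LINT x|std_normal_distribution. sin (t * x)) = Im (char std_normal_distribution t)"
    unfolding char_def by (simp_all add: integral_Re[symmetric] integral_Im[symmetric] Re_exp Im_exp)
  have "(LINT x|std_normal_distribution. cos (t * x + b))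
    = (LINT x|std_normal_distribution. cos b * cos (t * x) - sin b * sin (t * x))"
    by (simp add: cos_add mult.commute)
  also have "\<dots> = cos b * (LINT x|std_normal_distribution. cos (t * x)) - sin b * (LINT x|std_normal_distribution. sin (t * x))"
    by (subst Bochner_Integration.integral_diff)
      (auto intro!: integrable_const_bound[where B=1] integrable_mult_right)
  finally show ?thesis unfolding re im by (simp add: char_std_normal_distribution)
qed

text \<open>A degenerate variable obeys the same formula with variance 0, so degenerate linear
  combinations of the process cause no case distinction from here on.\<close>

lemma (in prob_space) gaussian_rv_centred:
  assumes Y: "gaussian_rv M Y" and mean: "expectation Y = 0"
  shows "Y \<in> borel_measurable M" and "integrable M (\<lambda>\<omega>. Y \<omega> ^ k)"
    and "expectation (\<lambda>\<omega>. cos (Y \<omega> + b)) = cos b * exp (- expectation (\<lambda>\<omega>. (Y \<omega>)\<^sup>2) / 2)"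
proof -
  have "Y \<in> borel_measurable M \<and> integrable M (\<lambda>\<omega>. Y \<omega> ^ k) \<and>
    expectation (\<lambda>\<omega>. cos (Y \<omega> + b)) = cos b * exp (- expectation (\<lambda>\<omega>. (Y \<omega>)\<^sup>2) / 2)"
    using Y unfolding gaussian_rv_def
  proof (elim disjE exE conjE)
    fix \<mu> \<sigma> :: real assume \<sigma>: "0 < \<sigma>" and "distributed M lborel Y (normal_density \<mu> \<sigma>)"
    then have D: "distributed M lborel Y (normal_density 0 \<sigma>)"
      using normal_distributed_expectation mean by metis
    have [measurable]: "Y \<in> borel_measurable M" using distributed_measurable[OF D] by simp
    have var: "expectation (\<lambda>\<omega>. (Y \<omega>)\<^sup>2) = \<sigma>\<^sup>2"
      using normal_distributed_variance[OF \<sigma> D] mean by simp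
    have "integrable M (\<lambda>\<omega>. Y \<omega> ^ k)"
      using integrable_normal_moment[OF \<sigma>, of 0 k]
      by (subst distributed_integrable[OF D, symmetric]) auto
    moreover have "distributed M lborel (\<lambda>\<omega>. Y \<omega> / \<sigma>) std_normal_density"
      using D normal_standard_normal_convert[OF \<sigma>, of Y 0] by simp
    then have "distr M lborel (\<lambda>\<omega>. Y \<omega> / \<sigma>) = std_normal_distribution"
      by (simp add: distributed_def)
    then have "expectation (\<lambda>\<omega>. cos (\<sigma> * (Y \<omega> / \<sigma>) + b)) = (LINT x|std_normal_distribution. cos (\<sigma> * x + b))"
      by (subst \<open>distr M lborel _ = _\<close>[symmetric], subst integral_distr) auto
    ultimately show ?thesis using \<sigma> var by (simp add: char_std_normal_cos)
  next
    fix \<mu> assume [measurable]: "Y \<in> borel_measurable M" and "AE \<omega> in M. Y \<omega> = \<mu>"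
    moreover from this have "expectation Y = \<mu>"
      by (subst integral_cong_AE[where g="\<lambda>_. \<mu>"]) (auto simp: prob_space)
    ultimately have AE: "AE \<omega> in M. Y \<omega> = 0" using mean by simp
    have "integrable M (\<lambda>\<omega>. Y \<omega> ^ k)"
      using AE by (subst integrable_cong_AE[where g="\<lambda>_. 0 ^ k"]) auto
    moreover have "expectation (\<lambda>\<omega>. (Y \<omega>)\<^sup>2) = expectation (\<lambda>_. 0)"
      using AE by (intro integral_cong_AE) auto
    moreover have "expectation (\<lambda>\<omega>. cos (Y \<omega> + b)) = expectation (\<lambda>_. cos b)"
      using AE by (intro integral_cong_AE) auto
    ultimately show ?thesis by (simp add: prob_space)
  qed
  then show "Y \<in> borel_measurable M" and "integrable M (\<lambda>\<omega>. Y \<omega> ^ k)"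
    and "expectation (\<lambda>\<omega>. cos (Y \<omega> + b)) = cos b * exp (- expectation (\<lambda>\<omega>. (Y \<omega>)\<^sup>2) / 2)" by auto
qed

lemma lborel_integral_prod_vec:
  fixes h :: "'n::finite \<Rightarrow> real \<Rightarrow> real"
  assumes h: "\<And>i. integrable lborel (h i)"
  shows "(LINT x|lborel. (\<Prod>i\<in>UNIV. h i (x $ i))) = (\<Prod>i\<in>UNIV. LINT u|lborel. h i u)"
proof -
  interpret product_sigma_finite "\<lambda>_ :: real ^ 'n. lborel :: real measure" ..
  let ?B = "Basis :: (real ^ 'n) set"
  \<comment> \<open>\<open>lborel\<close> is the image of a product measure indexed by basis
    vectors; \<open>ix\<close> returns the coordinate to which a basis vector belongs.\<close>
  define ix where "ix b = (THE i. b = axis i (1::real))" for b :: "real ^ 'n"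
  have ix: "ix (axis i 1) = i" for i unfolding ix_def by (auto simp: axis_eq_axis)
  have B: "?B = range (\<lambda>i. axis i 1)" by (auto simp: Basis_vec_def)
  have inj: "inj (\<lambda>i :: 'n. axis i (1::real))" by (auto simp: inj_on_def axis_eq_axis)
  have reidx: "(\<Prod>b\<in>?B. F b) = (\<Prod>i\<in>UNIV. F (axis i 1))" for F :: "real ^ 'n \<Rightarrow> real"
    unfolding B using inj by (subst prod.reindex) auto
  have m: "(\<lambda>x :: real ^ 'n. \<Prod>i\<in>UNIV. h i (x $ i)) \<in> borel_measurable borel"
    using h by (intro borel_measurable_prod measurable_compose[OF _ borel_measurable_integrable[OF h, simplified]]) auto
  have "(LINT x|lborel. (\<Prod>i\<in>UNIV. h i (x $ i)))
    = (LINT f|PiM ?B (\<lambda>_. lborel). (\<Prod>i\<in>UNIV. h i ((\<Sum>b\<in>?B. f b *\<^sub>R b) $ i)))"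
    by (subst lborel_eq, subst integral_distr) (use m in auto)
  also have "\<dots> = (LINT f|PiM ?B (\<lambda>_. lborel). (\<Prod>b\<in>?B. h (ix b) (f b)))"
  proof (rule Bochner_Integration.integral_cong[OF refl])
    fix f :: "real ^ 'n \<Rightarrow> real"
    have "(\<Sum>b\<in>?B. f b *\<^sub>R b) $ i = f (axis i 1)" for i
    proof -
      have "(\<Sum>b\<in>?B. f b *\<^sub>R b) $ i = (\<Sum>b\<in>?B. f b *\<^sub>R b) \<bullet> axis i 1" by (simp add: cart_eq_inner_axis)
      also have "\<dots> = f (axis i 1)" by (rule inner_sum_left_Basis) (simp add: B)
      finally show ?thesis .
    qed
    then show "(\<Prod>i\<in>UNIV. h i ((\<Sum>b\<in>?B. f b *\<^sub>R b) $ i)) = (\<Prod>b\<in>?B. h (ix b) (f b))"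
      by (simp add: reidx ix)
  qed
  also have "\<dots> = (\<Prod>b\<in>?B. LINT u|lborel. h (ix b) u)"
    using h by (intro product_integral_prod) auto
  finally show ?thesis by (simp add: reidx ix)
qed

section \<open>Gaussian structure of fractional Brownian motion\<close>

definition fbm_cov :: "real \<Rightarrow> real \<Rightarrow> real \<Rightarrow> real" where
  "fbm_cov H s t = (s powr (2 * H) + t powr (2 * H) - \<bar>t - s\<bar> powr (2 * H)) / 2"

lemma process_law_nn_integral:
  assumes "process_law M Y = process_law N Z"
    and [measurable]: "\<And>t. 0 \<le> t \<Longrightarrow> Y t \<in> borel_measurable M" "\<And>t. 0 \<le> t \<Longrightarrow> Z t \<in> borel_measurable N"
    and G: "G \<in> borel_measurable path_space"
  shows "(\<integral>\<^sup>+\<omega>. G (\<lambda>t\<in>{0..}. Y t \<omega>) \<partial>M) = (\<integral>\<^sup>+\<omega>. G (\<lambda>t\<in>{0..}. Z t \<omega>) \<partial>N)"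
proof -
  have "(\<lambda>\<omega>. \<lambda>t\<in>{0..}. Y t \<omega>) \<in> M \<rightarrow>\<^sub>M path_space" "(\<lambda>\<omega>. \<lambda>t\<in>{0..}. Z t \<omega>) \<in> N \<rightarrow>\<^sub>M path_space"
    using assms(2,3) by (auto intro!: measurable_restrict)
  note m = this
  have "(\<integral>\<^sup>+\<omega>. G (\<lambda>t\<in>{0..}. Y t \<omega>) \<partial>M) = integral\<^sup>N (process_law M Y) G"
    unfolding process_law_def using m(1) G by (subst nn_integral_distr) auto
  also have "\<dots> = (\<integral>\<^sup>+\<omega>. G (\<lambda>t\<in>{0..}. Z t \<omega>) \<partial>N)"
    unfolding assms(1) unfolding process_law_def using m(2) G by (subst nn_integral_distr) auto
  finally show ?thesis .
qed

lemma process_law_integral_component: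
  fixes g :: "'b::topological_space \<Rightarrow> real"
  assumes "process_law M Y = process_law N Z"
    and "\<And>t. 0 \<le> t \<Longrightarrow> Y t \<in> borel_measurable M" "\<And>t. 0 \<le> t \<Longrightarrow> Z t \<in> borel_measurable N"
    and t: "0 \<le> t" and g: "g \<in> borel_measurable borel"
  shows "(LINT \<omega>|M. g (Y t \<omega>)) = (LINT \<omega>|N. g (Z t \<omega>))"
    and "integrable M (\<lambda>\<omega>. g (Y t \<omega>)) \<longleftrightarrow> integrable N (\<lambda>\<omega>. g (Z t \<omega>))"
proof -
  have m: "(\<lambda>\<omega>. \<lambda>t\<in>{0..}. Y t \<omega>) \<in> M \<rightarrow>\<^sub>M path_space" "(\<lambda>\<omega>. \<lambda>t\<in>{0..}. Z t \<omega>) \<in> N \<rightarrow>\<^sub>M path_space"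
    using assms(2,3) by (auto intro!: measurable_restrict)
  have "(\<lambda>f. g (f t)) \<in> borel_measurable path_space"
    using t by (intro measurable_compose[OF _ g] measurable_component_singleton) auto
  from integral_distr[OF m(1) this] integral_distr[OF m(2) this]
    integrable_distr_eq[OF m(1) this] integrable_distr_eq[OF m(2) this]
  show "(LINT \<omega>|M. g (Y t \<omega>)) = (LINT \<omega>|N. g (Z t \<omega>))"
    "integrable M (\<lambda>\<omega>. g (Y t \<omega>)) \<longleftrightarrow> integrable N (\<lambda>\<omega>. g (Z t \<omega>))"
    using assms(1) t unfolding process_law_def by simp_all
qed

context fractional_brownian_motion
begin

lemma moments_at_1:
  shows "expectation (\<lambda>\<omega>. X 1 \<omega> $ i) = 0" and "expectation (\<lambda>\<omega>. (X 1 \<omega> $ i)\<^sup>2) = 1"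
proof -
  have *: "expectation (\<lambda>\<omega>. (X 1 \<omega> $ i) ^ k) = (LINT u|lborel. std_normal_density u * u ^ k)" for k
  proof -
    let ?h = "\<lambda>j u. std_normal_density u * (if j = i then u ^ k else 1)"
    have "expectation (\<lambda>\<omega>. (X 1 \<omega> $ i) ^ k) = (LINT x|lborel. (\<Prod>j\<in>UNIV. std_normal_density (x $ j)) * (x $ i) ^ k)"
      by (rule distributed_integral[OF standard_normal_at_1, symmetric]) (auto intro!: prod_nonneg)
    also have "\<dots> = (LINT x|lborel. (\<Prod>j\<in>UNIV. ?h j ((x :: real ^ 'n) $ j)))"
      by (simp add: prod.distrib)
    also have "\<dots> = (\<Prod>j\<in>UNIV. LINT u|lborel. ?h j u)"
    proof (rule lborel_integral_prod_vec)
      fix j :: 'n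
      show "integrable lborel (?h j)"
        using integrable_normal_moment[of 1 0 k] by (cases "j = i") auto
    qed
    also have "\<dots> = (LINT u|lborel. std_normal_density u * u ^ k)"
      by (subst prod.remove[of _ i]) auto
    finally show ?thesis .
  qed
  show "expectation (\<lambda>\<omega>. X 1 \<omega> $ i) = 0" using *[of 1] integral_std_normal_moment_odd[of 0] by simp
  show "expectation (\<lambda>\<omega>. (X 1 \<omega> $ i)\<^sup>2) = 1" using *[of 2] integral_std_normal_moment_even[of 1] by simp
qed

lemma gaussian_component:
  assumes "0 \<le> t" shows "gaussian_rv M (\<lambda>\<omega>. X t \<omega> $ i)"
proof -
  have "gaussian_rv M (\<lambda>\<omega>. \<Sum>s\<in>{t}. axis i 1 \<bullet> X s \<omega>)"
    using gaussian[unfolded gaussian_process_def, rule_format, of "{t}" "\<lambda>_. axis i 1"] assms by simp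
  then show ?thesis by (simp add: inner_axis')
qed

lemma component_scaling:
  fixes g :: "real \<Rightarrow> real"
  assumes "0 < c" and [measurable]: "g \<in> borel_measurable borel"
  shows "expectation (\<lambda>\<omega>. g (X c \<omega> $ i)) = expectation (\<lambda>\<omega>. g (c powr H * X 1 \<omega> $ i))"
proof -
  have m: "X (c * t) \<in> borel_measurable M" "(\<lambda>\<omega>. c powr H *\<^sub>R X t \<omega>) \<in> borel_measurable M" if "0 \<le> t" for t
    using measurable_X[of "c * t"] measurable_X[OF that] assms(1) that by auto
  have "(\<lambda>x :: real ^ 'n. g (x $ i)) \<in> borel_measurable borel" by measurable
  from process_law_integral_component(1)[OF self_similar[OF assms(1)] m, of 1, OF _ _ _ this]
  show ?thesis by simp
qed

lemma start_zero': "AE \<omega> in M. X 0 \<omega> $ i = 0"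
  using start_zero by (auto simp: vec_eq_iff)

lemma mean_zero: "0 \<le> t \<Longrightarrow> expectation (\<lambda>\<omega>. X t \<omega> $ i) = 0"
  and variance_X: "0 \<le> t \<Longrightarrow> expectation (\<lambda>\<omega>. (X t \<omega> $ i)\<^sup>2) = t powr (2 * H)"
proof -
  assume t: "0 \<le> t"
  have [measurable]: "X t \<in> borel_measurable M" using measurable_X t by simp
  have "expectation (\<lambda>\<omega>. X t \<omega> $ i) = 0 \<and> expectation (\<lambda>\<omega>. (X t \<omega> $ i)\<^sup>2) = t powr (2 * H)"
  proof (cases "t = 0")
    \<comment> \<open>Self-similarity concerns positive factors only; time 0 rests on the almost
      sure start in 0.\<close>
    case True
    have "AE \<omega> in M. X t \<omega> $ i = 0" "AE \<omega> in M. (X t \<omega> $ i)\<^sup>2 = 0" using start_zero'[of i] True by auto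
    from integral_cong_AE[OF _ _ this(1)] integral_cong_AE[OF _ _ this(2)]
    have "expectation (\<lambda>\<omega>. X t \<omega> $ i) = 0" "expectation (\<lambda>\<omega>. (X t \<omega> $ i)\<^sup>2) = 0" by simp_all
    then show ?thesis using True by simp
  next
    case False
    then have "0 < t" using t by simp
    have "(t powr H)\<^sup>2 = t powr (2 * H)"
      by (simp add: power2_eq_square powr_add[symmetric])
    then show ?thesis
      using component_scaling[OF \<open>0 < t\<close>, of "\<lambda>x. x" i] component_scaling[OF \<open>0 < t\<close>, of "\<lambda>x. x\<^sup>2" i]
      by (simp add: moments_at_1 power_mult_distrib)
  qed
  then show "expectation (\<lambda>\<omega>. X t \<omega> $ i) = 0" "expectation (\<lambda>\<omega>. (X t \<omega> $ i)\<^sup>2) = t powr (2 * H)" by auto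
qed

lemma integrable_power_component: "0 \<le> t \<Longrightarrow> integrable M (\<lambda>\<omega>. (X t \<omega> $ i) ^ k)"
  using gaussian_rv_centred(2)[OF gaussian_component mean_zero] .

lemma integrable_product_component:
  assumes "0 \<le> s" "0 \<le> t"
  shows "integrable M (\<lambda>\<omega>. X s \<omega> $ i * X t \<omega> $ j)"
proof (rule Bochner_Integration.integrable_bound)
  show "integrable M (\<lambda>\<omega>. (X s \<omega> $ i)\<^sup>2 + (X t \<omega> $ j)\<^sup>2)"
    using integrable_power_component assms by auto
  have [measurable]: "X s \<in> borel_measurable M" "X t \<in> borel_measurable M" using measurable_X assms by auto
  show "(\<lambda>\<omega>. X s \<omega> $ i * X t \<omega> $ j) \<in> borel_measurable M" by measurable
  have "\<bar>x * y\<bar> \<le> x\<^sup>2 + y\<^sup>2" for x y :: real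
  proof -
    have "2 * \<bar>x * y\<bar> \<le> x\<^sup>2 + y\<^sup>2"
      using sum_squares_bound[of "\<bar>x\<bar>" "\<bar>y\<bar>"] by (simp add: abs_mult mult.assoc)
    then show ?thesis using abs_ge_zero[of "x * y"] by linarith
  qed
  then show "AE \<omega> in M. norm (X s \<omega> $ i * X t \<omega> $ j) \<le> norm ((X s \<omega> $ i)\<^sup>2 + (X t \<omega> $ j)\<^sup>2)" by auto
qed

lemma variance_increment:
  assumes "0 \<le> s" "0 \<le> t"
  shows "expectation (\<lambda>\<omega>. (X t \<omega> $ i - X s \<omega> $ i)\<^sup>2) = \<bar>t - s\<bar> powr (2 * H)"
proof -
  have le: "expectation (\<lambda>\<omega>. (X t \<omega> $ i - X s \<omega> $ i)\<^sup>2) = \<bar>t - s\<bar> powr (2 * H)" if "0 \<le> s" "s \<le> t" for s t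
  proof -
    have [measurable]: "X 0 \<in> borel_measurable M" "X (t - s) \<in> borel_measurable M" using measurable_X that by auto
    have "expectation (\<lambda>\<omega>. (X t \<omega> $ i - X s \<omega> $ i)\<^sup>2) = expectation (\<lambda>\<omega>. (X (t - s) \<omega> $ i - X 0 \<omega> $ i)\<^sup>2)"
      using process_law_integral_component(1)[OF stationary_increments[OF that(1)], of "t - s" "\<lambda>x. (x $ i)\<^sup>2"] that measurable_X
      by (simp add: borel_measurable_diff)
    also have "\<dots> = expectation (\<lambda>\<omega>. (X (t - s) \<omega> $ i)\<^sup>2)"
      using start_zero'[of i] by (intro integral_cong_AE) auto
    finally show ?thesis using variance_X[of "t - s"] that by simp
  qed
  show ?thesis
    using le[of s t] le[of t s] assms by (cases "s \<le> t") (auto simp: power2_commute abs_minus_commute)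
qed

lemma covariance:
  assumes "0 \<le> s" "0 \<le> t"
  shows "expectation (\<lambda>\<omega>. X s \<omega> $ i * X t \<omega> $ j) = (if i = j then fbm_cov H s t else 0)"
proof (cases "i = j")
  case True
  have I: "integrable M (\<lambda>\<omega>. (X s \<omega> $ i)\<^sup>2)" "integrable M (\<lambda>\<omega>. (X t \<omega> $ i)\<^sup>2)"
    using integrable_power_component assms by auto
  have "expectation (\<lambda>\<omega>. (X t \<omega> $ i - X s \<omega> $ i)\<^sup>2)
    = expectation (\<lambda>\<omega>. (X t \<omega> $ i)\<^sup>2 + (X s \<omega> $ i)\<^sup>2 - 2 * (X s \<omega> $ i * X t \<omega> $ i))"
    by (simp add: power2_diff mult_ac)
  also have "\<dots> = t powr (2 * H) + s powr (2 * H) - 2 * expectation (\<lambda>\<omega>. X s \<omega> $ i * X t \<omega> $ i)"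
    using I integrable_product_component[OF assms, of i i] assms by (simp add: variance_X)
  finally show ?thesis using True by (simp add: variance_increment[OF assms] fbm_cov_def)
next
  case False
  \<comment> \<open>Reading the path of component \<open>i\<close> at time \<open>s\<close> and all
    other paths at time \<open>t\<close> turns independence of the paths into independence of real
    variables.\<close>
  have "indep_vars (\<lambda>_. borel) (\<lambda>k \<omega>. (\<lambda>t\<in>{0..}. X t \<omega> $ k) (if k = i then s else t)) (UNIV :: 'n set)"
    by (rule indep_vars_compose2[OF independent_components])
      (use assms in \<open>auto intro!: measurable_component_singleton\<close>)
  moreover have "(\<lambda>t\<in>{0..}. X t \<omega> $ k) (if k = i then s else t) = X (if k = i then s else t) \<omega> $ k" for k \<omega>
    using assms by auto
  ultimately have iv: "indep_vars (\<lambda>_. borel) (\<lambda>k \<omega>. X (if k = i then s else t) \<omega> $ k) (UNIV :: 'n set)"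
    by (simp only:)
  have "expectation (\<lambda>\<omega>. \<Prod>k\<in>{i, j}. X (if k = i then s else t) \<omega> $ k)
    = (\<Prod>k\<in>{i, j}. expectation (\<lambda>\<omega>. X (if k = i then s else t) \<omega> $ k))"
    using integrable_power_component[of _ _ 1] assms
    by (intro indep_vars_lebesgue_integral indep_vars_subset[OF iv]) auto
  then have "expectation (\<lambda>\<omega>. X s \<omega> $ i * X t \<omega> $ j) = expectation (\<lambda>\<omega>. X s \<omega> $ i) * expectation (\<lambda>\<omega>. X t \<omega> $ j)"
    using False by auto
  then show ?thesis using False assms by (simp add: mean_zero)
qed

lemma covariance_inner:
  assumes "0 \<le> s" "0 \<le> t"
  shows "expectation (\<lambda>\<omega>. (a \<bullet> X s \<omega>) * (b \<bullet> X t \<omega>)) = (a \<bullet> b) * fbm_cov H s t"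
    and "integrable M (\<lambda>\<omega>. (a \<bullet> X s \<omega>) * (b \<bullet> X t \<omega>))"
proof -
  have eq: "(a \<bullet> X s \<omega>) * (b \<bullet> X t \<omega>) = (\<Sum>i\<in>UNIV. \<Sum>j\<in>UNIV. (a $ i * b $ j) * (X s \<omega> $ i * X t \<omega> $ j))" for \<omega>
    by (simp add: inner_vec_def sum_product mult_ac)
  show "integrable M (\<lambda>\<omega>. (a \<bullet> X s \<omega>) * (b \<bullet> X t \<omega>))"
    unfolding eq using integrable_product_component[OF assms] by auto
  show "expectation (\<lambda>\<omega>. (a \<bullet> X s \<omega>) * (b \<bullet> X t \<omega>)) = (a \<bullet> b) * fbm_cov H s t"
    unfolding eq using integrable_product_component[OF assms]
    by (simp add: covariance[OF assms] if_distrib inner_vec_def sum_distrib_right cong: if_cong)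
qed

text \<open>Together with \<open>distr_PiM_vec_eqI_cos\<close> this reduces a comparison of laws to
  an identity between quadratic forms.\<close>

proposition characteristic_function:
  assumes T: "finite T" "T \<subseteq> {0..}"
  shows "expectation (\<lambda>\<omega>. cos ((\<Sum>t\<in>T. a t \<bullet> X t \<omega>) + b))
    = cos b * exp (- (\<Sum>s\<in>T. \<Sum>t\<in>T. (a s \<bullet> a t) * fbm_cov H s t) / 2)"
proof -
  let ?Y = "\<lambda>\<omega>. \<Sum>t\<in>T. a t \<bullet> X t \<omega>"
  have int1: "integrable M (\<lambda>\<omega>. X t \<omega> $ i)" if "t \<in> T" for t i
    using integrable_power_component[of t i 1] T that by auto
  have g: "gaussian_rv M ?Y" using gaussian T unfolding gaussian_process_def by blast
  have "expectation ?Y = (\<Sum>t\<in>T. \<Sum>i\<in>UNIV. a t $ i * expectation (\<lambda>\<omega>. X t \<omega> $ i))"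
    unfolding inner_vec_def using int1 by (simp add: inner_real_def)
  also have "\<dots> = 0" using T by (simp add: mean_zero subset_eq)
  finally have mean: "expectation ?Y = 0" .
  have "expectation (\<lambda>\<omega>. (?Y \<omega>)\<^sup>2) = expectation (\<lambda>\<omega>. \<Sum>s\<in>T. \<Sum>t\<in>T. (a s \<bullet> X s \<omega>) * (a t \<bullet> X t \<omega>))"
    by (simp add: power2_eq_square sum_product)
  also have "\<dots> = (\<Sum>s\<in>T. \<Sum>t\<in>T. expectation (\<lambda>\<omega>. (a s \<bullet> X s \<omega>) * (a t \<bullet> X t \<omega>)))"
    using T by (simp add: covariance_inner(2) subset_eq)
  also have "\<dots> = (\<Sum>s\<in>T. \<Sum>t\<in>T. (a s \<bullet> a t) * fbm_cov H s t)"
    using T by (intro sum.cong refl covariance_inner(1)) auto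
  finally show ?thesis using gaussian_rv_centred(3)[OF g mean, of b] by simp
qed

end

section \<open>The covariance kernel dominates Brownian motion\<close>

text \<open>For \<open>0 \<le> a < b\<close> and \<open>0 \<le> t\<close> this is the length of the
  intersection of [0, t] and [a, b], divided by \<open>b - a\<close>. Primitives of square
  integrable functions, such as this one, make up the Cameron-Martin space of Brownian
  motion.\<close>

definition ramp :: "real \<Rightarrow> real \<Rightarrow> real \<Rightarrow> real" where
  "ramp a b t = max 0 (min 1 ((t - a) / (b - a)))"

lemma ramp_simps:
  assumes "a < b"
  shows "t \<le> a \<Longrightarrow> ramp a b t = 0" "b \<le> t \<Longrightarrow> ramp a b t = 1"
  using assms by (auto simp: ramp_def divide_nonpos_nonneg divide_le_eq)

lemma lborel_integral_Icc_Int: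
  fixes a b c d :: real
  shows "(LINT u|lborel. indicator {a..b} u * indicator {c..d} u :: real) = max 0 (min b d - max a c)"
proof -
  have "(LINT u|lborel. indicator {a..b} u * indicator {c..d} u :: real) = (LINT u|lborel. indicator {max a c..min b d} u)"
    by (intro Bochner_Integration.integral_cong) (auto split: split_indicator)
  then show ?thesis by (simp add: max_def)
qed

lemma integrable_Icc_Int [simp, intro]:
  fixes a b c d :: real
  shows "integrable lborel (\<lambda>u. indicator {a..b} u * indicator {c..d} u :: real)"
proof -
  have "integrable lborel (indicator {max a c..min b d} :: real \<Rightarrow> real)"
    by (intro integrable_real_indicator) (auto simp: emeasure_lborel_Icc_eq)
  moreover have "(\<lambda>u. indicator {a..b} u * indicator {c..d} u :: real) = indicator {max a c..min b d}"
    by (auto split: split_indicator)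
  ultimately show ?thesis by simp
qed

text \<open>The quadratic form of a kernel of inner products is the integral of a square, hence
  nonnegative; both kernel inequalities below rest on this.\<close>

lemma integral_square_sum:
  fixes \<phi> :: "'t \<Rightarrow> 'a \<Rightarrow> real"
  assumes "\<And>s t. s \<in> T \<Longrightarrow> t \<in> T \<Longrightarrow> integrable M (\<lambda>u. \<phi> s u * \<phi> t u)"
  shows "(LINT u|M. (\<Sum>t\<in>T. \<alpha> t * \<phi> t u)\<^sup>2) = (\<Sum>s\<in>T. \<Sum>t\<in>T. \<alpha> s * \<alpha> t * (LINT u|M. \<phi> s u * \<phi> t u))"
    and "integrable M (\<lambda>u. (\<Sum>t\<in>T. \<alpha> t * \<phi> t u)\<^sup>2)"
proof -
  have sq: "(\<lambda>u. (\<Sum>t\<in>T. \<alpha> t * \<phi> t u)\<^sup>2) = (\<lambda>u. \<Sum>s\<in>T. \<Sum>t\<in>T. \<alpha> s * \<alpha> t * (\<phi> s u * \<phi> t u))"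
    by (simp add: power2_eq_square sum_product mult_ac)
  have i: "integrable M (\<lambda>u. \<alpha> s * \<alpha> t * (\<phi> s u * \<phi> t u))" if "s \<in> T" "t \<in> T" for s t
    using assms[OF that] by simp
  show "integrable M (\<lambda>u. (\<Sum>t\<in>T. \<alpha> t * \<phi> t u)\<^sup>2)"
    unfolding sq using i by (intro Bochner_Integration.integrable_sum) auto
  have "(LINT u|M. (\<Sum>t\<in>T. \<alpha> t * \<phi> t u)\<^sup>2) = (\<Sum>s\<in>T. \<Sum>t\<in>T. LINT u|M. \<alpha> s * \<alpha> t * (\<phi> s u * \<phi> t u))"
    unfolding sq using i by (simp add: Bochner_Integration.integral_sum Bochner_Integration.integrable_sum)
  then show "(LINT u|M. (\<Sum>t\<in>T. \<alpha> t * \<phi> t u)\<^sup>2) = (\<Sum>s\<in>T. \<Sum>t\<in>T. \<alpha> s * \<alpha> t * (LINT u|M. \<phi> s u * \<phi> t u))"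
    by simp
qed

text \<open>The kernel is the covariance of the increments from 0 of the moving average
  \<open>W (t + r) - W t\<close> of Brownian motion \<open>W\<close>.\<close>
lemma min_kernel_nonneg:
  fixes \<alpha> :: "real \<Rightarrow> real"
  assumes T: "finite T" "T \<subseteq> {0..}" and r: "0 \<le> r"
  shows "0 \<le> (\<Sum>s\<in>T. \<Sum>t\<in>T. \<alpha> s * \<alpha> t * (min s r + min t r - min \<bar>t - s\<bar> r))"
proof -
  let ?\<phi> = "\<lambda>t u. indicator {t..t + r} u - indicator {0..r} u :: real"
  have prod: "?\<phi> s u * ?\<phi> t u = indicator {s..s + r} u * indicator {t..t + r} u - indicator {s..s + r} u * indicator {0..r} u
    - indicator {t..t + r} u * indicator {0..r} u + indicator {0..r} u * indicator {0..r} u" for s t u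
    by (simp add: algebra_simps)
  have int: "integrable lborel (\<lambda>u. ?\<phi> s u * ?\<phi> t u)" for s t
    unfolding prod by auto
  have val: "(LINT u|lborel. ?\<phi> s u * ?\<phi> t u) = min s r + min t r - min \<bar>t - s\<bar> r" if "0 \<le> s" "0 \<le> t" for s t
    unfolding prod using that r
    by (simp add: lborel_integral_Icc_Int)
  have "0 \<le> (LINT u|lborel. (\<Sum>t\<in>T. \<alpha> t * ?\<phi> t u)\<^sup>2)" by simp
  also have "\<dots> = (\<Sum>s\<in>T. \<Sum>t\<in>T. \<alpha> s * \<alpha> t * (LINT u|lborel. ?\<phi> s u * ?\<phi> t u))"
    using int by (rule integral_square_sum)
  also have "\<dots> = (\<Sum>s\<in>T. \<Sum>t\<in>T. \<alpha> s * \<alpha> t * (min s r + min t r - min \<bar>t - s\<bar> r))"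
    using T by (intro sum.cong refl arg_cong2[where f="(*)"] val) auto
  finally show ?thesis .
qed

text \<open>A concave \<open>f\<close> with \<open>f 0 = 0\<close> and slope 0 at \<open>c\<close>
  is the integral of \<open>min x r\<close> against minus its second derivative. For
  \<open>f x = x powr (2 * H) - 2 * H * c powr (2 * H - 1) * x\<close> that weight is
  \<open>2 * H * (1 - 2 * H) * r powr (2 * H - 2)\<close>, positive because
  \<open>H < 1 / 2\<close>; the formula is divided by the constant. The integral is computed
  separately below and above \<open>r = x\<close>.\<close>

lemma powr_min_representation:
  fixes H x c :: real
  assumes H: "0 < H" "H < 1 / 2" and x: "0 \<le> x" "x \<le> c" "0 < c"
  shows "((\<lambda>r. min x r * r powr (2 * H - 2)) has_integral
    (x powr (2 * H) / (2 * H * (1 - 2 * H)) - x * c powr (2 * H - 1) / (1 - 2 * H))) {0..c}"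
proof (cases "x = 0")
  case True
  have "((\<lambda>r. min x r * r powr (2 * H - 2)) has_integral 0) {0..c}"
    by (rule has_integral_spike[OF negligible_empty, of _ _ "\<lambda>_. 0"]) (use True in auto)
  then show ?thesis using True H by simp
next
  case False
  then have "0 < x" using x by simp
  have "((\<lambda>r. r powr (2 * H - 1)) has_integral (x powr (2 * H - 1 + 1) / (2 * H - 1 + 1))) {0..x}"
    using H x by (intro has_integral_powr_from_0) auto
  then have 1: "((\<lambda>r. min x r * r powr (2 * H - 2)) has_integral (x powr (2 * H) / (2 * H))) {0..x}"
  proof (subst has_integral_cong[where g="\<lambda>r. r powr (2 * H - 1)"])
    fix r assume "r \<in> {0..x}"
    then show "min x r * r powr (2 * H - 2) = r powr (2 * H - 1)"
      by (cases "r = 0") (auto simp: powr_mult_base[symmetric] powr_diff power2_eq_square field_simps powr_numeral)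
  qed simp
  have 2: "((\<lambda>r. min x r * r powr (2 * H - 2)) has_integral
      (x * c powr (2 * H - 1) / (2 * H - 1) - x * x powr (2 * H - 1) / (2 * H - 1))) {x..c}"
  proof (rule fundamental_theorem_of_calculus[where f="\<lambda>r. x * r powr (2 * H - 1) / (2 * H - 1)", OF x(2)])
    fix r assume r: "r \<in> {x..c}"
    have "((\<lambda>r. x * r powr (2 * H - 1) / (2 * H - 1)) has_real_derivative
      x * ((2 * H - 1) * r powr (2 * H - 1 - 1)) / (2 * H - 1)) (at r within {x..c})"
      using r \<open>0 < x\<close> by (auto intro!: derivative_eq_intros)
    also have "x * ((2 * H - 1) * r powr (2 * H - 1 - 1)) / (2 * H - 1) = min x r * r powr (2 * H - 2)"
      using r H by (simp add: min_def)
    finally show "((\<lambda>r. x * r powr (2 * H - 1) / (2 * H - 1)) has_vector_derivative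
      min x r * r powr (2 * H - 2)) (at r within {x..c})"
      by (simp add: has_real_derivative_iff_has_vector_derivative)
  qed
  have "x * x powr (2 * H - 1) = x powr (2 * H)"
    using \<open>0 < x\<close> by (simp add: powr_mult_base)
  then have "x powr (2 * H) / (2 * H) + (x * c powr (2 * H - 1) / (2 * H - 1) - x * x powr (2 * H - 1) / (2 * H - 1))
    = x powr (2 * H) / (2 * H * (1 - 2 * H)) - x * c powr (2 * H - 1) / (1 - 2 * H)"
  proof -
    define p where "p = 1 - 2 * H"
    have "0 < p" and mp: "2 * H - 1 = - p" and "p + 2 * H = 1" using H by (auto simp: p_def)
    moreover have "x powr (2 * H) / (2 * H) + x powr (2 * H) / p = x powr (2 * H) * (p + 2 * H) / (2 * H * p)"
      using H \<open>0 < p\<close> by (simp add: field_simps)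
    ultimately show ?thesis
      using \<open>x * x powr (2 * H - 1) = x powr (2 * H)\<close> unfolding p_def[symmetric] mp by simp
  qed
  then show ?thesis using has_integral_combine[OF x(1,2) 1 2] by simp
qed

text \<open>Under \<open>f \<mapsto> f s + f t - f \<bar>t - s\<bar>\<close> the power gives
  \<open>2 * fbm_cov H s t\<close>, and the linear function with slope \<beta> gives
  \<open>2 * \<beta> * min s t\<close>, a multiple of the Brownian covariance. For their difference
  the quadratic form is a positive mixture of those in \<open>min_kernel_nonneg\<close>. The slope
  is the derivative of \<open>x powr (2 * H)\<close> at \<open>c\<close>, the largest for which the
  difference is still increasing on [0, c].\<close>

lemma brownian_le_fbm_cov:
  assumes H: "0 < H" "H < 1 / 2" and c: "0 < c" and T: "finite T" "T \<subseteq> {0..c}"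
  shows "2 * H * c powr (2 * H - 1) * (\<Sum>s\<in>T. \<Sum>t\<in>T. \<alpha> s * \<alpha> t * min s t)
    \<le> (\<Sum>s\<in>T. \<Sum>t\<in>T. \<alpha> s * \<alpha> t * fbm_cov H s t)"
proof -
  define \<kappa> where "\<kappa> = 2 * H * (1 - 2 * H)"
  define \<beta> where "\<beta> = 2 * H * c powr (2 * H - 1)"
  have \<kappa>: "0 < \<kappa>" using H by (simp add: \<kappa>_def)
  define J where "J x = (x powr (2 * H) - \<beta> * x) / \<kappa>" for x
  have J: "((\<lambda>r. min x r * r powr (2 * H - 2)) has_integral J x) {0..c}" if "0 \<le> x" "x \<le> c" for x
  proof -
    have "1 - 2 * H \<noteq> 0" "H \<noteq> 0" using H by auto
    then have "J x = x powr (2 * H) / (2 * H * (1 - 2 * H)) - x * c powr (2 * H - 1) / (1 - 2 * H)"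
      unfolding J_def \<kappa>_def \<beta>_def diff_divide_distrib by simp
    then show ?thesis using powr_min_representation[OF H that c] by simp
  qed
  have "((\<lambda>r. \<Sum>s\<in>T. \<Sum>t\<in>T. \<alpha> s * \<alpha> t * (min s r * r powr (2 * H - 2) + min t r * r powr (2 * H - 2)
      - min \<bar>t - s\<bar> r * r powr (2 * H - 2)))
    has_integral (\<Sum>s\<in>T. \<Sum>t\<in>T. \<alpha> s * \<alpha> t * (J s + J t - J \<bar>t - s\<bar>))) {0..c}"
  proof -
    have T': "0 \<le> s" "s \<le> c" if "s \<in> T" for s using T that by auto
    have "\<bar>t - s\<bar> \<le> c" if "s \<in> T" "t \<in> T" for s t using T'[of s] T'[of t] that by auto
    with T' T show ?thesis
      by (intro has_integral_sum has_integral_mult_right has_integral_diff has_integral_add J) auto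
  qed
  then have "0 \<le> (\<Sum>s\<in>T. \<Sum>t\<in>T. \<alpha> s * \<alpha> t * (J s + J t - J \<bar>t - s\<bar>))"
  proof (rule has_integral_nonneg)
    fix r assume "r \<in> {0..c}"
    then have "0 \<le> r powr (2 * H - 2) * (\<Sum>s\<in>T. \<Sum>t\<in>T. \<alpha> s * \<alpha> t * (min s r + min t r - min \<bar>t - s\<bar> r))"
      using T by (intro mult_nonneg_nonneg min_kernel_nonneg) auto
    then show "0 \<le> (\<Sum>s\<in>T. \<Sum>t\<in>T. \<alpha> s * \<alpha> t * (min s r * r powr (2 * H - 2) + min t r * r powr (2 * H - 2)
      - min \<bar>t - s\<bar> r * r powr (2 * H - 2)))"
      by (simp add: sum_distrib_left algebra_simps)
  qed
  also have "(\<Sum>s\<in>T. \<Sum>t\<in>T. \<alpha> s * \<alpha> t * (J s + J t - J \<bar>t - s\<bar>))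
    = (\<Sum>s\<in>T. \<Sum>t\<in>T. (2 / \<kappa>) * (\<alpha> s * \<alpha> t * fbm_cov H s t) - (2 * \<beta> / \<kappa>) * (\<alpha> s * \<alpha> t * min s t))"
  proof (intro sum.cong refl)
    fix s t
    have "\<beta> * s + \<beta> * t - \<beta> * \<bar>t - s\<bar> = 2 * \<beta> * min s t" by (auto simp: min_def abs_if algebra_simps)
    moreover have "J s + J t - J \<bar>t - s\<bar> = (s powr (2 * H) + t powr (2 * H) - \<bar>t - s\<bar> powr (2 * H)
      - (\<beta> * s + \<beta> * t - \<beta> * \<bar>t - s\<bar>)) / \<kappa>"
      unfolding J_def by (simp add: diff_divide_distrib add_divide_distrib)
    ultimately have "J s + J t - J \<bar>t - s\<bar> = (2 / \<kappa>) * fbm_cov H s t - (2 * \<beta> / \<kappa>) * min s t"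
      by (simp add: fbm_cov_def diff_divide_distrib add_divide_distrib)
    then show "\<alpha> s * \<alpha> t * (J s + J t - J \<bar>t - s\<bar>)
      = (2 / \<kappa>) * (\<alpha> s * \<alpha> t * fbm_cov H s t) - (2 * \<beta> / \<kappa>) * (\<alpha> s * \<alpha> t * min s t)"
      by (simp only: right_diff_distrib mult_ac)
  qed
  also have "\<dots> = (2 / \<kappa>) * ((\<Sum>s\<in>T. \<Sum>t\<in>T. \<alpha> s * \<alpha> t * fbm_cov H s t) - \<beta> * (\<Sum>s\<in>T. \<Sum>t\<in>T. \<alpha> s * \<alpha> t * min s t))"
    unfolding sum_subtractf sum_distrib_left[symmetric] by (simp add: right_diff_distrib)
  finally have "0 \<le> (2 / \<kappa>) * ((\<Sum>s\<in>T. \<Sum>t\<in>T. \<alpha> s * \<alpha> t * fbm_cov H s t) - \<beta> * (\<Sum>s\<in>T. \<Sum>t\<in>T. \<alpha> s * \<alpha> t * min s t))" .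
  then have "0 \<le> (\<Sum>s\<in>T. \<Sum>t\<in>T. \<alpha> s * \<alpha> t * fbm_cov H s t) - \<beta> * (\<Sum>s\<in>T. \<Sum>t\<in>T. \<alpha> s * \<alpha> t * min s t)"
    unfolding zero_le_mult_iff using \<kappa> by (auto simp: divide_le_0_iff)
  then show ?thesis by (simp add: \<beta>_def)
qed

text \<open>Cauchy-Schwarz in L2 for the indicator \<open>h\<close> of [a, b] and the step function
  \<open>f\<close>, whose square norm is the Brownian quadratic form.\<close>

lemma ramp_le_brownian:
  assumes ab: "0 \<le> a" "a < b" and T: "finite T" "T \<subseteq> {0..}"
  shows "(b - a) * (\<Sum>t\<in>T. \<alpha> t * ramp a b t)\<^sup>2 \<le> (\<Sum>s\<in>T. \<Sum>t\<in>T. \<alpha> s * \<alpha> t * min s t)"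
proof -
  define S where "S = (\<Sum>t\<in>T. \<alpha> t * ramp a b t)"
  define f where "f u = (\<Sum>t\<in>T. \<alpha> t * indicator {0..t} u)" for u :: real
  define h where "h = (indicator {a..b} :: real \<Rightarrow> real)"
  have "(LINT u|lborel. (f u)\<^sup>2) = (\<Sum>s\<in>T. \<Sum>t\<in>T. \<alpha> s * \<alpha> t * max 0 (min s t - max 0 0))"
    unfolding f_def lborel_integral_Icc_Int[symmetric] by (rule integral_square_sum) auto
  also have "\<dots> = (\<Sum>s\<in>T. \<Sum>t\<in>T. \<alpha> s * \<alpha> t * min s t)"
    using T by (intro sum.cong) (auto simp: subset_eq min_def)
  finally have f2: "(LINT u|lborel. (f u)\<^sup>2) = (\<Sum>s\<in>T. \<Sum>t\<in>T. \<alpha> s * \<alpha> t * min s t)" .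
  have if2: "integrable lborel (\<lambda>u. (f u)\<^sup>2)"
    unfolding f_def by (rule integral_square_sum(2)) auto
  have fh: "(\<lambda>u. f u * h u) = (\<lambda>u. \<Sum>t\<in>T. \<alpha> t * (indicator {0..t} u * indicator {a..b} u))"
    by (simp add: f_def h_def sum_distrib_right mult.assoc)
  have ifh: "integrable lborel (\<lambda>u. f u * h u)" unfolding fh by auto
  have "(LINT u|lborel. f u * h u) = (\<Sum>t\<in>T. \<alpha> t * max 0 (min t b - max 0 a))"
    unfolding fh by (subst Bochner_Integration.integral_sum) (auto simp: lborel_integral_Icc_Int)
  also have "\<dots> = (\<Sum>t\<in>T. \<alpha> t * ((b - a) * ramp a b t))"
    using ab by (intro sum.cong) (auto simp: ramp_def min_def max_def field_simps)
  also have "\<dots> = (b - a) * S" by (simp add: S_def sum_distrib_left mult_ac)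
  finally have fh': "(LINT u|lborel. f u * h u) = (b - a) * S" .
  have h2: "(LINT u|lborel. h u) = b - a" "integrable lborel h" using ab by (auto simp: h_def)
  \<comment> \<open>\<open>S * h\<close> is the orthogonal projection of \<open>f\<close> onto the
    line through \<open>h\<close>: the inner product of \<open>f\<close> and \<open>h\<close> is
    \<open>S\<close> times the square norm \<open>b - a\<close> of \<open>h\<close>.\<close>
  have "0 \<le> (LINT u|lborel. (f u - S * h u)\<^sup>2)" by simp
  also have "(\<lambda>u. (f u - S * h u)\<^sup>2) = (\<lambda>u. (f u)\<^sup>2 - 2 * S * (f u * h u) + S\<^sup>2 * h u)"
    by (auto simp: power2_eq_square algebra_simps h_def split: split_indicator)
  also have "(LINT u|lborel. (f u)\<^sup>2 - 2 * S * (f u * h u) + S\<^sup>2 * h u)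
    = (LINT u|lborel. (f u)\<^sup>2) - 2 * S * (LINT u|lborel. f u * h u) + S\<^sup>2 * (LINT u|lborel. h u)"
    using if2 ifh h2(2) by simp
  also have "\<dots> = (LINT u|lborel. (f u)\<^sup>2) - (b - a) * S\<^sup>2"
    unfolding fh' h2(1) by (simp add: power2_eq_square algebra_simps)
  finally show ?thesis unfolding f2 S_def by simp
qed

text \<open>Boundedness of this functional in the covariance seminorm is the dual description of
  membership in the Cameron-Martin space, and the form in which \<open>cameron_martin\<close> asks
  for it. The constant is the Brownian \<open>1 / (b - a)\<close> divided by the factor from the
  kernel comparison.\<close>

proposition ramp_le_fbm_cov:
  assumes H: "0 < H" "H < 1 / 2" and ab: "0 \<le> a" "a < b" and c: "0 < c"
  obtains C where "0 < C" and "\<And>T \<alpha>. finite T \<Longrightarrow> T \<subseteq> {0..c} \<Longrightarrow>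
    (\<Sum>t\<in>T. \<alpha> t * ramp a b t)\<^sup>2 \<le> C * (\<Sum>s\<in>T. \<Sum>t\<in>T. \<alpha> s * \<alpha> t * fbm_cov H s t)"
proof -
  define \<beta> where "\<beta> = 2 * H * c powr (2 * H - 1)"
  have "0 < \<beta> * (b - a)" using H c ab by (simp add: \<beta>_def)
  have "(\<Sum>t\<in>T. \<alpha> t * ramp a b t)\<^sup>2 \<le> (1 / (\<beta> * (b - a))) * (\<Sum>s\<in>T. \<Sum>t\<in>T. \<alpha> s * \<alpha> t * fbm_cov H s t)"
    if T: "finite T" "T \<subseteq> {0..c}" for T \<alpha>
  proof -
    have "\<beta> * ((b - a) * (\<Sum>t\<in>T. \<alpha> t * ramp a b t)\<^sup>2) \<le> \<beta> * (\<Sum>s\<in>T. \<Sum>t\<in>T. \<alpha> s * \<alpha> t * min s t)"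
      using T H c by (intro mult_left_mono ramp_le_brownian[OF ab T(1)]) (auto simp: \<beta>_def)
    also have "\<dots> \<le> (\<Sum>s\<in>T. \<Sum>t\<in>T. \<alpha> s * \<alpha> t * fbm_cov H s t)"
      unfolding \<beta>_def by (rule brownian_le_fbm_cov[OF H c T])
    finally show ?thesis using \<open>0 < \<beta> * (b - a)\<close> by (simp add: field_simps)
  qed
  with \<open>0 < \<beta> * (b - a)\<close> show thesis by (intro that[of "1 / (\<beta> * (b - a))"]) auto
qed

section \<open>Quasi-invariance under Cameron-Martin shifts\<close>

text \<open>The Riesz representation of \<open>l\<close> by an element of the completion, in the form of a
  minimising sequence for the norm on the hyperplane \<open>l = 1\<close>. Here \<open>comb x r y\<close> is
  \<open>x + r y\<close>.\<close>
lemma minimising_sequence: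
  fixes B :: "'e \<Rightarrow> 'e \<Rightarrow> real" and l :: "'e \<Rightarrow> real" and comb :: "'e \<Rightarrow> real \<Rightarrow> 'e \<Rightarrow> 'e"
  assumes V: "\<And>x y r. x \<in> V \<Longrightarrow> y \<in> V \<Longrightarrow> comb x r y \<in> V"
    and B_comb: "\<And>x y z r. x \<in> V \<Longrightarrow> y \<in> V \<Longrightarrow> z \<in> V \<Longrightarrow> B (comb x r y) z = B x z + r * B y z"
    and B_sym: "\<And>x y. x \<in> V \<Longrightarrow> y \<in> V \<Longrightarrow> B x y = B y x"
    and l_comb: "\<And>x y r. x \<in> V \<Longrightarrow> y \<in> V \<Longrightarrow> l (comb x r y) = l x + r * l y"
    and bound: "0 < C" "\<And>x. x \<in> V \<Longrightarrow> (l x)\<^sup>2 \<le> C * B x x"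
    and ex: "x1 \<in> V" "l x1 = 1"
  obtains v m where "0 < m" and "\<And>k::nat. v k \<in> V"
    and "(\<lambda>k. B (v k) (v k)) \<longlonglongrightarrow> m"
    and "\<And>x. x \<in> V \<Longrightarrow> (\<lambda>k. B (v k) x) \<longlonglongrightarrow> m * l x"
    and "\<And>k. B (comb (v (Suc k)) (-1) (v k)) (comb (v (Suc k)) (-1) (v k)) \<le> 4 * (1 / 16) ^ k"
proof -
  define S where "S = {B x x |x. x \<in> V \<and> l x = 1}"
  define m where "m = Inf S"
  have S_ge: "1 / C \<le> b" if "b \<in> S" for b
    using that bound by (force simp: S_def field_simps)
  have S: "S \<noteq> {}" "bdd_below S" using ex S_ge by (auto simp: S_def intro!: bdd_belowI[of _ "1 / C"])
  have "1 / C \<le> m" unfolding m_def using S S_ge by (intro cInf_greatest) auto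
  then have m: "0 < m" using bound(1) by (meson divide_pos_pos less_le_trans zero_less_one)
  have m_le: "m \<le> B x x" if "x \<in> V" "l x = 1" for x
    unfolding m_def using that S by (intro cInf_lower) (auto simp: S_def)
  \<comment> \<open>The rate \<open>1 / 16\<close> gives increments of norm of order
    \<open>(1 / 4) ^ k\<close>, which later yields almost sure convergence.\<close>
  have "\<exists>x. x \<in> V \<and> l x = 1 \<and> B x x < m + (1 / 16) ^ k" for k :: nat
  proof -
    have "m < m + (1 / 16) ^ k" by simp
    then obtain b where "b \<in> S" "b < m + (1 / 16) ^ k"
      using cInf_lessD[OF S(1)] unfolding m_def by metis
    then show ?thesis by (auto simp: S_def)
  qed
  then obtain v where v: "\<And>k. v k \<in> V" "\<And>k. l (v k) = 1" "\<And>k. B (v k) (v k) < m + (1 / 16) ^ k"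
    by metis
  have B_comb2: "B (comb x r y) (comb x r y) = B x x + 2 * r * B x y + r\<^sup>2 * B y y" if "x \<in> V" "y \<in> V" for x y r
    using that V B_comb[of x y "comb x r y" r] B_sym[of x "comb x r y"] B_sym[of y "comb x r y"]
      B_comb[of x y x r] B_comb[of x y y r] B_sym[of x y]
    by (simp add: algebra_simps power2_eq_square)
  have B_nonneg: "0 \<le> B x x" if "x \<in> V" for x
    using bound(1) bound(2)[OF that] by (meson order_trans zero_le_mult_iff zero_le_power2 not_less)
  \<comment> \<open>Moving \<open>v k\<close> along the kernel of \<open>l\<close> stays on the
    hyperplane and cannot bring the square norm below \<open>m\<close>. So a quadratic polynomial in
    \<open>r\<close> is nonnegative, and its discriminant gives the bound.\<close>
  have ortho: "(B (v k) x)\<^sup>2 \<le> (1 / 16) ^ k * B x x" if x: "x \<in> V" "l x = 0" for k x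
  proof -
    have ge: "0 \<le> (1 / 16) ^ k + 2 * r * B (v k) x + r\<^sup>2 * B x x" for r
      using m_le[OF V[OF v(1)[of k] x(1)], of r] v(2,3)[of k] x
      by (simp add: l_comb v(1) B_comb2)
    show ?thesis
    proof (cases "B x x = 0")
      case True
      have "B (v k) x = 0"
      proof (rule ccontr)
        assume "B (v k) x \<noteq> 0"
        then have "(1 / 16) ^ k \<le> (0 :: real)" using ge[of "- ((1 / 16) ^ k) / B (v k) x"] True by simp
        then show False using zero_less_power[of "1 / 16 :: real" k] by linarith
      qed
      then show ?thesis using True by simp
    next
      case False
      then have "0 < B x x" using B_nonneg[OF x(1)] by simp
      then show ?thesis using ge[of "- B (v k) x / B x x"]
        by (simp add: power2_eq_square field_simps)
    qed
  qed
  have pow0: "(\<lambda>k. (1 / 16) ^ k :: real) \<longlonglongrightarrow> 0" by (rule LIMSEQ_realpow_zero) auto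
  have lim: "(\<lambda>k. B (v k) (v k)) \<longlonglongrightarrow> m"
  proof (rule real_tendsto_sandwich[of "\<lambda>_. m" _ _ "\<lambda>k. m + (1 / 16) ^ k"])
    show "(\<lambda>k. m + (1 / 16) ^ k) \<longlonglongrightarrow> m" using tendsto_add[OF tendsto_const pow0, of m] by simp
    show "eventually (\<lambda>k. B (v k) (v k) \<le> m + (1 / 16) ^ k) sequentially"
      using less_imp_le[OF v(3)] by (intro always_eventually) blast
  qed (use m_le v in \<open>auto intro!: always_eventually\<close>)
  have "(\<lambda>k. B (v k) x) \<longlonglongrightarrow> m * l x" if x: "x \<in> V" for x
  proof -
    define D where "D = 2 * B x x + 2 * (l x)\<^sup>2 * (m + 1)"
    have le: "(B (v k) x - l x * B (v k) (v k))\<^sup>2 \<le> (1 / 16) ^ k * D" for k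
    proof -
      \<comment> \<open>Subtracting \<open>l x\<close> times \<open>v k\<close> from
        \<open>x\<close> lands in the kernel of \<open>l\<close>, where the near orthogonality
        applies.\<close>
      let ?y = "comb x (- l x) (v k)"
      have y: "?y \<in> V" "l ?y = 0" using x v V l_comb by auto
      have eq: "B (v k) ?y = B (v k) x - l x * B (v k) (v k)"
        using B_comb[OF x v(1) v(1)] B_sym[OF v(1) y(1)] B_sym[OF v(1) x] by simp
      have "0 \<le> B (comb x (l x) (v k)) (comb x (l x) (v k))" using x v V by (intro B_nonneg) auto
      then have "B ?y ?y \<le> 2 * B x x + 2 * (l x)\<^sup>2 * B (v k) (v k)"
        using B_comb2[OF x v(1)[of k], of "l x"] B_comb2[OF x v(1)[of k], of "- l x"] by (simp add: mult.commute)
      also have "\<dots> \<le> D"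
        unfolding D_def using v(3)[of k] power_le_one[of "1/16 :: real" k]
        by (intro add_mono mult_left_mono) auto
      finally have "B ?y ?y \<le> D" .
      then have "(1 / 16) ^ k * B ?y ?y \<le> (1 / 16) ^ k * D" by (intro mult_left_mono) auto
      then show ?thesis using ortho[OF y, of k] unfolding eq by linarith
    qed
    have "(\<lambda>k. (1 / 16) ^ k * D) \<longlonglongrightarrow> 0" using tendsto_mult_right[OF pow0, of D] by simp
    then have "(\<lambda>k. (B (v k) x - l x * B (v k) (v k))\<^sup>2) \<longlonglongrightarrow> 0"
      by (rule Lim_null_comparison[rotated]) (rule always_eventually, simp add: le)
    from tendsto_real_sqrt[OF this]
    have "(\<lambda>k. \<bar>B (v k) x - l x * B (v k) (v k)\<bar>) \<longlonglongrightarrow> 0" by simp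
    then have "(\<lambda>k. B (v k) x - l x * B (v k) (v k)) \<longlonglongrightarrow> 0" by (rule tendsto_rabs_zero_cancel)
    from tendsto_add[OF this tendsto_mult_left[OF lim, of "l x"]]
    show ?thesis by (simp add: mult.commute)
  qed
  moreover have "B (comb (v (Suc k)) (-1) (v k)) (comb (v (Suc k)) (-1) (v k)) \<le> 4 * (1 / 16) ^ k" for k
  proof -
    \<comment> \<open>The midpoint of \<open>v k\<close> and \<open>v (Suc k)\<close>, again on the
      hyperplane; \<open>comb\<close> leaves its first argument unscaled, so half of
      \<open>v k\<close> is taken off afterwards. The parallelogram identity then bounds the
      difference of the two.\<close>
    let ?h = "comb (comb (v k) (1 / 2) (v (Suc k))) (- 1 / 2) (v k)"
    have h: "?h \<in> V" "l ?h = 1" using v V l_comb by auto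
    have "B ?h ?h = (B (v k) (v k) + 2 * B (v k) (v (Suc k)) + B (v (Suc k)) (v (Suc k))) / 4"
    proof -
      let ?g = "comb (v k) (1 / 2) (v (Suc k))"
      have "?g \<in> V" using V v(1) by blast
      then have "B ?h ?h = B ?g ?g + 2 * (- 1 / 2) * B ?g (v k) + (- 1 / 2)\<^sup>2 * B (v k) (v k)"
        using v(1) by (rule B_comb2)
      moreover have "B ?g ?g = B (v k) (v k) + 2 * (1 / 2) * B (v k) (v (Suc k)) + (1 / 2)\<^sup>2 * B (v (Suc k)) (v (Suc k))"
        using v(1) v(1) by (rule B_comb2)
      moreover have "B ?g (v k) = B (v k) (v k) + 1 / 2 * B (v (Suc k)) (v k)"
        using v(1) v(1) v(1) by (rule B_comb)
      ultimately show ?thesis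
        using B_sym[OF v(1)[of "Suc k"] v(1)[of k]] by (simp add: power2_eq_square)
    qed
    then have "4 * m \<le> B (v k) (v k) + 2 * B (v k) (v (Suc k)) + B (v (Suc k)) (v (Suc k))"
      using m_le[OF h] by simp
    moreover have "0 \<le> ((1 / 16) ^ k :: real)" "(1 / 16) ^ Suc k \<le> ((1 / 16) ^ k :: real)" by simp_all
    moreover have "B (comb (v (Suc k)) (-1) (v k)) (comb (v (Suc k)) (-1) (v k))
      = B (v (Suc k)) (v (Suc k)) - 2 * B (v k) (v (Suc k)) + B (v k) (v k)"
      using B_comb2[OF v(1)[of "Suc k"] v(1)[of k], of "- 1"] B_sym[OF v(1)[of "Suc k"] v(1)[of k]] by simp
    ultimately show ?thesis using v(3)[of k] v(3)[of "Suc k"] by linarith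
  qed
  ultimately show thesis using that[OF m v(1) lim] by blast
qed

section \<open>Null sets under translation and the Cameron-Martin theorem\<close>

lemma AE_lborel_translate:
  fixes y :: "'a::euclidean_space"
  assumes "AE x in lborel. P x" and [measurable]: "Measurable.pred borel P"
  shows "AE x in lborel. P (x + y)"
proof -
  have "AE x in distr lborel borel ((+) y). P x"
    using assms(1) by (subst lborel_distr_plus)
  then show ?thesis by (subst (asm) AE_distr_iff) (auto simp: add.commute)
qed

context fractional_brownian_motion
begin

text \<open>The normal density vanishes nowhere, so the law of \<open>X 1\<close> and Lebesgue
  measure have the same null sets. Translation invariance of the latter thereby passes to the
  former.\<close>

lemma AE_X1_iff:
  assumes [measurable]: "Measurable.pred borel P"
  shows "(AE \<omega> in M. P (X 1 \<omega>)) \<longleftrightarrow> (AE x in lborel. P x)"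
proof -
  have D: "distr M lborel (X 1) = density lborel (\<lambda>x. ennreal (\<Prod>i\<in>UNIV. std_normal_density (x $ i)))"
    using standard_normal_at_1 by (simp add: distributed_def)
  have pos: "0 < (\<Prod>i\<in>UNIV. std_normal_density ((x :: real ^ 'n) $ i))" for x
    by (intro prod_pos) (auto intro: normal_density_pos)
  have "(AE \<omega> in M. P (X 1 \<omega>)) \<longleftrightarrow> (AE x in distr M lborel (X 1). P x)"
    using measurable_X[of 1] by (subst AE_distr_iff) auto
  also have "\<dots> \<longleftrightarrow> (AE x in lborel. P x)"
    unfolding D using pos by (subst AE_density) auto
  finally show ?thesis .
qed

text \<open>Here \<open>v\<close> is, up to the factor \<open>m\<close>, the Gaussian variable representing \<open>g\<close>, so
  \<open>X t - g t v\<close> has the covariance kernel \<open>K - m g g\<close>; adding \<open>sqrt m g\<close> times an independent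
  standard normal vector restores the law of \<open>X\<close>.\<close>
lemma gaussian_direction:
  assumes c: "0 \<le> c"
    and C: "0 < C" "\<And>T \<alpha>. finite T \<Longrightarrow> T \<subseteq> {0..c} \<Longrightarrow>
      (\<Sum>t\<in>T. \<alpha> t * g t)\<^sup>2 \<le> C * (\<Sum>s\<in>T. \<Sum>t\<in>T. \<alpha> s * \<alpha> t * fbm_cov H s t)"
    and t1: "t1 \<in> {0..c}" "g t1 \<noteq> 0"
  obtains m v where "0 < m" and "v \<in> borel_measurable M"
    and "\<And>J a b. finite J \<Longrightarrow> J \<subseteq> {0..c} \<Longrightarrow>
      expectation (\<lambda>\<omega>. cos ((\<Sum>t\<in>J. a t \<bullet> X t \<omega>) - (\<Sum>t\<in>J. g t *\<^sub>R a t) \<bullet> v \<omega> + b))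
      = cos b * exp (- ((\<Sum>s\<in>J. \<Sum>t\<in>J. (a s \<bullet> a t) * fbm_cov H s t) - m * (norm (\<Sum>t\<in>J. g t *\<^sub>R a t))\<^sup>2) / 2)"
proof -
  \<comment> \<open>Finitely supported coefficient functions on [0, c] stand for finite linear
    combinations of the process; \<open>B\<close> is their covariance within one component and
    \<open>l\<close> their pairing with \<open>g\<close>.\<close>
  define supp where "supp \<alpha> = {t. \<alpha> t \<noteq> (0::real)}" for \<alpha> :: "real \<Rightarrow> real"
  define V where "V = {\<alpha>. finite (supp \<alpha>) \<and> supp \<alpha> \<subseteq> {0..c}}"
  define B where "B \<alpha> \<beta> = (\<Sum>s\<in>supp \<alpha>. \<Sum>t\<in>supp \<beta>. \<alpha> s * \<beta> t * fbm_cov H s t)" for \<alpha> \<beta>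
  define l where "l \<alpha> = (\<Sum>t\<in>supp \<alpha>. \<alpha> t * g t)" for \<alpha>
  define comb where "comb \<alpha> r \<beta> = (\<lambda>t. \<alpha> t + r * \<beta> t)" for \<alpha> \<beta> :: "real \<Rightarrow> real" and r
  have B_eq: "B \<alpha> \<beta> = (\<Sum>s\<in>T. \<Sum>t\<in>T. \<alpha> s * \<beta> t * fbm_cov H s t)"
    if "finite T" "supp \<alpha> \<subseteq> T" "supp \<beta> \<subseteq> T" for T \<alpha> \<beta>
  proof -
    have "B \<alpha> \<beta> = (\<Sum>s\<in>supp \<alpha>. \<Sum>t\<in>T. \<alpha> s * \<beta> t * fbm_cov H s t)"
      unfolding B_def using that by (intro sum.cong refl sum.mono_neutral_left) (auto simp: supp_def)
    also have "\<dots> = (\<Sum>s\<in>T. \<Sum>t\<in>T. \<alpha> s * \<beta> t * fbm_cov H s t)"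
      using that by (intro sum.mono_neutral_left) (auto simp: supp_def)
    finally show ?thesis .
  qed
  have l_eq: "l \<alpha> = (\<Sum>t\<in>T. \<alpha> t * g t)" if "finite T" "supp \<alpha> \<subseteq> T" for T \<alpha>
    unfolding l_def using that by (intro sum.mono_neutral_left) (auto simp: supp_def)
  have supp_comb: "supp (comb \<alpha> r \<beta>) \<subseteq> supp \<alpha> \<union> supp \<beta>" for \<alpha> \<beta> r
    by (auto simp: supp_def comb_def)
  obtain v m where m: "0 < m" and v: "\<And>k::nat. v k \<in> V"
    and Bvv: "(\<lambda>k. B (v k) (v k)) \<longlonglongrightarrow> m"
    and Bv: "\<And>x. x \<in> V \<Longrightarrow> (\<lambda>k. B (v k) x) \<longlonglongrightarrow> m * l x"
    and Bd: "\<And>k. B (comb (v (Suc k)) (-1) (v k)) (comb (v (Suc k)) (-1) (v k)) \<le> 4 * (1 / 16) ^ k"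
  \<comment> \<open>The coefficient \<open>1 / g t1\<close> at the single time \<open>t1\<close>
    shows that the hyperplane is nonempty.\<close>
  proof (rule minimising_sequence[of V comb B l C "\<lambda>t. if t = t1 then 1 / g t1 else 0"])
    show "comb x r y \<in> V" if "x \<in> V" "y \<in> V" for x y r
      using that supp_comb[of x r y] unfolding V_def by (auto intro: finite_subset)
    show "B (comb x r y) z = B x z + r * B y z" if "x \<in> V" "y \<in> V" "z \<in> V" for x y z r
    proof -
      let ?T = "supp x \<union> supp y \<union> supp z"
      have "finite ?T" using that by (auto simp: V_def)
      then show ?thesis using supp_comb[of x r y]
        by (subst (1 2 3) B_eq[of ?T]) (auto simp: comb_def algebra_simps sum.distrib sum_distrib_left)
    qed
    show "B x y = B y x" if "x \<in> V" "y \<in> V" for x y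
      unfolding B_def by (subst sum.swap) (simp add: fbm_cov_def mult_ac add.commute abs_minus_commute)
    show "l (comb x r y) = l x + r * l y" if "x \<in> V" "y \<in> V" for x y r
    proof -
      have "finite (supp x \<union> supp y)" using that by (auto simp: V_def)
      then show ?thesis using supp_comb[of x r y]
        by (subst (1 2 3) l_eq[of "supp x \<union> supp y"]) (auto simp: comb_def algebra_simps sum.distrib sum_distrib_left)
    qed
    show "(l x)\<^sup>2 \<le> C * B x x" if "x \<in> V" for x
      using that C(2)[of "supp x" x] by (auto simp: V_def l_def B_def)
    show "(\<lambda>t. if t = t1 then 1 / g t1 else 0) \<in> V"
      using t1 by (auto simp: V_def supp_def)
    have "supp (\<lambda>t. if t = t1 then 1 / g t1 else 0) = {t1}" using t1 by (auto simp: supp_def)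
    then show "l (\<lambda>t. if t = t1 then 1 / g t1 else 0) = 1" using t1 by (simp add: l_def)
  qed (use C in auto)
  define \<xi> where "\<xi> k \<omega> = (\<Sum>t\<in>supp (v k). v k t *\<^sub>R X t \<omega>)" for k \<omega>
  have \<xi>_eq: "\<xi> k \<omega> = (\<Sum>t\<in>T. v k t *\<^sub>R X t \<omega>)" if "finite T" "supp (v k) \<subseteq> T" for T k \<omega>
    unfolding \<xi>_def using that by (intro sum.mono_neutral_left) (auto simp: supp_def)
  have vk: "finite (supp (v k))" "supp (v k) \<subseteq> {0..c}" for k using v[of k] by (auto simp: V_def)
  have [measurable]: "\<xi> k \<in> borel_measurable M" for k
    unfolding \<xi>_def using vk[of k] measurable_X by (auto intro!: borel_measurable_sum borel_measurable_scaleR)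
  \<comment> \<open>Each of the \<open>CARD('n)\<close> components contributes the same variance
    \<open>B d d\<close>.\<close>
  have sq: "integrable M (\<lambda>\<omega>. (norm (\<xi> (Suc k) \<omega> - \<xi> k \<omega>))\<^sup>2) \<and>
    expectation (\<lambda>\<omega>. (norm (\<xi> (Suc k) \<omega> - \<xi> k \<omega>))\<^sup>2) \<le> 4 * CARD('n) * (1 / 16) ^ k" for k
  proof -
    define d where "d = comb (v (Suc k)) (-1) (v k)"
    define T where "T = supp (v (Suc k)) \<union> supp (v k)"
    have T: "finite T" "T \<subseteq> {0..c}" "supp (v (Suc k)) \<subseteq> T" "supp (v k) \<subseteq> T" "supp d \<subseteq> T"
      using vk supp_comb unfolding T_def d_def by auto
    then have T0: "t \<in> T \<Longrightarrow> 0 \<le> t" for t by auto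
    have diff: "\<xi> (Suc k) \<omega> - \<xi> k \<omega> = (\<Sum>t\<in>T. d t *\<^sub>R X t \<omega>)" for \<omega>
      using T by (subst (1 2) \<xi>_eq[of T]) (auto simp: d_def comb_def algebra_simps sum_subtractf)
    have n2: "(norm (\<xi> (Suc k) \<omega> - \<xi> k \<omega>))\<^sup>2 = (\<Sum>i\<in>UNIV. \<Sum>s\<in>T. \<Sum>t\<in>T. (d s * d t) * (X s \<omega> $ i * X t \<omega> $ i))" for \<omega>
      unfolding diff power2_norm_eq_inner inner_vec_def
      by (simp add: sum_product algebra_simps)
    have i: "integrable M (\<lambda>\<omega>. \<Sum>s\<in>T. \<Sum>t\<in>T. (d s * d t) * (X s \<omega> $ i * X t \<omega> $ i))" for i
      using T0 by (intro Bochner_Integration.integrable_sum integrable_mult_right integrable_product_component) auto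
    have e: "expectation (\<lambda>\<omega>. \<Sum>s\<in>T. \<Sum>t\<in>T. (d s * d t) * (X s \<omega> $ i * X t \<omega> $ i)) = B d d" for i
    proof -
      have "expectation (\<lambda>\<omega>. \<Sum>s\<in>T. \<Sum>t\<in>T. (d s * d t) * (X s \<omega> $ i * X t \<omega> $ i))
        = (\<Sum>s\<in>T. \<Sum>t\<in>T. (d s * d t) * expectation (\<lambda>\<omega>. X s \<omega> $ i * X t \<omega> $ i))"
        using T0 by (simp add: Bochner_Integration.integral_sum integrable_product_component Bochner_Integration.integrable_sum)
      also have "\<dots> = (\<Sum>s\<in>T. \<Sum>t\<in>T. d s * d t * fbm_cov H s t)"
        using T0 by (intro sum.cong refl) (simp add: covariance)
      also have "\<dots> = B d d" using T by (intro B_eq[symmetric]) auto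
      finally show ?thesis .
    qed
    show ?thesis unfolding n2 using i e Bd[of k, folded d_def]
      by (auto simp: Bochner_Integration.integral_sum Bochner_Integration.integrable_sum)
  qed
  have conv: "AE \<omega> in M. convergent (\<lambda>k. \<xi> k \<omega>)"
  proof -
    \<comment> \<open>With second moments of order \<open>(1 / 16) ^ k\<close>, the factor
      \<open>4 ^ k\<close> balances both terms at order \<open>(1 / 4) ^ k\<close>, so the expected
      norms of the increments are summable.\<close>
    have le: "x \<le> 4 ^ k * x\<^sup>2 + (1 / 4) ^ k" for x :: real and k :: nat
    proof (cases "x \<le> (1 / 4) ^ k")
      case True
      then show ?thesis by (simp add: add_increasing)
    next
      case False
      then have "1 \<le> 4 ^ k * x" by (simp add: power_divide field_simps)
      then have "x * 1 \<le> x * (4 ^ k * x)" using False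
        by (intro mult_left_mono) (auto simp: not_le less_imp_le intro: order_trans[of _ "(1/4)^k"])
      then show ?thesis by (simp add: power2_eq_square mult_ac add_increasing2)
    qed
    have "(\<integral>\<^sup>+\<omega>. ennreal (norm (\<xi> (Suc k) \<omega> - \<xi> k \<omega>)) \<partial>M) \<le> ennreal ((4 * CARD('n) + 1) * (1 / 4) ^ k)" for k
    proof -
      have "(\<integral>\<^sup>+\<omega>. ennreal (norm (\<xi> (Suc k) \<omega> - \<xi> k \<omega>)) \<partial>M)
        \<le> (\<integral>\<^sup>+\<omega>. ennreal (4 ^ k * (norm (\<xi> (Suc k) \<omega> - \<xi> k \<omega>))\<^sup>2 + (1 / 4) ^ k) \<partial>M)"
        by (intro nn_integral_mono ennreal_leI le)
      also have "\<dots> = ennreal (expectation (\<lambda>\<omega>. 4 ^ k * (norm (\<xi> (Suc k) \<omega> - \<xi> k \<omega>))\<^sup>2 + (1 / 4) ^ k))"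
        using sq[of k] by (intro nn_integral_eq_integral) auto
      also have "\<dots> = ennreal (4 ^ k * expectation (\<lambda>\<omega>. (norm (\<xi> (Suc k) \<omega> - \<xi> k \<omega>))\<^sup>2) + (1 / 4) ^ k)"
        using sq[of k] by (simp add: prob_space)
      also have "\<dots> \<le> ennreal (4 ^ k * (4 * CARD('n) * (1 / 16) ^ k) + (1 / 4) ^ k)"
        using sq[of k] by (intro ennreal_leI add_mono mult_left_mono) auto
      also have "4 ^ k * (4 * CARD('n) * (1 / 16) ^ k) + (1 / 4) ^ k = (4 * CARD('n) + 1) * (1 / 4) ^ k"
        by (simp add: power_divide field_simps flip: power_mult_distrib)
      finally show ?thesis .
    qed
    then have "(\<Sum>k. \<integral>\<^sup>+\<omega>. ennreal (norm (\<xi> (Suc k) \<omega> - \<xi> k \<omega>)) \<partial>M) \<le> (\<Sum>k. ennreal ((4 * CARD('n) + 1) * (1 / 4) ^ k))"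
      by (intro suminf_le) auto
    also have "\<dots> = ennreal (\<Sum>k. (4 * CARD('n) + 1) * (1 / 4) ^ k)"
      by (intro suminf_ennreal2) (auto intro!: summable_mult summable_geometric)
    also have "\<dots> < \<infinity>" by simp
    finally have "(\<integral>\<^sup>+\<omega>. (\<Sum>k. ennreal (norm (\<xi> (Suc k) \<omega> - \<xi> k \<omega>))) \<partial>M) \<noteq> \<infinity>"
      by (subst nn_integral_suminf) auto
    then have "AE \<omega> in M. (\<Sum>k. ennreal (norm (\<xi> (Suc k) \<omega> - \<xi> k \<omega>))) \<noteq> \<infinity>"
      by (intro nn_integral_PInf_AE) auto
    then show ?thesis
    proof eventually_elim
      case (elim \<omega>)
      then have "summable (\<lambda>k. norm (\<xi> (Suc k) \<omega> - \<xi> k \<omega>))"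
        by (intro summable_suminf_not_top) auto
      then have "summable (\<lambda>k. \<xi> (Suc k) \<omega> - \<xi> k \<omega>)" by (rule summable_norm_cancel)
      then have "convergent (\<lambda>n. \<Sum>k<n. \<xi> (Suc k) \<omega> - \<xi> k \<omega>)" by (rule summable_iff_convergent[THEN iffD1])
      then have "convergent (\<lambda>n. \<xi> n \<omega> - \<xi> 0 \<omega>)" unfolding sum_lessThan_telescope[of "\<lambda>k. \<xi> k \<omega>"] .
      then show ?case using convergent_add[OF _ convergent_const[of "\<xi> 0 \<omega>"]] by fastforce
    qed
  qed
  define w where "w \<omega> = lim (\<lambda>k. \<xi> k \<omega>)" for \<omega>
  have [measurable]: "w \<in> borel_measurable M" unfolding w_def by measurable
  have w: "AE \<omega> in M. (\<lambda>k. \<xi> k \<omega>) \<longlonglongrightarrow> w \<omega>"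
    using conv by eventually_elim (simp add: w_def convergent_LIMSEQ_iff)
  have "expectation (\<lambda>\<omega>. cos ((\<Sum>t\<in>J. a t \<bullet> X t \<omega>) - (\<Sum>t\<in>J. g t *\<^sub>R a t) \<bullet> w \<omega> + b))
      = cos b * exp (- ((\<Sum>s\<in>J. \<Sum>t\<in>J. (a s \<bullet> a t) * fbm_cov H s t) - m * (norm (\<Sum>t\<in>J. g t *\<^sub>R a t))\<^sup>2) / 2)"
    if J: "finite J" "J \<subseteq> {0..c}" for J and a :: "real \<Rightarrow> real ^ 'n" and b
  proof -
    define A where "A = (\<Sum>t\<in>J. g t *\<^sub>R a t)"
    \<comment> \<open>The coefficients seen by component \<open>i\<close>; the value 0 outside
      \<open>J\<close> puts them into \<open>V\<close>.\<close>
    define \<alpha> where "\<alpha> i t = (if t \<in> J then a t $ i else 0)" for i t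
    have \<alpha>: "\<alpha> i \<in> V" "supp (\<alpha> i) \<subseteq> J" for i
      using J unfolding V_def by (auto simp: supp_def \<alpha>_def intro: finite_subset)
    have l\<alpha>: "l (\<alpha> i) = A $ i" for i
      using l_eq[OF J(1) \<alpha>(2)] by (simp add: A_def \<alpha>_def mult.commute)
    have [measurable]: "(\<lambda>\<omega>. \<Sum>t\<in>J. a t \<bullet> X t \<omega>) \<in> borel_measurable M"
      using J measurable_X by (intro borel_measurable_sum borel_measurable_inner) auto
    \<comment> \<open>The variance of the linear combination minus
      \<open>A \<bullet> \<xi> k\<close>, summed over components. As
      \<open>B (v k) (\<alpha> i)\<close> tends to \<open>m * A $ i\<close> and
      \<open>B (v k) (v k)\<close> to \<open>m\<close>, the two correction terms leave
      \<open>- m * (A $ i)\<^sup>2\<close> in the limit.\<close>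
    define Q where "Q k = (\<Sum>i\<in>UNIV. B (\<alpha> i) (\<alpha> i) - 2 * A $ i * B (v k) (\<alpha> i) + (A $ i)\<^sup>2 * B (v k) (v k))" for k
    have cf: "expectation (\<lambda>\<omega>. cos ((\<Sum>t\<in>J. a t \<bullet> X t \<omega>) - A \<bullet> \<xi> k \<omega> + b)) = cos b * exp (- Q k / 2)" for k
    proof -
      let ?T = "J \<union> supp (v k)"
      define a' where "a' t = (\<chi> i. \<alpha> i t - A $ i * v k t)" for t
      have T: "finite ?T" "?T \<subseteq> {0..}" using J vk[of k] by auto
      have "(\<Sum>t\<in>?T. a' t \<bullet> X t \<omega>) = (\<Sum>t\<in>J. a t \<bullet> X t \<omega>) - A \<bullet> \<xi> k \<omega>" for \<omega>
      proof -
        have "(\<Sum>t\<in>J. a t \<bullet> X t \<omega>) = (\<Sum>t\<in>?T. (\<chi> i. \<alpha> i t) \<bullet> X t \<omega>)"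
          using T by (intro sum.mono_neutral_cong_left) (auto simp: \<alpha>_def inner_vec_def)
        moreover have "A \<bullet> \<xi> k \<omega> = (\<Sum>t\<in>?T. v k t * (A \<bullet> X t \<omega>))"
          using T by (subst \<xi>_eq[of ?T]) (auto simp: inner_sum_right)
        moreover have "a' t \<bullet> x = (\<chi> i. \<alpha> i t) \<bullet> x - v k t * (A \<bullet> x)" for t x
          by (simp add: a'_def inner_vec_def algebra_simps sum_subtractf sum_distrib_left)
        ultimately show ?thesis by (simp add: sum_subtractf)
      qed
      moreover have "(\<Sum>s\<in>?T. \<Sum>t\<in>?T. (a' s \<bullet> a' t) * fbm_cov H s t) = Q k"
      proof -
        have s: "supp (\<alpha> i) \<subseteq> ?T" "supp (v k) \<subseteq> ?T" for i using \<alpha>(2) by auto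
        have "(\<Sum>s\<in>?T. \<Sum>t\<in>?T. (a' s \<bullet> a' t) * fbm_cov H s t)
          = (\<Sum>s\<in>?T. \<Sum>t\<in>?T. \<Sum>i\<in>UNIV. (\<alpha> i s - A $ i * v k s) * (\<alpha> i t - A $ i * v k t) * fbm_cov H s t)"
          by (simp add: inner_vec_def a'_def sum_distrib_right)
        also have "\<dots> = (\<Sum>i\<in>UNIV. \<Sum>s\<in>?T. \<Sum>t\<in>?T. (\<alpha> i s - A $ i * v k s) * (\<alpha> i t - A $ i * v k t) * fbm_cov H s t)"
          by (subst sum.swap, subst (2) sum.swap) (rule refl)
        also have "\<dots> = (\<Sum>i\<in>UNIV. B (\<alpha> i) (\<alpha> i) - A $ i * B (v k) (\<alpha> i) - A $ i * B (\<alpha> i) (v k) + (A $ i)\<^sup>2 * B (v k) (v k))"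
          using s T by (intro sum.cong refl, subst (1 2 3 4) B_eq[of ?T])
            (auto simp: algebra_simps power2_eq_square sum.distrib sum_subtractf sum_distrib_left)
        also have "\<dots> = Q k"
        proof -
          have "B (\<alpha> i) (v k) = B (v k) (\<alpha> i)" for i
            unfolding B_def by (subst sum.swap) (simp add: fbm_cov_def mult_ac add.commute abs_minus_commute)
          then show ?thesis by (simp add: Q_def mult.assoc)
        qed
        finally show ?thesis .
      qed
      ultimately show ?thesis using characteristic_function[OF T, of a' b] by simp
    qed
    have "(\<lambda>k. expectation (\<lambda>\<omega>. cos ((\<Sum>t\<in>J. a t \<bullet> X t \<omega>) - A \<bullet> \<xi> k \<omega> + b)))
      \<longlonglongrightarrow> expectation (\<lambda>\<omega>. cos ((\<Sum>t\<in>J. a t \<bullet> X t \<omega>) - A \<bullet> w \<omega> + b))"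
    proof (rule integral_dominated_convergence[where w="\<lambda>_. 1"])
      show "AE \<omega> in M. (\<lambda>k. cos ((\<Sum>t\<in>J. a t \<bullet> X t \<omega>) - A \<bullet> \<xi> k \<omega> + b)) \<longlonglongrightarrow> cos ((\<Sum>t\<in>J. a t \<bullet> X t \<omega>) - A \<bullet> w \<omega> + b)"
        using w by eventually_elim (intro tendsto_intros)
    qed auto
    moreover have "(\<lambda>k. cos b * exp (- Q k / 2)) \<longlonglongrightarrow>
      cos b * exp (- (\<Sum>i\<in>UNIV. B (\<alpha> i) (\<alpha> i) - 2 * A $ i * (m * A $ i) + (A $ i)\<^sup>2 * m) / 2)"
      unfolding Q_def using Bv[OF \<alpha>(1)] Bvv by (intro tendsto_intros) (auto simp: l\<alpha>)
    ultimately have lim: "expectation (\<lambda>\<omega>. cos ((\<Sum>t\<in>J. a t \<bullet> X t \<omega>) - A \<bullet> w \<omega> + b))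
      = cos b * exp (- (\<Sum>i\<in>UNIV. B (\<alpha> i) (\<alpha> i) - 2 * A $ i * (m * A $ i) + (A $ i)\<^sup>2 * m) / 2)"
      unfolding cf by (rule LIMSEQ_unique)
    have "(\<Sum>i\<in>UNIV. B (\<alpha> i) (\<alpha> i) - 2 * A $ i * (m * A $ i) + (A $ i)\<^sup>2 * m)
      = (\<Sum>s\<in>J. \<Sum>t\<in>J. (a s \<bullet> a t) * fbm_cov H s t) - m * (norm A)\<^sup>2"
    proof -
      have "(\<Sum>i\<in>UNIV. B (\<alpha> i) (\<alpha> i)) = (\<Sum>i\<in>UNIV. \<Sum>s\<in>J. \<Sum>t\<in>J. a s $ i * a t $ i * fbm_cov H s t)"
        using J \<alpha>(2) by (intro sum.cong refl, subst B_eq[of J]) (auto simp: \<alpha>_def)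
      also have "\<dots> = (\<Sum>s\<in>J. \<Sum>t\<in>J. \<Sum>i\<in>UNIV. a s $ i * a t $ i * fbm_cov H s t)"
        by (subst sum.swap, subst (2) sum.swap) (rule refl)
      also have "\<dots> = (\<Sum>s\<in>J. \<Sum>t\<in>J. (a s \<bullet> a t) * fbm_cov H s t)"
        by (simp add: inner_vec_def sum_distrib_right)
      finally have 1: "(\<Sum>i\<in>UNIV. B (\<alpha> i) (\<alpha> i)) = (\<Sum>s\<in>J. \<Sum>t\<in>J. (a s \<bullet> a t) * fbm_cov H s t)" .
      have 2: "m * (norm A)\<^sup>2 = (\<Sum>i\<in>UNIV. m * (A $ i)\<^sup>2)"
        unfolding power2_norm_eq_inner inner_vec_def by (simp add: sum_distrib_left power2_eq_square)
      show ?thesis unfolding 1[symmetric] 2 sum_subtractf[symmetric]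
        by (intro sum.cong refl) (simp add: power2_eq_square)
    qed
    then show ?thesis using lim unfolding A_def[symmetric] by (simp only:)
  qed
  then show thesis using m that[of m w] by simp
qed

text \<open>For a fixed first coordinate \<omega> the decomposed path is an affine function
  \<open>N \<omega>\<close> of a standard normal vector, and adding \<open>g t *\<^sub>R y\<close>
  amounts to translating that vector by \<open>y\<close> divided by \<open>sqrt m\<close>. Null sets
  survive the translation for almost every \<omega>, and Fubini puts them together again. Only null
  sets are compared, so no density of the shifted law is computed.\<close>

theorem cameron_martin:
  assumes c: "0 \<le> c"
    and C: "0 < C" "\<And>T \<alpha>. finite T \<Longrightarrow> T \<subseteq> {0..c} \<Longrightarrow>
      (\<Sum>t\<in>T. \<alpha> t * g t)\<^sup>2 \<le> C * (\<Sum>s\<in>T. \<Sum>t\<in>T. \<alpha> s * \<alpha> t * fbm_cov H s t)"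
    and F[measurable]: "F \<in> sets (PiM {0..c} (\<lambda>_. borel))"
    and null: "AE \<omega> in M. (\<lambda>t\<in>{0..c}. X t \<omega>) \<notin> F"
  shows "AE \<omega> in M. (\<lambda>t\<in>{0..c}. X t \<omega> + g t *\<^sub>R y) \<notin> F"
proof (cases "\<exists>t1\<in>{0..c}. g t1 \<noteq> 0")
  case False
  then have "(\<lambda>t\<in>{0..c}. X t \<omega> + g t *\<^sub>R y) = (\<lambda>t\<in>{0..c}. X t \<omega>)" for \<omega> by auto
  then show ?thesis using null by simp
next
  case True
  then obtain t1 where t1: "t1 \<in> {0..c}" "g t1 \<noteq> 0" by blast
  let ?P = "PiM {0..c} (\<lambda>_. borel) :: (real \<Rightarrow> real ^ 'n) measure"
  obtain m v where m: "0 < m" and v[measurable]: "v \<in> borel_measurable M"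
    and cf: "\<And>J a b. finite J \<Longrightarrow> J \<subseteq> {0..c} \<Longrightarrow>
      expectation (\<lambda>\<omega>. cos ((\<Sum>t\<in>J. a t \<bullet> X t \<omega>) - (\<Sum>t\<in>J. g t *\<^sub>R a t) \<bullet> v \<omega> + b))
      = cos b * exp (- ((\<Sum>s\<in>J. \<Sum>t\<in>J. (a s \<bullet> a t) * fbm_cov H s t) - m * (norm (\<Sum>t\<in>J. g t *\<^sub>R a t))\<^sup>2) / 2)"
    using gaussian_direction[OF c C t1] by blast
  interpret MM: pair_prob_space M M ..
  have [measurable]: "X t \<in> borel_measurable M" if "t \<in> {0..c}" for t using measurable_X that by auto
  have [measurable]: "X 1 \<in> borel_measurable M" using measurable_X by auto
  \<comment> \<open>The second coordinate of the product space supplies the independent normal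
    vector, as its own copy of \<open>X 1\<close>.\<close>
  define Z where "Z t p = X t (fst p) - g t *\<^sub>R v (fst p) + (g t * sqrt m) *\<^sub>R X 1 (snd p)" for t p
  have Z[measurable]: "Z t \<in> borel_measurable (M \<Otimes>\<^sub>M M)" if "t \<in> {0..c}" for t
    unfolding Z_def using that by measurable
  have law: "distr M ?P (\<lambda>\<omega>. \<lambda>t\<in>{0..c}. X t \<omega>) = distr (M \<Otimes>\<^sub>M M) ?P (\<lambda>p. \<lambda>t\<in>{0..c}. Z t p)"
  proof (rule distr_PiM_vec_eqI_cos)
    show "prob_space M" "prob_space (M \<Otimes>\<^sub>M M)" by unfold_locales
    fix J and a :: "real \<Rightarrow> real ^ 'n" and b assume J: "finite J" "J \<subseteq> {0..c}"
    define A where "A = (\<Sum>t\<in>J. g t *\<^sub>R a t)"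
    have [measurable]: "(\<lambda>\<omega>. \<Sum>t\<in>J. a t \<bullet> X t \<omega>) \<in> borel_measurable M"
      using J by (intro borel_measurable_sum borel_measurable_inner) auto
    \<comment> \<open>For fixed \<omega> this is a linear form in the single vector
      \<open>X 1 \<omega>'\<close> plus a phase. Integrating over \<omega>' multiplies the cosine of
      the phase by \<open>exp (- m * (norm A)\<^sup>2 / 2)\<close>, which offsets the term with
      \<open>m\<close> in \<open>cf\<close>.\<close>
    have eq: "(\<Sum>t\<in>J. a t \<bullet> Z t (\<omega>, \<omega>')) + b
      = (\<Sum>t\<in>{1}. (sqrt m *\<^sub>R A) \<bullet> X t \<omega>') + ((\<Sum>t\<in>J. a t \<bullet> X t \<omega>) - A \<bullet> v \<omega> + b)" for \<omega> \<omega>'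
      by (simp add: Z_def A_def inner_simps sum.distrib sum_subtractf inner_sum_left scaleR_sum_right sum_distrib_left mult_ac)
    have m1: "(\<lambda>p. cos ((\<Sum>t\<in>J. a t \<bullet> Z t p) + b)) \<in> borel_measurable (M \<Otimes>\<^sub>M M)"
      using J by (intro borel_measurable_cos measurable_compose[OF _ borel_measurable_cos] borel_measurable_add borel_measurable_sum borel_measurable_inner Z) auto
    have "(LINT p|(M \<Otimes>\<^sub>M M). cos ((\<Sum>t\<in>J. a t \<bullet> Z t p) + b))
      = (LINT \<omega>|M. LINT \<omega>'|M. cos ((\<Sum>t\<in>J. a t \<bullet> Z t (\<omega>, \<omega>')) + b))"
      by (intro MM.integral_fst'[symmetric] MM.P.integrable_const_bound[where B=1] m1) auto
    also have "\<dots> = (LINT \<omega>|M. exp (- m * (norm A)\<^sup>2 / 2) * cos ((\<Sum>t\<in>J. a t \<bullet> X t \<omega>) - A \<bullet> v \<omega> + b))"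
      unfolding eq using m
      by (subst characteristic_function) (auto simp: fbm_cov_def power2_norm_eq_inner mult_ac)
    also have "\<dots> = exp (- m * (norm A)\<^sup>2 / 2) * (cos b * exp (- ((\<Sum>s\<in>J. \<Sum>t\<in>J. (a s \<bullet> a t) * fbm_cov H s t) - m * (norm A)\<^sup>2) / 2))"
      using cf[OF J, of a b] unfolding A_def[symmetric] by (simp only: integral_mult_right_zero)
    also have "\<dots> = cos b * exp (- (\<Sum>s\<in>J. \<Sum>t\<in>J. (a s \<bullet> a t) * fbm_cov H s t) / 2)"
      by (simp add: mult_ac flip: exp_add) (simp add: field_simps)
    also have "\<dots> = expectation (\<lambda>\<omega>. cos ((\<Sum>t\<in>J. a t \<bullet> X t \<omega>) + b))"
      using J by (intro characteristic_function[symmetric]) auto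
    finally show "expectation (\<lambda>\<omega>. cos ((\<Sum>t\<in>J. a t \<bullet> X t \<omega>) + b)) = (LINT p|(M \<Otimes>\<^sub>M M). cos ((\<Sum>t\<in>J. a t \<bullet> Z t p) + b))" ..
  qed (use measurable_X Z in auto)
  have XP: "(\<lambda>\<omega>. \<lambda>t\<in>{0..c}. X t \<omega>) \<in> M \<rightarrow>\<^sub>M ?P" and ZP: "(\<lambda>p. \<lambda>t\<in>{0..c}. Z t p) \<in> M \<Otimes>\<^sub>M M \<rightarrow>\<^sub>M ?P"
    by (auto intro!: measurable_restrict Z measurable_X)
  have transfer: "(AE \<omega> in M. (\<lambda>t\<in>{0..c}. X t \<omega>) \<notin> E) \<longleftrightarrow> (AE p in M \<Otimes>\<^sub>M M. (\<lambda>t\<in>{0..c}. Z t p) \<notin> E)"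
    if E: "E \<in> sets ?P" for E
  proof -
    have s: "{f \<in> space ?P. f \<notin> E} \<in> sets ?P" using E by (auto simp: set_diff_eq[symmetric])
    show ?thesis
      using AE_distr_iff[OF XP s] AE_distr_iff[OF ZP s] unfolding law by blast
  qed
  let ?sh = "\<lambda>f. \<lambda>t\<in>{0..c}. f t + g t *\<^sub>R y"
  have sh: "?sh \<in> ?P \<rightarrow>\<^sub>M ?P"
    by (intro measurable_restrict borel_measurable_add measurable_component_singleton) auto
  define F' where "F' = ?sh -` F \<inter> space ?P"
  have F': "F' \<in> sets ?P" unfolding F'_def using sh F by (rule measurable_sets)
  have memF': "(\<lambda>t\<in>{0..c}. x t) \<in> F' \<longleftrightarrow> (\<lambda>t\<in>{0..c}. x t + g t *\<^sub>R y) \<in> F" for x :: "real \<Rightarrow> real ^ 'n"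
  proof -
    have "?sh (\<lambda>t\<in>{0..c}. x t) = (\<lambda>t\<in>{0..c}. x t + g t *\<^sub>R y)" by auto
    then show ?thesis by (simp add: F'_def space_PiM)
  qed
  define N where "N \<omega> x = (\<lambda>t\<in>{0..c}. X t \<omega> - g t *\<^sub>R v \<omega> + (g t * sqrt m) *\<^sub>R x)" for \<omega> and x :: "real ^ 'n"
  have NZ: "(\<lambda>t\<in>{0..c}. Z t (\<omega>, \<omega>')) = N \<omega> (X 1 \<omega>')" for \<omega> \<omega>' by (simp add: N_def Z_def)
  have N_meas: "N \<omega> \<in> borel \<rightarrow>\<^sub>M ?P" for \<omega>
    unfolding N_def by (intro measurable_restrict) measurable
  have N_shift: "?sh (N \<omega> x) = N \<omega> (x + (1 / sqrt m) *\<^sub>R y)" for \<omega> x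
    using m by (auto simp: N_def scaleR_add_right)
  have pred: "Measurable.pred borel (\<lambda>x. N \<omega> x \<notin> F)" for \<omega>
  proof -
    have "N \<omega> -` F \<inter> space borel \<in> sets borel" by (rule measurable_sets[OF N_meas F])
    then have "- {x. N \<omega> x \<in> F} \<in> sets borel" by (intro borel_comp) (simp add: vimage_def)
    moreover have "- {x. N \<omega> x \<in> F} = {x \<in> space borel. N \<omega> x \<notin> F}" by auto
    ultimately show ?thesis unfolding pred_def by simp
  qed
  have "AE p in M \<Otimes>\<^sub>M M. (\<lambda>t\<in>{0..c}. Z t p) \<notin> F" using null transfer[OF F] by simp
  then have "AE \<omega> in M. AE \<omega>' in M. (\<lambda>t\<in>{0..c}. Z t (\<omega>, \<omega>')) \<notin> F" by (rule MM.AE_pair)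
  then have "AE \<omega> in M. AE x in lborel. N \<omega> x \<notin> F"
    unfolding NZ AE_X1_iff[OF pred] .
  then have "AE \<omega> in M. AE x in lborel. N \<omega> (x + (1 / sqrt m) *\<^sub>R y) \<notin> F"
    by eventually_elim (rule AE_lborel_translate[OF _ pred])
  moreover have pred': "Measurable.pred borel (\<lambda>x. N \<omega> (x + (1 / sqrt m) *\<^sub>R y) \<notin> F)" for \<omega>
    by (rule measurable_compose[OF _ pred]) measurable
  ultimately have "AE \<omega> in M. AE \<omega>' in M. N \<omega> (X 1 \<omega>' + (1 / sqrt m) *\<^sub>R y) \<notin> F"
    unfolding AE_X1_iff[OF pred'] by simp
  moreover have "(\<lambda>t\<in>{0..c}. Z t (\<omega>, \<omega>')) \<in> F' \<longleftrightarrow> N \<omega> (X 1 \<omega>' + (1 / sqrt m) *\<^sub>R y) \<in> F" for \<omega> \<omega>'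
  proof -
    have "(\<lambda>t\<in>{0..c}. Z t (\<omega>, \<omega>') + g t *\<^sub>R y) = ?sh (N \<omega> (X 1 \<omega>'))"
      unfolding NZ[symmetric] by auto
    then show ?thesis by (subst memF') (simp only: N_shift)
  qed
  ultimately have ae: "AE \<omega> in M. AE \<omega>' in M. (\<lambda>t\<in>{0..c}. Z t (\<omega>, \<omega>')) \<notin> F'" by simp
  have "AE p in M \<Otimes>\<^sub>M M. (\<lambda>t\<in>{0..c}. Z t p) \<notin> F'"
  proof (rule MM.AE_pair_measure)
    have "(\<lambda>p. \<lambda>t\<in>{0..c}. Z t p) -` F' \<inter> space (M \<Otimes>\<^sub>M M) \<in> sets (M \<Otimes>\<^sub>M M)"
      by (rule measurable_sets[OF ZP F'])
    then have "space (M \<Otimes>\<^sub>M M) - (\<lambda>p. \<lambda>t\<in>{0..c}. Z t p) -` F' \<inter> space (M \<Otimes>\<^sub>M M) \<in> sets (M \<Otimes>\<^sub>M M)" by blast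
    moreover have "space (M \<Otimes>\<^sub>M M) - (\<lambda>p. \<lambda>t\<in>{0..c}. Z t p) -` F' \<inter> space (M \<Otimes>\<^sub>M M)
      = {x \<in> space (M \<Otimes>\<^sub>M M). (\<lambda>t\<in>{0..c}. Z t x) \<notin> F'}" by auto
    ultimately show "{x \<in> space (M \<Otimes>\<^sub>M M). (\<lambda>t\<in>{0..c}. Z t x) \<notin> F'} \<in> sets (M \<Otimes>\<^sub>M M)" by simp
  qed (use ae in simp)
  then have "AE \<omega> in M. (\<lambda>t\<in>{0..c}. X t \<omega>) \<notin> F'" using transfer[OF F'] by simp
  then show ?thesis unfolding memF' .
qed

end

section \<open>Finite expected volume of the range\<close>

text \<open>The leading constant can be brought as close to 1 as desired at the expense of
  \<open>C\<close>: either \<open>y\<close> is a small multiple of \<open>x\<close>, or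
  \<open>x\<close> is a bounded multiple of \<open>y\<close>. Convexity would give
  \<open>2 ^ (p - 1)\<close>, which grows with \<open>p\<close>, whereas the recursion for
  \<open>dyadic_max\<close> tolerates only constants below 3.\<close>

lemma power_add_le_three_halves:
  fixes p :: nat
  obtains C where "0 \<le> C" and "\<And>x y::real. 0 \<le> x \<Longrightarrow> 0 \<le> y \<Longrightarrow> (x + y) ^ p \<le> 3 / 2 * x ^ p + C * y ^ p"
proof -
  have "((\<lambda>\<eta>::real. (1 + \<eta>) ^ p) \<longlongrightarrow> (1 + 0) ^ p) (at_right 0)"
    by (intro tendsto_intros)
  then have "eventually (\<lambda>\<eta>::real. (1 + \<eta>) ^ p < 3 / 2) (at_right 0)"
    by (rule order_tendstoD) simp
  moreover have "eventually (\<lambda>\<eta>::real. 0 < \<eta>) (at_right 0)" by (rule eventually_at_right_less)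
  ultimately have "eventually (\<lambda>\<eta>::real. (1 + \<eta>) ^ p < 3 / 2 \<and> 0 < \<eta>) (at_right 0)" by eventually_elim auto
  then obtain \<eta> :: real where \<eta>: "(1 + \<eta>) ^ p < 3 / 2" "0 < \<eta>"
    using eventually_happens[of _ "at_right (0::real)"] by auto
  have "(x + y) ^ p \<le> 3 / 2 * x ^ p + (1 / \<eta> + 1) ^ p * y ^ p" if xy: "0 \<le> x" "0 \<le> y" for x y
  proof (cases "y \<le> \<eta> * x")
    case True
    then have "(x + y) ^ p \<le> ((1 + \<eta>) * x) ^ p" using xy by (intro power_mono) (auto simp: algebra_simps)
    also have "\<dots> \<le> 3 / 2 * x ^ p"
      unfolding power_mult_distrib using \<eta> xy by (intro mult_right_mono) auto
    finally show ?thesis using \<eta> xy by (simp add: add_increasing2)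
  next
    case False
    then have "x \<le> y / \<eta>" using \<eta>(2) by (simp add: field_simps)
    then have "(x + y) ^ p \<le> ((1 / \<eta> + 1) * y) ^ p" using xy by (intro power_mono) (auto simp: algebra_simps)
    then show ?thesis using xy by (simp add: power_mult_distrib add_increasing)
  qed
  then show thesis using that[of "(1 / \<eta> + 1) ^ p"] \<eta>(2) by auto
qed

text \<open>On a finite grid the maximum has finite expectation, which is not known beforehand for
  the supremum over [0, 1].\<close>

definition dyadic_max :: "nat \<Rightarrow> nat \<Rightarrow> (real \<Rightarrow> 'b::real_normed_vector) \<Rightarrow> ennreal" where
  "dyadic_max p k f = (SUP j\<in>{0..(2::nat) ^ k}. ennreal (norm (f (real j / 2 ^ k)) ^ p))"

lemma dyadic_max_ge: "j \<le> 2 ^ k \<Longrightarrow> ennreal (norm (f (real j / 2 ^ k)) ^ p) \<le> dyadic_max p k f"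
  unfolding dyadic_max_def by (intro SUP_upper) auto

lemma dyadic_max_cong:
  "(\<And>t. 0 \<le> t \<Longrightarrow> t \<le> 1 \<Longrightarrow> f t = g t) \<Longrightarrow> dyadic_max p k f = dyadic_max p k g"
  unfolding dyadic_max_def by (intro SUP_cong refl) (auto simp: field_simps)

lemma dyadic_max_scaleR:
  assumes "0 \<le> r"
  shows "dyadic_max p k (\<lambda>t. r *\<^sub>R f t) = ennreal (r ^ p) * dyadic_max p k f"
proof -
  have "ennreal (norm (r *\<^sub>R x) ^ p) = ennreal (r ^ p) * ennreal (norm x ^ p)" for x :: 'a
    using assms by (simp add: power_mult_distrib ennreal_mult)
  then show ?thesis unfolding dyadic_max_def by (simp add: SUP_mult_left_ennreal)
qed

lemma dyadic_max_Suc_mono: "dyadic_max p k f \<le> dyadic_max p (Suc k) f"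
  unfolding dyadic_max_def
proof (intro SUP_mono)
  fix j :: nat assume "j \<in> {0..2 ^ k}"
  then have "2 * j \<in> {0..2 ^ Suc k}" by auto
  moreover have "real j / 2 ^ k = real (2 * j) / 2 ^ Suc k" by simp
  ultimately show "\<exists>m\<in>{0..2 ^ Suc k}. ennreal (norm (f (real j / 2 ^ k)) ^ p) \<le> ennreal (norm (f (real m / 2 ^ Suc k)) ^ p)"
    by (metis order_refl)
qed

text \<open>The grid on \<open>[0, 1]\<close> consists of two half-size grids, the second one viewed from
  the point \<open>f (1 / 2)\<close>.\<close>
lemma dyadic_max_Suc:
  fixes f :: "real \<Rightarrow> 'b::real_normed_vector"
  assumes C: "0 \<le> C" "\<And>x y::real. 0 \<le> x \<Longrightarrow> 0 \<le> y \<Longrightarrow> (x + y) ^ p \<le> 3 / 2 * x ^ p + C * y ^ p"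
  shows "dyadic_max p (Suc k) f \<le> dyadic_max p k (\<lambda>t. f (1 / 2 * t))
    + ennreal (3 / 2) * dyadic_max p k (\<lambda>t. f (1 / 2 + 1 / 2 * t) - f (1 / 2)) + ennreal (C * norm (f (1 / 2)) ^ p)"
  unfolding dyadic_max_def[of p "Suc k"]
proof (intro SUP_least)
  fix j :: nat assume j: "j \<in> {0..2 ^ Suc k}"
  let ?A = "dyadic_max p k (\<lambda>t. f (1 / 2 * t))" and ?B = "dyadic_max p k (\<lambda>t. f (1 / 2 + 1 / 2 * t) - f (1 / 2))"
  show "ennreal (norm (f (real j / 2 ^ Suc k)) ^ p) \<le> ?A + ennreal (3 / 2) * ?B + ennreal (C * norm (f (1 / 2)) ^ p)"
  proof (cases "j \<le> 2 ^ k")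
    case True
    have "ennreal (norm (f (real j / 2 ^ Suc k)) ^ p) \<le> ?A"
      using dyadic_max_ge[OF True, of "\<lambda>t. f (1 / 2 * t)" p] by simp
    also have "\<dots> \<le> ?A + (ennreal (3 / 2) * ?B + ennreal (C * norm (f (1 / 2)) ^ p))"
      by (rule add_increasing2) auto
    finally show ?thesis by (simp add: add.assoc)
  next
    case False
    define i where "i = j - 2 ^ k"
    have i: "i \<le> 2 ^ k" "j = 2 ^ k + i" using False j by (auto simp: i_def)
    define u where "u = f (1 / 2 + 1 / 2 * (real i / 2 ^ k)) - f (1 / 2)"
    have "real j / 2 ^ Suc k = 1 / 2 + 1 / 2 * (real i / 2 ^ k)" unfolding i(2) by (simp add: field_simps)
    then have "norm (f (real j / 2 ^ Suc k)) \<le> norm u + norm (f (1 / 2))"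
      unfolding u_def using norm_triangle_ineq[of u "f (1 / 2)"] by (simp add: u_def)
    then have "norm (f (real j / 2 ^ Suc k)) ^ p \<le> (norm u + norm (f (1 / 2))) ^ p" by (intro power_mono) auto
    also have "\<dots> \<le> 3 / 2 * norm u ^ p + C * norm (f (1 / 2)) ^ p" by (intro C) auto
    finally have "ennreal (norm (f (real j / 2 ^ Suc k)) ^ p) \<le> ennreal (3 / 2 * norm u ^ p + C * norm (f (1 / 2)) ^ p)"
      by (rule ennreal_leI)
    also have "\<dots> = ennreal (3 / 2) * ennreal (norm u ^ p) + ennreal (C * norm (f (1 / 2)) ^ p)"
      using C(1) ennreal_mult[of "3 / 2" "norm u ^ p"] by (subst ennreal_plus) auto
    also have "ennreal (norm u ^ p) \<le> ?B"
      unfolding u_def using dyadic_max_ge[OF i(1), of "\<lambda>t. f (1 / 2 + 1 / 2 * t) - f (1 / 2)" p] .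
    also have "ennreal (3 / 2) * ?B + ennreal (C * norm (f (1 / 2)) ^ p)
      \<le> ?A + (ennreal (3 / 2) * ?B + ennreal (C * norm (f (1 / 2)) ^ p))"
      by (rule add_increasing) auto
    finally show ?thesis by (simp add: add.assoc add_right_mono mult_left_mono)
  qed
qed

lemma norm_power_le_SUP_dyadic_max:
  fixes f :: "real \<Rightarrow> 'b::real_normed_vector"
  assumes "continuous_on {0..} f" "0 \<le> t" "t \<le> 1"
  shows "ennreal (norm (f t) ^ p) \<le> (SUP k. dyadic_max p k f)"
proof -
  define q where "q k = real (nat \<lfloor>t * 2 ^ k\<rfloor>) / 2 ^ k" for k :: nat
  have q: "t - (1 / 2) ^ k \<le> q k" "q k \<le> t" "0 \<le> q k" for k
  proof -
    have "real (nat \<lfloor>t * 2 ^ k\<rfloor>) = of_int \<lfloor>t * 2 ^ k\<rfloor>" using assms(2) by simp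
    then have "t * 2 ^ k - 1 \<le> real (nat \<lfloor>t * 2 ^ k\<rfloor>)" "real (nat \<lfloor>t * 2 ^ k\<rfloor>) \<le> t * 2 ^ k" by linarith+
    then have "(t * 2 ^ k - 1) / 2 ^ k \<le> q k" "q k \<le> t * 2 ^ k / 2 ^ k"
      unfolding q_def by (intro divide_right_mono; simp)+
    then show "t - (1 / 2) ^ k \<le> q k" "q k \<le> t"
      by (simp_all add: diff_divide_distrib power_divide)
    show "0 \<le> q k" by (simp add: q_def)
  qed
  have "(\<lambda>k. (1 / 2) ^ k :: real) \<longlonglongrightarrow> 0" by (rule LIMSEQ_realpow_zero) auto
  from tendsto_diff[OF tendsto_const[of t] this]
  have "q \<longlonglongrightarrow> t"
    by (intro real_tendsto_sandwich[of "\<lambda>k. t - (1 / 2) ^ k" q sequentially "\<lambda>_. t"] always_eventually allI q) simp_all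
  then have "(\<lambda>k. f (q k)) \<longlonglongrightarrow> f t"
    using continuous_on_tendsto_compose[OF assms(1), of q t sequentially] q(3) assms(2) by auto
  then have "(\<lambda>k. ennreal (norm (f (q k)) ^ p)) \<longlonglongrightarrow> ennreal (norm (f t) ^ p)"
    by (intro tendsto_intros)
  moreover have "ennreal (norm (f (q k)) ^ p) \<le> (SUP k. dyadic_max p k f)" for k
  proof -
    have "real (nat \<lfloor>t * 2 ^ k\<rfloor>) \<le> 2 ^ k"
    proof -
      have "q k * 2 ^ k \<le> 1 * 2 ^ k" using q(2)[of k] assms(3) by (intro mult_right_mono) auto
      then show ?thesis by (simp add: q_def)
    qed
    then have "nat \<lfloor>t * 2 ^ k\<rfloor> \<le> 2 ^ k" by (metis of_nat_le_iff of_nat_numeral of_nat_power)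
    from dyadic_max_ge[OF this, of f p] show ?thesis
      unfolding q_def by (rule order_trans) (rule SUP_upper, simp)
  qed
  ultimately show ?thesis by (intro LIMSEQ_le_const2) blast+
qed

section \<open>Moments of the supremum of the process over the unit interval\<close>

context fractional_brownian_motion
begin

lemma nn_integral_norm_power_finite:
  assumes "0 \<le> t" "even p" shows "(\<integral>\<^sup>+\<omega>. ennreal (norm (X t \<omega>) ^ p) \<partial>M) < \<infinity>"
proof -
  have le: "norm x ^ p \<le> real CARD('n) ^ p * (\<Sum>i\<in>UNIV. (x $ i) ^ p)" for x :: "real ^ 'n"
  proof -
    obtain i where i: "\<And>j. \<bar>x $ j\<bar> \<le> \<bar>x $ i\<bar>"
    proof -
      have "Max (range (\<lambda>i. \<bar>x $ i\<bar>)) \<in> range (\<lambda>i. \<bar>x $ i\<bar>)" by (intro Max_in) auto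
      then obtain i where "Max (range (\<lambda>i. \<bar>x $ i\<bar>)) = \<bar>x $ i\<bar>" by (metis (no_types, lifting) imageE)
      then show thesis using that[of i] by (metis Max_ge finite_code finite_imageI rangeI)
    qed
    have "norm x \<le> (\<Sum>j\<in>UNIV. \<bar>x $ j\<bar>)" by (rule norm_le_l1_cart)
    also have "\<dots> \<le> real CARD('n) * \<bar>x $ i\<bar>" using i by (intro sum_bounded_above) 
    finally have "norm x ^ p \<le> (real CARD('n) * \<bar>x $ i\<bar>) ^ p" by (intro power_mono) auto
    also have "\<dots> = real CARD('n) ^ p * (x $ i) ^ p" using assms(2) by (simp add: power_mult_distrib power_even_abs)
    also have "(x $ i) ^ p \<le> (\<Sum>i\<in>UNIV. (x $ i) ^ p)"
      using assms(2) by (intro member_le_sum) (auto simp: zero_le_even_power)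
    finally show ?thesis by (simp add: mult_left_mono)
  qed
  have i: "integrable M (\<lambda>\<omega>. real CARD('n) ^ p * (\<Sum>i\<in>UNIV. (X t \<omega> $ i) ^ p))"
    using integrable_power_component[OF assms(1)] by auto
  have "(\<integral>\<^sup>+\<omega>. ennreal (norm (X t \<omega>) ^ p) \<partial>M) \<le> (\<integral>\<^sup>+\<omega>. ennreal (real CARD('n) ^ p * (\<Sum>i\<in>UNIV. (X t \<omega> $ i) ^ p)) \<partial>M)"
    using le by (intro nn_integral_mono ennreal_leI)
  also have "\<dots> < \<infinity>"
    using i assms(2) by (subst nn_integral_eq_integral) (auto intro!: AE_I2 mult_nonneg_nonneg sum_nonneg simp: zero_le_even_power)
  finally show ?thesis .
qed

lemma dyadic_max_measurable:
  "(\<lambda>f. dyadic_max p k (\<lambda>t. f (c * t) :: real ^ 'n)) \<in> borel_measurable path_space" if "0 \<le> c"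
proof -
  have [measurable]: "(\<lambda>f. f (c * (real j / 2 ^ k)) :: real ^ 'n) \<in> borel_measurable path_space" for j
    using that by (intro measurable_component_singleton) simp
  show ?thesis unfolding dyadic_max_def by measurable
qed

text \<open>Halving time multiplies the \<open>p\<close>-th power by
  \<open>(1 / 2) powr (H * p) = 1 / 4\<close>, so the two halves of the grid contribute
  \<open>1/4\<close> and \<open>3/2 * 1/4\<close>, together \<open>5/8 < 1\<close>. With
  \<open>H * p = 1\<close> the halves would add up to at least 1 and nothing would contract. An
  inequality \<open>S \<le> 5/8 * S + K\<close> says nothing about an infinite \<open>S\<close>; it
  is therefore used as a recursion over finite grids from a finite initial value, and the limit is
  taken last.\<close>

lemma expectation_SUP_dyadic_max_finite:
  assumes p: "even p" "H * p = 2"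
  shows "(\<integral>\<^sup>+\<omega>. (SUP k. dyadic_max p k (\<lambda>t. X t \<omega>)) \<partial>M) < \<infinity>"
proof -
  define u where "u k = (\<integral>\<^sup>+\<omega>. dyadic_max p k (\<lambda>t. X t \<omega>) \<partial>M)" for k
  obtain C where C: "0 \<le> C" "\<And>x y::real. 0 \<le> x \<Longrightarrow> 0 \<le> y \<Longrightarrow> (x + y) ^ p \<le> 3 / 2 * x ^ p + C * y ^ p"
    using power_add_le_three_halves[of p] by blast
  define K where "K = ennreal C * (\<integral>\<^sup>+\<omega>. ennreal (norm (X (1 / 2) \<omega>) ^ p) \<partial>M)"
  have "K < \<infinity>" unfolding K_def using nn_integral_norm_power_finite[of "1 / 2" p] p by (simp add: ennreal_mult_less_top)
  have mX[measurable]: "X t \<in> borel_measurable M" if "0 \<le> t" for t using measurable_X that .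
  have meas: "(\<lambda>\<omega>. dyadic_max p k (\<lambda>t. Y t \<omega>)) \<in> borel_measurable M"
    if "\<And>t. 0 \<le> t \<Longrightarrow> Y t \<in> borel_measurable M" for Y :: "real \<Rightarrow> 'a \<Rightarrow> real ^ 'n" and k
    unfolding dyadic_max_def using that
    by (intro borel_measurable_SUP) (auto intro!: borel_measurable_power measurable_compose[OF _ borel_measurable_norm])
  have rw: "((1 / 2) powr H) ^ p = 1 / 4"
  proof -
    have "((1 / 2) powr H) ^ p = (1 / 2) powr (H * p)" by (simp add: powr_power mult.commute)
    then show ?thesis unfolding p(2) by (simp add: powr_numeral power2_eq_square)
  qed
  have half: "(\<integral>\<^sup>+\<omega>. dyadic_max p k (\<lambda>t. X (1 / 2 * t) \<omega>) \<partial>M) = ennreal (1 / 4) * u k" for k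
  proof -
    \<comment> \<open>The factor in \<open>1 * t\<close> gives the integrand the shape of
      \<open>dyadic_max_measurable\<close>.\<close>
    have "(\<integral>\<^sup>+\<omega>. dyadic_max p k (\<lambda>t. (\<lambda>t\<in>{0..}. X (1 / 2 * t) \<omega>) (1 * t)) \<partial>M)
      = (\<integral>\<^sup>+\<omega>. dyadic_max p k (\<lambda>t. (\<lambda>t\<in>{0..}. (1 / 2) powr H *\<^sub>R X t \<omega>) (1 * t)) \<partial>M)"
      by (rule process_law_nn_integral[OF self_similar _ _ dyadic_max_measurable]) auto
    then have "(\<integral>\<^sup>+\<omega>. dyadic_max p k (\<lambda>t. X (1 / 2 * t) \<omega>) \<partial>M)
      = (\<integral>\<^sup>+\<omega>. dyadic_max p k (\<lambda>t. (1 / 2) powr H *\<^sub>R X t \<omega>) \<partial>M)"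
      by (simp cong: dyadic_max_cong)
    also have "\<dots> = ennreal (1 / 4) * u k"
      unfolding u_def by (simp only: dyadic_max_scaleR powr_ge_zero rw) (intro nn_integral_cmult meas mX)
    finally show ?thesis .
  qed
  have half': "(\<integral>\<^sup>+\<omega>. dyadic_max p k (\<lambda>t. X (1 / 2 + 1 / 2 * t) \<omega> - X (1 / 2) \<omega>) \<partial>M) = ennreal (1 / 4) * u k" for k
  proof -
    have "(\<integral>\<^sup>+\<omega>. dyadic_max p k (\<lambda>t. (\<lambda>t\<in>{0..}. X (1 / 2 + t) \<omega> - X (1 / 2) \<omega>) (1 / 2 * t)) \<partial>M)
      = (\<integral>\<^sup>+\<omega>. dyadic_max p k (\<lambda>t. (\<lambda>t\<in>{0..}. X t \<omega> - X 0 \<omega>) (1 / 2 * t)) \<partial>M)"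
      by (rule process_law_nn_integral[OF stationary_increments _ _ dyadic_max_measurable]) auto
    then have "(\<integral>\<^sup>+\<omega>. dyadic_max p k (\<lambda>t. X (1 / 2 + 1 / 2 * t) \<omega> - X (1 / 2) \<omega>) \<partial>M)
      = (\<integral>\<^sup>+\<omega>. dyadic_max p k (\<lambda>t. X (1 / 2 * t) \<omega> - X 0 \<omega>) \<partial>M)"
      by (simp cong: dyadic_max_cong)
    also have "\<dots> = (\<integral>\<^sup>+\<omega>. dyadic_max p k (\<lambda>t. X (1 / 2 * t) \<omega>) \<partial>M)"
      using start_zero by (intro nn_integral_cong_AE) (auto elim: eventually_mono)
    finally show ?thesis using half by simp
  qed
  have step: "u (Suc k) \<le> ennreal (5 / 8) * u k + K" for k
  proof -
    have "u (Suc k) \<le> (\<integral>\<^sup>+\<omega>. dyadic_max p k (\<lambda>t. X (1 / 2 * t) \<omega>)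
      + ennreal (3 / 2) * dyadic_max p k (\<lambda>t. X (1 / 2 + 1 / 2 * t) \<omega> - X (1 / 2) \<omega>) + ennreal (C * norm (X (1 / 2) \<omega>) ^ p) \<partial>M)"
      unfolding u_def by (intro nn_integral_mono dyadic_max_Suc[OF C])
    also have "\<dots> = ennreal (1 / 4) * u k + ennreal (3 / 2) * (ennreal (1 / 4) * u k) + K"
    proof -
      define A where "A \<omega> = dyadic_max p k (\<lambda>t. X (1 / 2 * t) \<omega>)" for \<omega>
      define B where "B \<omega> = dyadic_max p k (\<lambda>t. X (1 / 2 + 1 / 2 * t) \<omega> - X (1 / 2) \<omega>)" for \<omega>
      define D where "D \<omega> = ennreal (norm (X (1 / 2) \<omega>) ^ p)" for \<omega>
      have [measurable]: "A \<in> borel_measurable M" "B \<in> borel_measurable M" "D \<in> borel_measurable M"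
        unfolding A_def B_def D_def by (rule meas; auto)+ measurable
      have "(\<integral>\<^sup>+\<omega>. A \<omega> + ennreal (3 / 2) * B \<omega> + ennreal C * D \<omega> \<partial>M)
        = (\<integral>\<^sup>+\<omega>. A \<omega> \<partial>M) + ennreal (3 / 2) * (\<integral>\<^sup>+\<omega>. B \<omega> \<partial>M) + ennreal C * (\<integral>\<^sup>+\<omega>. D \<omega> \<partial>M)"
        by (simp add: nn_integral_add nn_integral_cmult)
      then show ?thesis
        using half[of k] half'[of k] C(1) unfolding A_def B_def D_def K_def by (simp only: ennreal_mult zero_le_power norm_ge_zero)
    qed
    also have "ennreal (1 / 4) * u k + ennreal (3 / 2) * (ennreal (1 / 4) * u k) = ennreal (5 / 8) * u k"
      by (simp add: mult.assoc[symmetric] distrib_right[symmetric] ennreal_mult[symmetric] ennreal_plus[symmetric] del: ennreal_plus)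
    finally show ?thesis .
  qed
  have "u 0 \<le> (\<integral>\<^sup>+\<omega>. ennreal (norm (X 0 \<omega>) ^ p) + ennreal (norm (X 1 \<omega>) ^ p) \<partial>M)"
    unfolding u_def
  proof (intro nn_integral_mono, unfold dyadic_max_def, intro SUP_least)
    fix \<omega> and j :: nat assume "j \<in> {0..2 ^ 0}"
    then have "j = 0 \<or> j = 1" by auto
    then show "ennreal (norm (X (real j / 2 ^ 0) \<omega>) ^ p) \<le> ennreal (norm (X 0 \<omega>) ^ p) + ennreal (norm (X 1 \<omega>) ^ p)"
      by (auto intro: add_increasing add_increasing2)
  qed
  also have "\<dots> < \<infinity>"
    using nn_integral_norm_power_finite[of 0 p] nn_integral_norm_power_finite[of 1 p] p by (simp add: nn_integral_add)
  finally have "u 0 < \<infinity>" .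
  \<comment> \<open>The recursion preserves every bound that is at least
    \<open>K / (1 - 5/8) = 8/3 * K\<close>; the term \<open>3 * K\<close> rounds this up.\<close>
  define L where "L = u 0 + 3 * K"
  have "L < \<infinity>" using \<open>u 0 < \<infinity>\<close> \<open>K < \<infinity>\<close> by (simp add: L_def ennreal_mult_less_top)
  have uL: "u k \<le> L" for k
  proof (induction k)
    case 0
    then show ?case by (simp add: L_def add_increasing2)
  next
    case (Suc k)
    obtain a b where ab: "u 0 = ennreal a" "0 \<le> a" "K = ennreal b" "0 \<le> b"
      using \<open>u 0 < \<infinity>\<close> \<open>K < \<infinity>\<close> by (metis ennreal_cases infinity_ennreal_def less_irrefl)
    have L: "L = ennreal (a + 3 * b)" unfolding L_def ab using ab
      by (simp add: ennreal_mult ennreal_plus)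
    have "u (Suc k) \<le> ennreal (5 / 8) * L + K"
      using step[of k] Suc by (meson add_right_mono mult_left_mono order_trans zero_le)
    also have "\<dots> = ennreal (5 / 8 * (a + 3 * b) + b)"
      unfolding L ab using ab by (subst ennreal_mult[symmetric]) (auto simp: ennreal_plus[symmetric] simp del: ennreal_plus)
    also have "\<dots> \<le> L" unfolding L using ab by (intro ennreal_leI) auto
    finally show ?case .
  qed
  have "(\<integral>\<^sup>+\<omega>. (SUP k. dyadic_max p k (\<lambda>t. X t \<omega>)) \<partial>M) = (SUP k. u k)"
    unfolding u_def
    by (intro nn_integral_monotone_convergence_SUP incseq_SucI le_funI dyadic_max_Suc_mono meas mX)
  also have "\<dots> \<le> L" by (intro SUP_least uL)
  finally show ?thesis using \<open>L < \<infinity>\<close> by simp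
qed

text \<open>A path of norm at most \<open>r\<close> stays in a cube of side \<open>2 * r\<close>. If
  \<open>R\<close> is the supremum of the power \<open>2 * CARD('n)\<close> of the norm, the volume
  is \<open>2 ^ CARD('n)\<close> times the square root of \<open>R\<close>, which is at most
  \<open>1 + R\<close>.\<close>

lemma emeasure_path_le:
  assumes \<omega>: "\<omega> \<in> space M"
  shows "emeasure lborel ((\<lambda>t. X t \<omega>) ` {0..1})
    \<le> 2 ^ CARD('n) * (1 + (SUP k. dyadic_max (2 * CARD('n)) k (\<lambda>t. X t \<omega>)))"
proof (cases "(SUP k. dyadic_max (2 * CARD('n)) k (\<lambda>t. X t \<omega>)) = \<infinity>")
  case True
  then show ?thesis unfolding True by (simp add: ennreal_mult_top)
next
  case False
  let ?n = "CARD('n)"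
  obtain R where R: "0 \<le> R" "(SUP k. dyadic_max (2 * ?n) k (\<lambda>t. X t \<omega>)) = ennreal R"
    using False by (metis ennreal_cases infinity_ennreal_def)
  define r where "r = root (2 * ?n) R"
  have r: "0 \<le> r" "r ^ (2 * ?n) = R" using R(1) by (auto simp: r_def)
  have "norm (X t \<omega>) \<le> r" if "t \<in> {0..1}" for t
  proof -
    have "ennreal (norm (X t \<omega>) ^ (2 * ?n)) \<le> ennreal R"
      unfolding R(2)[symmetric] using that \<omega> continuous_paths by (intro norm_power_le_SUP_dyadic_max) auto
    then have "norm (X t \<omega>) ^ (2 * ?n) \<le> r ^ (2 * ?n)" using R(1) r by simp
    then show ?thesis by (rule power_le_imp_le_base[rotated 0, of _ "2 * ?n - 1", simplified]) (use r in auto)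
  qed
  then have "\<bar>X t \<omega> \<bullet> b\<bar> \<le> r" if "t \<in> {0..1}" "b \<in> Basis" for t b
    using Basis_le_norm[OF that(2), of "X t \<omega>"] that(1) by (meson order_trans)
  then have "- r \<le> X t \<omega> \<bullet> b \<and> X t \<omega> \<bullet> b \<le> r" if "t \<in> {0..1}" "b \<in> Basis" for t b
    using that by (simp add: abs_le_iff minus_le_iff)
  then have "(\<lambda>t. X t \<omega>) ` {0..1} \<subseteq> cbox (\<Sum>b\<in>Basis. - r *\<^sub>R b) (\<Sum>b\<in>Basis. r *\<^sub>R b)"
    by (auto simp: mem_box inner_sum_left_Basis[where f="\<lambda>_. r"] sum_negf)
  then have "emeasure lborel ((\<lambda>t. X t \<omega>) ` {0..1}) \<le> emeasure lborel (cbox (\<Sum>b\<in>Basis. - r *\<^sub>R b) (\<Sum>b\<in>Basis. r *\<^sub>R b) :: (real ^ 'n) set)"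
    by (intro emeasure_mono) auto
  also have "\<dots> = ennreal ((2 * r) ^ ?n)"
  proof -
    have u: "(\<Sum>b\<in>Basis. r *\<^sub>R b) \<bullet> b = r" if "b \<in> Basis" for b :: "real ^ 'n"
      using inner_sum_left_Basis[OF that, of "\<lambda>_. r"] by simp
    have l: "(\<Sum>b\<in>Basis. - r *\<^sub>R b) \<bullet> b = - r" if "b \<in> Basis" for b :: "real ^ 'n"
      using inner_sum_left_Basis[OF that, of "\<lambda>_. - r"] by simp
    have "(\<Prod>b\<in>Basis. ((\<Sum>b\<in>Basis. r *\<^sub>R b) - (\<Sum>b\<in>Basis. - r *\<^sub>R b)) \<bullet> (b :: real ^ 'n)) = (2 * r) ^ ?n"
      by (simp only: inner_diff_left u l cong: prod.cong) simp
    moreover have "(\<Sum>b\<in>Basis. - r *\<^sub>R b) \<bullet> b \<le> (\<Sum>b\<in>Basis. r *\<^sub>R b) \<bullet> b" if "b \<in> Basis" for b :: "real ^ 'n"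
      unfolding u[OF that] l[OF that] using r(1) by simp
    ultimately show ?thesis by (subst emeasure_lborel_cbox) simp_all
  qed
  also have "\<dots> \<le> ennreal (2 ^ ?n * (1 + R))"
  proof (rule ennreal_leI)
    have "r ^ ?n \<le> 1 + (r ^ ?n)\<^sup>2" using sum_squares_bound[of 1 "r ^ ?n"] zero_le_power[OF r(1), of ?n] by simp
    also have "(r ^ ?n)\<^sup>2 = R" unfolding r(2)[symmetric] by (simp add: power_mult[symmetric] mult.commute)
    finally show "(2 * r) ^ ?n \<le> 2 ^ ?n * (1 + R)" by (simp add: power_mult_distrib)
  qed
  also have "\<dots> = 2 ^ ?n * (1 + ennreal R)"
    using R(1) by (simp add: ennreal_mult ennreal_power[symmetric])
  finally show ?thesis unfolding R(2) .
qed

end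

section \<open>Volume of the range and Levy's argument\<close>

text \<open>For a continuous path on a nondegenerate interval this means that \<open>z\<close> lies
  in the image (\<open>hits_iff_image\<close>). Phrased with countably many times, it is measurable
  for arbitrary functions on the product space, jointly with \<open>z\<close>.\<close>

definition hits :: "real \<Rightarrow> real \<Rightarrow> 'b::metric_space \<Rightarrow> (real \<Rightarrow> 'b) \<Rightarrow> bool" where
  "hits a b z f \<longleftrightarrow> (\<forall>k::nat. \<exists>r::rat. a \<le> real_of_rat r \<and> real_of_rat r \<le> b \<and> dist (f (real_of_rat r)) z < inverse (real (Suc k)))"

lemma hits_cong:
  assumes "\<And>t. a \<le> t \<Longrightarrow> t \<le> b \<Longrightarrow> dist (f t) z = dist (g t) w"
  shows "hits a b z f \<longleftrightarrow> hits a b w g"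
proof -
  have "(a \<le> real_of_rat r \<and> real_of_rat r \<le> b \<and> dist (f (real_of_rat r)) z < e)
    \<longleftrightarrow> (a \<le> real_of_rat r \<and> real_of_rat r \<le> b \<and> dist (g (real_of_rat r)) w < e)" for r e
    using assms[of "real_of_rat r"] by auto
  then show ?thesis unfolding hits_def by (simp only:)
qed

lemma hits_mono: "hits a b z f \<Longrightarrow> a' \<le> a \<Longrightarrow> b \<le> b' \<Longrightarrow> hits a' b' z f"
  unfolding hits_def
proof (intro allI)
  fix k :: nat
  assume "\<forall>k::nat. \<exists>r::rat. a \<le> real_of_rat r \<and> real_of_rat r \<le> b \<and> dist (f (real_of_rat r)) z < inverse (real (Suc k))"
    and ab: "a' \<le> a" "b \<le> b'"
  then obtain r :: rat where "a \<le> real_of_rat r" "real_of_rat r \<le> b" "dist (f (real_of_rat r)) z < inverse (real (Suc k))"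
    by blast
  with ab show "\<exists>r::rat. a' \<le> real_of_rat r \<and> real_of_rat r \<le> b' \<and> dist (f (real_of_rat r)) z < inverse (real (Suc k))"
    by (intro exI[of _ r]) auto
qed

lemma hits_iff_image:
  fixes f :: "real \<Rightarrow> 'b::metric_space"
  assumes f: "continuous_on {0..} f" and ab: "0 \<le> a" "a < b"
  shows "hits a b z f \<longleftrightarrow> z \<in> f ` {a..b}"
proof
  have cont: "continuous_on {a..b} f" using f ab by (auto intro: continuous_on_subset)
  assume h: "hits a b z f"
  have "z \<in> closure (f ` {a..b})"
    unfolding closure_approachable
  proof (intro allI impI)
    fix e :: real assume "0 < e"
    then obtain k :: nat where "inverse (real (Suc k)) < e" using reals_Archimedean by blast
    moreover obtain r :: rat where "a \<le> real_of_rat r" "real_of_rat r \<le> b" "dist (f (real_of_rat r)) z < inverse (real (Suc k))"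
      using h unfolding hits_def by blast
    ultimately show "\<exists>y\<in>f ` {a..b}. dist y z < e" by force
  qed
  moreover have "compact (f ` {a..b})" using cont by (intro compact_continuous_image) auto
  then have "closed (f ` {a..b})" by (rule compact_imp_closed)
  ultimately show "z \<in> f ` {a..b}" by simp
next
  assume "z \<in> f ` {a..b}"
  then obtain t where t: "a \<le> t" "t \<le> b" "z = f t" by auto
  show "hits a b z f"
    unfolding hits_def
  proof
    fix k :: nat
    have "0 < inverse (real (Suc k))" by simp
    moreover have "continuous_on {a..b} f" using f ab by (auto intro: continuous_on_subset)
    ultimately obtain d where d: "0 < d" "\<And>s. s \<in> {a..b} \<Longrightarrow> dist s t < d \<Longrightarrow> dist (f s) (f t) < inverse (real (Suc k))"
      using t unfolding continuous_on_iff by (metis atLeastAtMost_iff)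
    \<comment> \<open>Here \<open>a < b\<close> matters: even at an endpoint \<open>t\<close>, the
      neighbourhood inside [a, b] has positive length and contains a rational.\<close>
    have "max a (t - d) < min b (t + d)" using d(1) t ab by (auto simp: max_def min_def)
    then obtain r' where "r' \<in> \<rat>" "max a (t - d) < r'" "r' < min b (t + d)" using Rats_dense_in_real by blast
    then obtain r where "max a (t - d) < real_of_rat r" "real_of_rat r < min b (t + d)" by (auto simp: Rats_def)
    then show "\<exists>r::rat. a \<le> real_of_rat r \<and> real_of_rat r \<le> b \<and> dist (f (real_of_rat r)) z < inverse (real (Suc k))"
      using d(2)[of "real_of_rat r"] t(3) by (intro exI[of _ r]) (auto simp: dist_real_def)
  qed
qed

lemma pred_hits:
  fixes Y :: "real \<Rightarrow> 'a \<Rightarrow> 'b::{metric_space, second_countable_topology}"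
  assumes Y: "\<And>t. a \<le> t \<Longrightarrow> t \<le> b \<Longrightarrow> Y t \<in> borel_measurable N" and z[measurable]: "z \<in> borel_measurable N"
  shows "Measurable.pred N (\<lambda>x. hits a b (z x) (\<lambda>t. Y t x))"
proof -
  have *: "Measurable.pred N (\<lambda>x. a \<le> real_of_rat r \<and> real_of_rat r \<le> b \<and> dist (Y (real_of_rat r) x) (z x) < inverse (real (Suc k)))" for r k
  proof (cases "a \<le> real_of_rat r \<and> real_of_rat r \<le> b")
    case True
    then have [measurable]: "Y (real_of_rat r) \<in> borel_measurable N" using Y by simp
    show ?thesis by measurable
  next
    case False
    then have "(\<lambda>x. a \<le> real_of_rat r \<and> real_of_rat r \<le> b \<and> dist (Y (real_of_rat r) x) (z x) < inverse (real (Suc k))) = (\<lambda>_. False)"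
      by (intro ext) blast
    then show ?thesis by (simp only: measurable_const space_count_space UNIV_I)
  qed
  show ?thesis unfolding hits_def by (rule pred_intros_countable, rule pred_intros_countable, rule *)
qed

text \<open>Going through \<open>hits\<close> makes this a measurable functional on
  \<open>path_space\<close>, so that self-similarity and stationarity of the increments apply to its
  expectation.\<close>

definition range_vol :: "real \<Rightarrow> real \<Rightarrow> (real \<Rightarrow> 'b::euclidean_space) \<Rightarrow> ennreal" where
  "range_vol a b f = emeasure lborel {z. hits a b z f}"

lemma range_vol_eq:
  "continuous_on {0..} f \<Longrightarrow> 0 \<le> a \<Longrightarrow> a < b \<Longrightarrow> range_vol a b f = emeasure lborel (f ` {a..b})"
  unfolding range_vol_def by (simp only: hits_iff_image Collect_mem_eq)

lemma range_vol_cong: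
  assumes "\<And>t. a \<le> t \<Longrightarrow> t \<le> b \<Longrightarrow> f t = g t"
  shows "range_vol a b f = range_vol a b g"
proof -
  have "hits a b z f \<longleftrightarrow> hits a b z g" for z by (rule hits_cong) (simp add: assms)
  then show ?thesis unfolding range_vol_def by simp
qed

lemma measurable_emeasure_Collect:
  fixes P :: "'a \<Rightarrow> 'b::euclidean_space \<Rightarrow> bool"
  assumes "Measurable.pred (N \<Otimes>\<^sub>M borel) (\<lambda>p. P (fst p) (snd p))"
  shows "(\<lambda>x. emeasure lborel {z. P x z}) \<in> borel_measurable N"
proof -
  have "{p \<in> space (N \<Otimes>\<^sub>M lborel). P (fst p) (snd p)} \<in> sets (N \<Otimes>\<^sub>M lborel)"
    using assms by (simp add: pred_def space_pair_measure cong: sets_pair_measure_cong)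
  then have "(\<lambda>x. emeasure lborel (Pair x -` {p \<in> space (N \<Otimes>\<^sub>M lborel). P (fst p) (snd p)})) \<in> borel_measurable N"
    by (rule lborel.measurable_emeasure_Pair)
  then show ?thesis by (rule measurable_cong[THEN iffD1, rotated]) (simp add: space_pair_measure vimage_def)
qed

lemma range_vol_measurable:
  fixes Y :: "real \<Rightarrow> 'a \<Rightarrow> 'b::euclidean_space"
  assumes Y: "\<And>t. a \<le> t \<Longrightarrow> t \<le> b \<Longrightarrow> Y t \<in> borel_measurable N"
  shows "(\<lambda>x. range_vol a b (\<lambda>t. Y t x)) \<in> borel_measurable N"
  unfolding range_vol_def
proof (rule measurable_emeasure_Collect, rule pred_hits)
  fix t assume "a \<le> t" "t \<le> b"
  then show "(\<lambda>p. Y t (fst p)) \<in> borel_measurable (N \<Otimes>\<^sub>M borel)"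
    by (intro measurable_compose[OF measurable_fst Y])
qed simp

text \<open>Serves for dilations, for translations and, with \<open>c = -1\<close>, for the
  reflection of a range at a point.\<close>

lemma emeasure_lborel_affine_vimage:
  fixes A :: "'b::euclidean_space set"
  assumes c: "c \<noteq> 0" and A: "A \<in> sets borel"
  shows "emeasure lborel A = ennreal (\<bar>c\<bar> ^ DIM('b)) * emeasure lborel {x. t + c *\<^sub>R x \<in> A}"
proof -
  have "emeasure lborel A = emeasure (density (distr lborel borel (\<lambda>x. t + c *\<^sub>R x)) (\<lambda>_. \<bar>c\<bar> ^ DIM('b))) A"
    using lborel_affine[OF c, of t] by simp
  also have "\<dots> = ennreal (\<bar>c\<bar> ^ DIM('b)) * emeasure lborel {x. t + c *\<^sub>R x \<in> A}"
    using A by (subst emeasure_density_const) (auto simp: emeasure_distr vimage_def)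
  finally show ?thesis .
qed

lemma emeasure_lborel_scaleR:
  fixes A :: "'b::euclidean_space set"
  assumes c: "0 < c" and A: "closed A"
  shows "emeasure lborel ((*\<^sub>R) c ` A) = ennreal (c ^ DIM('b)) * emeasure lborel A"
proof -
  have "closed ((*\<^sub>R) c ` A)" using A by (rule closed_scaling)
  moreover have "{x. 0 + c *\<^sub>R x \<in> (*\<^sub>R) c ` A} = A" using c by auto
  ultimately show ?thesis using emeasure_lborel_affine_vimage[of c "(*\<^sub>R) c ` A" 0] c by simp
qed

lemma emeasure_lborel_translate:
  fixes A :: "'b::euclidean_space set"
  assumes A: "closed A"
  shows "emeasure lborel ((\<lambda>x. x - t) ` A) = emeasure lborel A"
proof -
  have eq: "(\<lambda>x. x - t) ` A = {x. t + 1 *\<^sub>R x \<in> A}"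
  proof safe
    fix x assume "t + 1 *\<^sub>R x \<in> A"
    then show "x \<in> (\<lambda>x. x - t) ` A" by (intro image_eqI[of _ _ "t + x"]) auto
  qed auto
  show ?thesis unfolding eq using emeasure_lborel_affine_vimage[of 1 A t] A by simp
qed

text \<open>With \<open>\<tau>\<close> the supremum of all \<open>a\<close> for which the range over \<open>[0, a]\<close> is null, the
  ranges over \<open>[0, \<tau>)\<close> and over \<open>(\<tau>, c]\<close> are both countable unions of null sets.\<close>
lemma range_null_dichotomy:
  fixes f :: "real \<Rightarrow> 'b::euclidean_space"
  assumes f: "continuous_on {0..} f" and c: "0 < c"
    and dich: "\<And>a b. a \<in> \<rat> \<Longrightarrow> b \<in> \<rat> \<Longrightarrow> 0 < a \<Longrightarrow> a < b \<Longrightarrow> b < c \<Longrightarrow>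
      emeasure lborel (f ` {0..a}) = 0 \<or> emeasure lborel (f ` {b..c}) = 0"
  shows "emeasure lborel (f ` {0..c}) = 0"
proof -
  have cl: "f ` {a..b} \<in> sets lborel" if "0 \<le> a" for a b
  proof -
    have "compact (f ` {a..b})"
      using f that by (intro compact_continuous_image) (auto intro: continuous_on_subset)
    then show ?thesis by (simp add: compact_imp_closed)
  qed
  define S where "S = {a \<in> {0..c}. emeasure lborel (f ` {0..a}) = 0}"
  define \<tau> where "\<tau> = Sup S"
  have S: "0 \<in> S" "bdd_above S" using c by (auto simp: S_def)
  have "0 \<le> \<tau>" unfolding \<tau>_def using S by (intro cSup_upper) auto
  have below: "f ` {0..a} \<in> null_sets lborel" if "a < \<tau>" "0 \<le> a" for a
  proof -
    obtain a' where "a' \<in> S" "a < a'" using \<open>a < \<tau>\<close> S less_cSup_iff[of S a] unfolding \<tau>_def by (metis empty_iff)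
    then have "f ` {0..a'} \<in> null_sets lborel" using cl by (auto simp: S_def null_sets_def)
    then show ?thesis using \<open>a < a'\<close> cl by (rule_tac null_sets_subset) (auto intro!: image_mono)
  qed
  have above: "f ` {b..c} \<in> null_sets lborel" if "\<tau> < b" "b < c" "b \<in> \<rat>" for b
  proof -
    \<comment> \<open>A rational strictly between \<tau> and \<open>b\<close> is outside
      \<open>S\<close>; the dichotomy, given at rational times only, then makes the other side
      null.\<close>
    obtain a where a: "a \<in> \<rat>" "\<tau> < a" "a < b" using Rats_dense_in_real[OF \<open>\<tau> < b\<close>] by auto
    then have "a \<notin> S" using S cSup_upper[of a S] unfolding \<tau>_def by auto
    then have "emeasure lborel (f ` {0..a}) \<noteq> 0" using a that \<open>0 \<le> \<tau>\<close> by (auto simp: S_def)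
    then have "emeasure lborel (f ` {b..c}) = 0" using dich[of a b] a that \<open>0 \<le> \<tau>\<close> by auto
    then show ?thesis using cl that \<open>0 \<le> \<tau>\<close> by (auto simp: null_sets_def)
  qed
  \<comment> \<open>The single points account for the times \<tau>, 0 and \<open>c\<close>, where
    the two rational unions are not relied upon.\<close>
  let ?U = "(\<Union>a\<in>{a\<in>\<rat>. 0 \<le> a \<and> a < \<tau>}. f ` {0..a}) \<union> (\<Union>b\<in>{b\<in>\<rat>. \<tau> < b \<and> b < c}. f ` {b..c}) \<union> {f \<tau>, f 0, f c}"
  have cnt: "countable {a\<in>\<rat>. 0 \<le> a \<and> a < \<tau>}" "countable {b\<in>\<rat>. \<tau> < b \<and> b < (c::real)}"
    by (rule countable_subset[OF _ countable_rat], auto)+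
  have "(\<Union>a\<in>{a\<in>\<rat>. 0 \<le> a \<and> a < \<tau>}. f ` {0..a}) \<in> null_sets lborel"
    by (rule null_sets_UN'[OF cnt(1)]) (simp add: below)
  moreover have "(\<Union>b\<in>{b\<in>\<rat>. \<tau> < b \<and> b < c}. f ` {b..c}) \<in> null_sets lborel"
    by (rule null_sets_UN'[OF cnt(2)]) (simp add: above)
  moreover have "{f \<tau>, f 0, f c} \<in> null_sets lborel" by (rule finite_imp_null_set_lborel) simp
  ultimately have U: "?U \<in> null_sets lborel" by (intro null_sets.Un)
  have "f ` {0..c} \<subseteq> ?U"
  proof
    fix x assume "x \<in> f ` {0..c}"
    then obtain t where t: "0 \<le> t" "t \<le> c" "x = f t" by auto
    consider "t = 0" | "t = c" | "t = \<tau>" | "0 < t" "t < \<tau>" | "\<tau> < t" "t < c" using t by linarith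
    then show "x \<in> ?U"
    proof cases
      case 1
      then show ?thesis using t(3) by (intro UnI2) simp
    next
      case 2
      then show ?thesis using t(3) by (intro UnI2) simp
    next
      case 3
      then show ?thesis using t(3) by (intro UnI2) simp
    next
      case 4
      obtain a where a: "a \<in> \<rat>" "t < a" "a < \<tau>" using Rats_dense_in_real[OF 4(2)] by auto
      then have "x \<in> f ` {0..a}" "a \<in> {a\<in>\<rat>. 0 \<le> a \<and> a < \<tau>}" using t by auto
      then have "x \<in> (\<Union>a\<in>{a\<in>\<rat>. 0 \<le> a \<and> a < \<tau>}. f ` {0..a})" by (rule UN_I[rotated])
      then show ?thesis by (rule UnI1[OF UnI1])
    next
      case 5
      obtain b where b: "b \<in> \<rat>" "\<tau> < b" "b < t" using Rats_dense_in_real[OF 5(1)] by auto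
      then have "x \<in> f ` {b..c}" "b \<in> {b\<in>\<rat>. \<tau> < b \<and> b < c}" using t 5 by auto
      then have "x \<in> (\<Union>b\<in>{b\<in>\<rat>. \<tau> < b \<and> b < c}. f ` {b..c})" by (rule UN_I[rotated])
      then show ?thesis by (rule UnI1[OF UnI2])
    qed
  qed
  then have "f ` {0..c} \<in> null_sets lborel" using cl U by (intro null_sets_subset[OF U]) auto
  then show ?thesis by auto
qed

section \<open>The range of fractional Brownian motion in the critical dimension\<close>

context fractional_brownian_motion
begin

abbreviation path :: "'a \<Rightarrow> real \<Rightarrow> real ^ 'n" where "path \<omega> \<equiv> (\<lambda>t. X t \<omega>)"

lemma closed_path_image: "\<omega> \<in> space M \<Longrightarrow> 0 \<le> a \<Longrightarrow> closed (path \<omega> ` {a..b})"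
  by (intro compact_imp_closed compact_continuous_image continuous_on_subset[OF continuous_paths]) auto

lemma nn_integral_range_vol_scaling:
  assumes n: "H * CARD('n) = 1" and c: "0 < c"
  shows "(\<integral>\<^sup>+\<omega>. emeasure lborel (path \<omega> ` {0..c}) \<partial>M) = ennreal c * (\<integral>\<^sup>+\<omega>. emeasure lborel (path \<omega> ` {0..1}) \<partial>M)"
proof -
  \<comment> \<open>Criticality is used here: dilating space by \<open>c powr H\<close> multiplies
    volume by its power with exponent \<open>CARD('n)\<close>, which is exactly
    \<open>c\<close>.\<close>
  have powc: "(c powr H) ^ CARD('n) = c" using n c by (simp add: powr_power mult.commute)
  have m: "(\<lambda>f. range_vol 0 1 f) \<in> borel_measurable (path_space :: (real \<Rightarrow> real ^ 'n) measure)"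
    using range_vol_measurable[of 0 1 "\<lambda>t f. f t" "path_space :: (real \<Rightarrow> real ^ 'n) measure"]
    by (auto intro: measurable_component_singleton)
  have "(\<integral>\<^sup>+\<omega>. range_vol 0 1 (\<lambda>t\<in>{0..}. X (c * t) \<omega>) \<partial>M) = (\<integral>\<^sup>+\<omega>. range_vol 0 1 (\<lambda>t\<in>{0..}. c powr H *\<^sub>R X t \<omega>) \<partial>M)"
    using measurable_X c by (intro process_law_nn_integral[OF self_similar _ _ m]) auto
  moreover have "range_vol 0 1 (\<lambda>t\<in>{0..}. X (c * t) \<omega>) = emeasure lborel (path \<omega> ` {0..c})" if "\<omega> \<in> space M" for \<omega>
  proof -
    have "range_vol 0 1 (\<lambda>t\<in>{0..}. X (c * t) \<omega>) = range_vol 0 1 (\<lambda>t. X (c * t) \<omega>)" by (rule range_vol_cong) auto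
    also have "\<dots> = emeasure lborel ((\<lambda>t. X (c * t) \<omega>) ` {0..1})"
      using c by (intro range_vol_eq continuous_on_compose2[OF continuous_paths[OF that]] continuous_intros) auto
    also have "(\<lambda>t. X (c * t) \<omega>) ` {0..1} = path \<omega> ` ((*) c ` {0..1})" by auto
    also have "(*) c ` {0..1} = {0..c}" using c by (simp add: image_mult_atLeastAtMost)
    finally show ?thesis .
  qed
  moreover have "range_vol 0 1 (\<lambda>t\<in>{0..}. c powr H *\<^sub>R X t \<omega>) = ennreal c * emeasure lborel (path \<omega> ` {0..1})" if "\<omega> \<in> space M" for \<omega>
  proof -
    have "range_vol 0 1 (\<lambda>t\<in>{0..}. c powr H *\<^sub>R X t \<omega>) = range_vol 0 1 (\<lambda>t. c powr H *\<^sub>R X t \<omega>)" by (rule range_vol_cong) auto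
    also have "\<dots> = emeasure lborel ((\<lambda>t. c powr H *\<^sub>R X t \<omega>) ` {0..1})"
      by (intro range_vol_eq continuous_intros continuous_paths[OF that]) auto
    also have "(\<lambda>t. c powr H *\<^sub>R X t \<omega>) ` {0..1} = (*\<^sub>R) (c powr H) ` path \<omega> ` {0..1}" by auto
    also have "emeasure lborel \<dots> = ennreal c * emeasure lborel (path \<omega> ` {0..1})"
      using c closed_path_image[OF that, of 0 1] by (subst emeasure_lborel_scaleR) (auto simp: powc)
    finally show ?thesis .
  qed
  moreover have "(\<lambda>\<omega>. emeasure lborel (path \<omega> ` {0..1})) \<in> borel_measurable M"
  proof -
    have "(\<lambda>\<omega>. range_vol 0 1 (path \<omega>)) \<in> borel_measurable M" by (rule range_vol_measurable) (auto intro: measurable_X)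
    then show ?thesis by (rule measurable_cong[THEN iffD1, rotated]) (simp add: range_vol_eq continuous_paths)
  qed
  ultimately show ?thesis by (simp add: nn_integral_cmult cong: nn_integral_cong)
qed

lemma nn_integral_range_vol_stationary:
  assumes a: "0 \<le> a" "a < b"
  shows "(\<integral>\<^sup>+\<omega>. emeasure lborel (path \<omega> ` {a..b}) \<partial>M) = (\<integral>\<^sup>+\<omega>. emeasure lborel (path \<omega> ` {0..b - a}) \<partial>M)"
proof -
  have m: "(\<lambda>f. range_vol 0 (b - a) f) \<in> borel_measurable (path_space :: (real \<Rightarrow> real ^ 'n) measure)"
    using range_vol_measurable[of 0 "b - a" "\<lambda>t f. f t" "path_space :: (real \<Rightarrow> real ^ 'n) measure"]
    by (auto intro: measurable_component_singleton)
  \<comment> \<open>Applied with \<open>s = a\<close> on one side of the identity and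
    \<open>s = 0\<close> on the other; subtracting \<open>X s \<omega>\<close> is a translation and
    keeps the volume.\<close>
  have inc: "range_vol 0 (b - a) (\<lambda>t\<in>{0..}. X (s + t) \<omega> - X s \<omega>) = emeasure lborel (path \<omega> ` {s..b - a + s})"
    if \<omega>: "\<omega> \<in> space M" and s: "0 \<le> s" for \<omega> s
  proof -
    have "range_vol 0 (b - a) (\<lambda>t\<in>{0..}. X (s + t) \<omega> - X s \<omega>) = range_vol 0 (b - a) (\<lambda>t. X (s + t) \<omega> - X s \<omega>)"
      by (rule range_vol_cong) auto
    also have "\<dots> = emeasure lborel ((\<lambda>t. X (s + t) \<omega> - X s \<omega>) ` {0..b - a})"
      using a s by (intro range_vol_eq continuous_intros continuous_on_compose2[OF continuous_paths[OF \<omega>]]) auto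
    also have "(\<lambda>t. X (s + t) \<omega> - X s \<omega>) ` {0..b - a} = (\<lambda>x. x - X s \<omega>) ` path \<omega> ` ((+) s ` {0..b - a})" by (simp only: image_image)
    also have "(+) s ` {0..b - a} = {s..b - a + s}" by (simp add: add.commute)
    also have "emeasure lborel ((\<lambda>x. x - X s \<omega>) ` path \<omega> ` {s..b - a + s}) = emeasure lborel (path \<omega> ` {s..b - a + s})"
      using closed_path_image[OF \<omega> s] by (rule emeasure_lborel_translate)
    finally show ?thesis .
  qed
  have "(\<integral>\<^sup>+\<omega>. range_vol 0 (b - a) (\<lambda>t\<in>{0..}. X (a + t) \<omega> - X a \<omega>) \<partial>M)
    = (\<integral>\<^sup>+\<omega>. range_vol 0 (b - a) (\<lambda>t\<in>{0..}. X t \<omega> - X 0 \<omega>) \<partial>M)"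
    using a measurable_X by (intro process_law_nn_integral[OF stationary_increments _ _ m]) (auto intro!: borel_measurable_diff)
  then show ?thesis using inc[OF _ a(1)] inc[of _ 0] by (simp cong: nn_integral_cong)
qed

lemma nn_integral_range_vol_finite:
  assumes n: "H * CARD('n) = 1"
  shows "(\<integral>\<^sup>+\<omega>. emeasure lborel (path \<omega> ` {0..1}) \<partial>M) < \<infinity>"
proof -
  let ?S = "\<lambda>\<omega>. SUP k. dyadic_max (2 * CARD('n)) k (path \<omega>)"
  have [measurable]: "(\<lambda>\<omega>. dyadic_max p k (path \<omega>)) \<in> borel_measurable M" for p k
  proof -
    have [measurable]: "X (real j / 2 ^ k) \<in> borel_measurable M" for j :: nat by (rule measurable_X) simp
    show ?thesis unfolding dyadic_max_def by measurable
  qed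
  have "(\<integral>\<^sup>+\<omega>. emeasure lborel (path \<omega> ` {0..1}) \<partial>M) \<le> (\<integral>\<^sup>+\<omega>. 2 ^ CARD('n) * (1 + ?S \<omega>) \<partial>M)"
    by (intro nn_integral_mono emeasure_path_le)
  also have "\<dots> = 2 ^ CARD('n) * (1 + (\<integral>\<^sup>+\<omega>. ?S \<omega> \<partial>M))"
    by (simp add: nn_integral_cmult nn_integral_add emeasure_space_1)
  also have "\<dots> < \<infinity>"
    using expectation_SUP_dyadic_max_finite[of "2 * CARD('n)"] n by (simp add: ennreal_mult_less_top mult.commute mult.left_commute power_less_top_ennreal)
  finally show ?thesis .
qed

lemma pred_hits_path:
  assumes "0 \<le> a" "u \<in> N \<rightarrow>\<^sub>M M" "w \<in> borel_measurable N"
  shows "Measurable.pred N (\<lambda>x. hits a b (w x) (path (u x)))"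
  using assms by (intro pred_hits measurable_compose[OF _ measurable_X]) auto

lemma AE_lborel_iff_emeasure:
  fixes P :: "'b::euclidean_space \<Rightarrow> bool"
  assumes "Measurable.pred borel P"
  shows "(AE z in lborel. \<not> P z) \<longleftrightarrow> emeasure lborel {z. P z} = 0"
proof -
  have "{z. P z} \<in> sets lborel" using assms by (simp add: pred_def)
  from AE_iff_measurable[OF this, of "\<lambda>z. \<not> P z"] show ?thesis by simp
qed

lemma AE_swap:
  fixes P :: "'a \<Rightarrow> 'b::euclidean_space \<Rightarrow> bool"
  assumes "Measurable.pred (M \<Otimes>\<^sub>M borel) (\<lambda>p. P (fst p) (snd p))"
  shows "(AE \<omega> in M. AE z in lborel. P \<omega> z) \<longleftrightarrow> (AE z in lborel. AE \<omega> in M. P \<omega> z)"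
proof -
  interpret pair_sigma_finite M "lborel :: 'b measure" ..
  show ?thesis
    using assms by (intro AE_commute) (simp add: pred_def space_pair_measure cong: sets_pair_measure_cong)
qed

lemma AE_overlap_null:
  assumes n: "H * CARD('n) = 1" and ac: "0 < a" "a < c"
  shows "AE \<omega> in M. emeasure lborel {z. hits 0 a z (path \<omega>) \<and> hits a c z (path \<omega>)} = 0"
proof -
  define R where "R s t \<omega> = emeasure lborel (path \<omega> ` {s..t})" for s t \<omega>
  define D where "D \<omega> = emeasure lborel {z. hits 0 a z (path \<omega>) \<and> hits a c z (path \<omega>)}" for \<omega>
  have mR[measurable]: "R s t \<in> borel_measurable M" if "0 \<le> s" "s < t" for s t
  proof -
    have "(\<lambda>\<omega>. range_vol s t (path \<omega>)) \<in> borel_measurable M"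
      using that by (intro range_vol_measurable measurable_X) auto
    then show ?thesis unfolding R_def
      by (rule measurable_cong[THEN iffD1, rotated]) (simp add: range_vol_eq continuous_paths that)
  qed
  have [measurable]: "D \<in> borel_measurable M"
    unfolding D_def using ac
    by (intro measurable_emeasure_Collect pred_intros_logic pred_hits_path) auto
  \<comment> \<open>Inclusion-exclusion with sums on both sides, since subtraction is unsafe for
    extended values.\<close>
  have eq: "R 0 c \<omega> + D \<omega> = R 0 a \<omega> + R a c \<omega>" if "\<omega> \<in> space M" for \<omega>
  proof -
    have "D \<omega> = emeasure lborel (path \<omega> ` {0..a} \<inter> path \<omega> ` {a..c})"
      unfolding D_def using ac continuous_paths[OF that]
      by (intro arg_cong2[where f=emeasure]) (auto simp: hits_iff_image)
    moreover have "path \<omega> ` {0..c} = path \<omega> ` {0..a} \<union> path \<omega> ` {a..c}"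
      using ac by (simp add: image_Un[symmetric] ivl_disj_un_two_touch)
    moreover have "emeasure lborel (path \<omega> ` {0..a}) + emeasure lborel (path \<omega> ` {a..c})
      = emeasure lborel (path \<omega> ` {0..a} \<union> path \<omega> ` {a..c}) + emeasure lborel (path \<omega> ` {0..a} \<inter> path \<omega> ` {a..c})"
      using closed_path_image[OF that, of 0 a] closed_path_image[OF that, of a c] ac
      by (intro emeasure_Un_Int) auto
    ultimately show ?thesis unfolding R_def by (simp only:)
  qed
  have fin: "(\<integral>\<^sup>+\<omega>. R 0 1 \<omega> \<partial>M) < \<infinity>" unfolding R_def by (rule nn_integral_range_vol_finite[OF n])
  have scal: "(\<integral>\<^sup>+\<omega>. R 0 t \<omega> \<partial>M) = ennreal t * (\<integral>\<^sup>+\<omega>. R 0 1 \<omega> \<partial>M)" if "0 < t" for t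
    unfolding R_def by (rule nn_integral_range_vol_scaling[OF n that])
  have "(\<integral>\<^sup>+\<omega>. R 0 c \<omega> \<partial>M) + (\<integral>\<^sup>+\<omega>. D \<omega> \<partial>M) = (\<integral>\<^sup>+\<omega>. R 0 c \<omega> + D \<omega> \<partial>M)"
    using ac by (intro nn_integral_add[symmetric]) auto
  also have "\<dots> = (\<integral>\<^sup>+\<omega>. R 0 a \<omega> + R a c \<omega> \<partial>M)" by (intro nn_integral_cong eq)
  also have "\<dots> = (\<integral>\<^sup>+\<omega>. R 0 a \<omega> \<partial>M) + (\<integral>\<^sup>+\<omega>. R a c \<omega> \<partial>M)" using ac by (intro nn_integral_add) auto
  also have "(\<integral>\<^sup>+\<omega>. R a c \<omega> \<partial>M) = (\<integral>\<^sup>+\<omega>. R 0 (c - a) \<omega> \<partial>M)"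
    unfolding R_def using ac by (intro nn_integral_range_vol_stationary) auto
  also have "(\<integral>\<^sup>+\<omega>. R 0 a \<omega> \<partial>M) + (\<integral>\<^sup>+\<omega>. R 0 (c - a) \<omega> \<partial>M) = (ennreal a + ennreal (c - a)) * (\<integral>\<^sup>+\<omega>. R 0 1 \<omega> \<partial>M)"
    using ac scal[of a] scal[of "c - a"] by (simp add: distrib_right)
  also have "ennreal a + ennreal (c - a) = ennreal c" using ac by (subst ennreal_plus[symmetric]) auto
  also have "ennreal c * (\<integral>\<^sup>+\<omega>. R 0 1 \<omega> \<partial>M) = (\<integral>\<^sup>+\<omega>. R 0 c \<omega> \<partial>M) + 0"
    using ac scal[of c] by simp
  finally have "(\<integral>\<^sup>+\<omega>. R 0 c \<omega> \<partial>M) + (\<integral>\<^sup>+\<omega>. D \<omega> \<partial>M) = (\<integral>\<^sup>+\<omega>. R 0 c \<omega> \<partial>M) + 0" .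
  \<comment> \<open>Without finiteness the preceding equation would carry no information about
    \<open>D\<close>.\<close>
  moreover have "(\<integral>\<^sup>+\<omega>. R 0 c \<omega> \<partial>M) \<noteq> \<infinity>"
    using fin ac scal[of c] by (simp add: ennreal_mult_eq_top_iff)
  ultimately have "(\<integral>\<^sup>+\<omega>. D \<omega> \<partial>M) = 0" unfolding ennreal_add_left_cancel by simp
  then show ?thesis unfolding D_def[symmetric] by (simp add: nn_integral_0_iff_AE)
qed

text \<open>The congruence condition says that \<open>P\<close> looks at a path on [0, c] only,
  which allows passing between whole paths and their restrictions in the product space.\<close>

lemma AE_path_shift_notin:
  assumes H: "H < 1 / 2" and ab: "0 \<le> a" "a < b" "b \<le> c"
    and P: "Measurable.pred (PiM {0..c} (\<lambda>_. borel)) P"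
    and cong: "\<And>f g :: real \<Rightarrow> real ^ 'n. (\<And>t. 0 \<le> t \<Longrightarrow> t \<le> c \<Longrightarrow> f t = g t) \<Longrightarrow> P f = P g"
    and null: "AE \<omega> in M. \<not> P (path \<omega>)"
  shows "AE \<omega> in M. \<not> P (\<lambda>t. X t \<omega> + ramp a b t *\<^sub>R y)"
proof -
  have c: "0 < c" using ab by simp
  obtain C where C: "0 < C" "\<And>T \<alpha>. finite T \<Longrightarrow> T \<subseteq> {0..c} \<Longrightarrow>
    (\<Sum>t\<in>T. \<alpha> t * ramp a b t)\<^sup>2 \<le> C * (\<Sum>s\<in>T. \<Sum>t\<in>T. \<alpha> s * \<alpha> t * fbm_cov H s t)"
    using ramp_le_fbm_cov[OF hurst(1) H ab(1,2) c] by blast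
  let ?F = "{f \<in> space (PiM {0..c} (\<lambda>_. borel)). P f}"
  have mem: "(\<lambda>t\<in>{0..c}. f t) \<in> ?F \<longleftrightarrow> P f" for f :: "real \<Rightarrow> real ^ 'n"
    using cong[of "\<lambda>t\<in>{0..c}. f t" f] by (simp add: space_PiM)
  have "AE \<omega> in M. (\<lambda>t\<in>{0..c}. X t \<omega> + ramp a b t *\<^sub>R y) \<notin> ?F"
    using P null c unfolding pred_def by (intro cameron_martin[OF _ C]) (auto simp only: mem less_imp_le)
  then show ?thesis unfolding mem .
qed

text \<open>Write \<open>A\<close> and \<open>B\<close> for the ranges over [0, a] and [b, c].
  Adding the ramp times \<open>y\<close> to the path keeps \<open>A\<close> in place and moves
  \<open>B\<close> by \<open>y\<close>, so the null overlap persists for every \<open>y\<close>. The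
  integral over \<open>y\<close> of the volume of \<open>A \<inter> (B + y)\<close> is the product
  of the volumes of \<open>A\<close> and \<open>B\<close>, which therefore vanishes.\<close>

lemma AE_range_null_or:
  assumes H: "H < 1 / 2" and n: "H * CARD('n) = 1" and abc: "0 < a" "a < b" "b < c"
  shows "AE \<omega> in M. emeasure lborel (path \<omega> ` {0..a}) = 0 \<or> emeasure lborel (path \<omega> ` {b..c}) = 0"
proof -
  define D where "D y \<omega> = emeasure lborel {z. hits 0 a z (path \<omega>) \<and> hits b c (z - y) (path \<omega>)}" for y \<omega>
  have D0: "AE \<omega> in M. D y \<omega> = 0" for y
  proof -
    have pz: "Measurable.pred borel (\<lambda>z. hits 0 a z (path \<omega>) \<and> hits b c (z - y) (path \<omega>))" if "\<omega> \<in> space M" for \<omega> y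
      using abc that by (intro pred_intros_logic pred_hits_path) auto
    have "AE \<omega> in M. emeasure lborel {z. hits 0 a z (path \<omega>) \<and> hits a c z (path \<omega>)} = 0"
      using abc by (intro AE_overlap_null[OF n]) auto
    then have "AE \<omega> in M. AE z in lborel. \<not> (hits 0 a z (path \<omega>) \<and> hits b c z (path \<omega>))"
      using AE_space
    proof eventually_elim
      case (elim \<omega>)
      have "Measurable.pred borel (\<lambda>z. hits 0 a z (path \<omega>) \<and> hits a c z (path \<omega>))"
        using abc elim(2) by (intro pred_intros_logic pred_hits_path) auto
      then have "AE z in lborel. \<not> (hits 0 a z (path \<omega>) \<and> hits a c z (path \<omega>))"
        using elim(1) by (simp only: AE_lborel_iff_emeasure)
      then show ?case using hits_mono[of b c _ "path \<omega>" a c] abc by (auto elim: eventually_mono)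
    qed
    \<comment> \<open>The shift applies to one event, hence to a fixed \<open>z\<close>; Fubini
      brings \<open>z\<close> outside and, after the shift, inside again.\<close>
    then have "AE z in lborel. AE \<omega> in M. \<not> (hits 0 a z (path \<omega>) \<and> hits b c z (path \<omega>))"
      by (subst (asm) AE_swap) (use abc in \<open>auto intro!: pred_intros_logic pred_hits_path\<close>)
    then have "AE z in lborel. AE \<omega> in M. \<not> (hits 0 a z (path \<omega>) \<and> hits b c (z - y) (path \<omega>))"
    proof eventually_elim
      case (elim z)
      have "AE \<omega> in M. \<not> (hits 0 a z (\<lambda>t. X t \<omega> + ramp a b t *\<^sub>R y) \<and> hits b c z (\<lambda>t. X t \<omega> + ramp a b t *\<^sub>R y))"
      proof (rule AE_path_shift_notin[OF H _ abc(2) _ _ _ elim])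
        show "Measurable.pred (PiM {0..c} (\<lambda>_. borel)) (\<lambda>f :: real \<Rightarrow> real ^ 'n. hits 0 a z f \<and> hits b c z f)"
          using abc by (intro pred_intros_logic pred_hits measurable_component_singleton) auto
        fix f g :: "real \<Rightarrow> real ^ 'n" assume "\<And>t. 0 \<le> t \<Longrightarrow> t \<le> c \<Longrightarrow> f t = g t"
        then show "(hits 0 a z f \<and> hits b c z f) = (hits 0 a z g \<and> hits b c z g)"
          using abc by (intro arg_cong2[where f="(\<and>)"] hits_cong) auto
      qed (use abc in auto)
      moreover have "hits 0 a z (\<lambda>t. X t \<omega> + ramp a b t *\<^sub>R y) \<longleftrightarrow> hits 0 a z (path \<omega>)"
        "hits b c z (\<lambda>t. X t \<omega> + ramp a b t *\<^sub>R y) \<longleftrightarrow> hits b c (z - y) (path \<omega>)" for \<omega>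
        using abc by (auto intro!: hits_cong simp: ramp_simps dist_norm algebra_simps)
      ultimately show ?case by simp
    qed
    then have "AE \<omega> in M. AE z in lborel. \<not> (hits 0 a z (path \<omega>) \<and> hits b c (z - y) (path \<omega>))"
      by (subst AE_swap) (use abc in \<open>auto intro!: pred_intros_logic pred_hits_path\<close>)
    then show ?thesis
      using AE_space
    proof eventually_elim
      case (elim \<omega>)
      then show ?case unfolding D_def by (simp only: AE_lborel_iff_emeasure[OF pz])
    qed
  qed
  \<comment> \<open>The exceptional null set may depend on \<open>y\<close>; Fubini gives a single
    one outside which almost every \<open>y\<close> works.\<close>
  have "AE \<omega> in M. AE y in lborel. D y \<omega> = 0"
  proof (subst AE_swap)
    have "(\<lambda>p. emeasure lborel {z. hits 0 a z (path (fst p)) \<and> hits b c (z - snd p) (path (fst p))}) \<in> borel_measurable (M \<Otimes>\<^sub>M (borel :: (real ^ 'n) measure))"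
      using abc by (intro measurable_emeasure_Collect pred_intros_logic pred_hits_path) auto
    then show "Measurable.pred (M \<Otimes>\<^sub>M borel) (\<lambda>p. D (snd p) (fst p) = 0)"
      unfolding D_def by measurable
  qed (intro AE_I2 D0)
  then show ?thesis
    using AE_space
  proof eventually_elim
    case (elim \<omega>)
    let ?A = "path \<omega> ` {0..a}" and ?B = "path \<omega> ` {b..c}"
    have A: "hits 0 a z (path \<omega>) \<longleftrightarrow> z \<in> ?A" and B: "hits b c z (path \<omega>) \<longleftrightarrow> z \<in> ?B" for z
      using continuous_paths[OF elim(2)] abc by (auto simp: hits_iff_image)
    have meas: "?A \<in> sets borel" "?B \<in> sets borel" using closed_path_image[OF elim(2)] abc by auto
    have "AE y in lborel. AE z in lborel. \<not> (z \<in> ?A \<and> z - y \<in> ?B)"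
      using elim(1) unfolding D_def A B
    proof eventually_elim
      case (elim y)
      have "{z. z - y \<in> ?B} \<in> sets borel"
        using measurable_sets[of "\<lambda>z. z - y" borel borel ?B] meas(2) by (simp add: vimage_def)
      then have "Measurable.pred borel (\<lambda>z. z \<in> ?A \<and> z - y \<in> ?B)"
        using meas(1) by (intro pred_intros_logic) (auto simp: pred_def)
      then show ?case using elim by (simp only: AE_lborel_iff_emeasure)
    qed
    moreover have "{p \<in> space (lborel \<Otimes>\<^sub>M lborel). \<not> (snd p \<in> ?A \<and> snd p - fst p \<in> ?B)} \<in> sets (lborel \<Otimes>\<^sub>M lborel)"
    proof -
      have "closed ((\<lambda>p :: (real ^ 'n) \<times> (real ^ 'n). snd p) -` ?A \<inter> (\<lambda>p. snd p - fst p) -` ?B)"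
        using closed_path_image[OF elim(2)] abc
        by (intro closed_Int closed_vimage continuous_intros) auto
      then have "- ((\<lambda>p :: (real ^ 'n) \<times> (real ^ 'n). snd p) -` ?A \<inter> (\<lambda>p. snd p - fst p) -` ?B) \<in> sets borel"
        by (intro borel_open open_Compl)
      moreover have "- ((\<lambda>p :: (real ^ 'n) \<times> (real ^ 'n). snd p) -` ?A \<inter> (\<lambda>p. snd p - fst p) -` ?B)
        = {p \<in> space (lborel \<Otimes>\<^sub>M lborel). \<not> (snd p \<in> ?A \<and> snd p - fst p \<in> ?B)}"
        by (auto simp: space_pair_measure)
      ultimately show ?thesis by (simp add: borel_prod[symmetric] cong: sets_pair_measure_cong)
    qed
    \<comment> \<open>With \<open>z\<close> fixed first, the \<open>y\<close> such that
      \<open>z - y\<close> lies in the later range form a reflected copy of that range, of the same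
      volume.\<close>
    ultimately have "AE z in lborel. AE y in lborel. \<not> (z \<in> ?A \<and> z - y \<in> ?B)"
      by (subst (asm) lborel_pair.AE_commute) auto
    show ?case
    proof (rule disjCI)
      assume nz: "emeasure lborel ?B \<noteq> 0"
      have "AE z in lborel. z \<notin> ?A"
        using \<open>AE z in lborel. AE y in lborel. \<not> (z \<in> ?A \<and> z - y \<in> ?B)\<close>
      proof eventually_elim
        case (elim z)
        show ?case
        proof
          assume "z \<in> ?A"
          then have "AE y in lborel. \<not> (z + (-1) *\<^sub>R y \<in> ?B)" using elim by simp
          moreover have "Measurable.pred borel (\<lambda>y. z + (-1) *\<^sub>R y \<in> ?B)"
            using measurable_sets[of "\<lambda>y. z + (-1) *\<^sub>R y" borel borel ?B] meas(2) by (simp add: vimage_def pred_def)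
          ultimately have "emeasure lborel {y. z + (-1) *\<^sub>R y \<in> ?B} = 0" by (simp only: AE_lborel_iff_emeasure)
          then have "emeasure lborel ?B = 0"
            using emeasure_lborel_affine_vimage[of "-1" ?B z] meas(2) by simp
          then show False using nz by simp
        qed
      qed
      then show "emeasure lborel ?A = 0"
        using AE_lborel_iff_emeasure[of "\<lambda>z. z \<in> ?A"] meas(1) by (simp add: pred_def)
    qed
  qed
qed

text \<open>The deterministic dichotomy asks for rational times only; these pairs are countable, so
  one null set serves them all.\<close>

proposition AE_range_null:
  assumes H: "H < 1 / 2" and n: "H * CARD('n) = 1" and c: "0 < c"
  shows "AE \<omega> in M. emeasure lborel (path \<omega> ` {0..c}) = 0"
proof -
  define S where "S = {p \<in> \<rat> \<times> \<rat>. 0 < fst p \<and> fst p < snd p \<and> snd p < c}"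
  have "countable S"
    by (rule countable_subset[OF _ countable_SIGMA[OF countable_rat, of "\<lambda>_. \<rat>"]]) (auto simp: S_def countable_rat)
  then have "AE \<omega> in M. \<forall>p\<in>S. emeasure lborel (path \<omega> ` {0..fst p}) = 0 \<or> emeasure lborel (path \<omega> ` {snd p..c}) = 0"
    by (subst AE_ball_countable) (auto simp: S_def intro!: AE_range_null_or[OF H n])
  then show ?thesis
    using AE_space
  proof eventually_elim
    case (elim \<omega>)
    then show ?case
      by (intro range_null_dichotomy[OF continuous_paths c]) (force simp: S_def)+
  qed
qed

text \<open>On [b, c] the ramp from \<open>b / 2\<close> to \<open>b\<close> equals 1, so the shift
  adds exactly \<open>z0 - z\<close> there and hitting \<open>z0\<close> becomes hitting
  \<open>z\<close>. The ramp needs \<open>b > 0\<close> in order to rise, in accordance with the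
  origin being hit at time 0.\<close>

proposition AE_not_hits:
  assumes H: "H < 1 / 2" and n: "H * CARD('n) = 1" and bc: "0 < b" "b < c"
  shows "AE \<omega> in M. \<not> hits b c z (path \<omega>)"
proof -
  have "AE \<omega> in M. emeasure lborel (path \<omega> ` {0..c}) = 0"
    using bc by (intro AE_range_null[OF H n]) simp
  then have "AE \<omega> in M. AE z in lborel. \<not> hits b c z (path \<omega>)"
    using AE_space
  proof eventually_elim
    case (elim \<omega>)
    have "{z. hits b c z (path \<omega>)} \<subseteq> path \<omega> ` {0..c}"
      using bc by (auto simp: hits_iff_image[OF continuous_paths[OF elim(2)]])
    then have "emeasure lborel {z. hits b c z (path \<omega>)} \<le> emeasure lborel (path \<omega> ` {0..c})"
      using closed_path_image[OF elim(2), of 0 c] by (intro emeasure_mono) auto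
    then have "emeasure lborel {z. hits b c z (path \<omega>)} = 0" using elim(1) by simp
    moreover have "Measurable.pred borel (\<lambda>z. hits b c z (path \<omega>))"
      using bc elim(2) by (intro pred_hits_path) auto
    ultimately show ?case by (simp add: AE_lborel_iff_emeasure)
  qed
  then have "AE z in lborel. AE \<omega> in M. \<not> hits b c z (path \<omega>)"
    by (subst (asm) AE_swap) (use bc in \<open>auto intro!: pred_intros_logic pred_hits_path\<close>)
  \<comment> \<open>Lebesgue measure is not zero, so what holds for almost every point holds for
    some point.\<close>
  moreover have "ae_filter (lborel :: (real ^ 'n) measure) \<noteq> bot" by (simp add: ae_filter_eq_bot_iff)
  ultimately obtain z0 where z0: "AE \<omega> in M. \<not> hits b c z0 (path \<omega>)"
    using eventually_happens' by blast
  have "AE \<omega> in M. \<not> hits b c z0 (\<lambda>t. X t \<omega> + ramp (b / 2) b t *\<^sub>R (z0 - z))"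
  proof (rule AE_path_shift_notin[OF H _ _ _ _ _ z0])
    show "Measurable.pred (PiM {0..c} (\<lambda>_. borel)) (\<lambda>f :: real \<Rightarrow> real ^ 'n. hits b c z0 f)"
      using bc by (intro pred_hits measurable_component_singleton) auto
    fix f g :: "real \<Rightarrow> real ^ 'n" assume "\<And>t. 0 \<le> t \<Longrightarrow> t \<le> c \<Longrightarrow> f t = g t"
    then show "hits b c z0 f = hits b c z0 g" using bc by (intro hits_cong) auto
  qed (use bc in auto)
  moreover have "hits b c z0 (\<lambda>t. X t \<omega> + ramp (b / 2) b t *\<^sub>R (z0 - z)) \<longleftrightarrow> hits b c z (path \<omega>)" for \<omega>
    using bc by (intro hits_cong) (auto simp: ramp_simps dist_norm algebra_simps)
  ultimately show ?thesis by simp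
qed

end

theorem theorem1:
  fixes M :: "'a measure" and H :: real and X :: "real \<Rightarrow> 'a \<Rightarrow> real ^ 'n::finite"
    and z :: "real ^ 'n"
  assumes "0 < H" and "H < 1 / 2" and "1 / H \<in> \<int>"
    and "real CARD('n) = 1 / H"
    and "fractional_brownian_motion M H X"
  shows "{\<omega> \<in> space M. \<exists>t>0. X t \<omega> = z} \<in> sets M \<and>
         measure M {\<omega> \<in> space M. \<exists>t>0. X t \<omega> = z} = 0"
proof -
  interpret fractional_brownian_motion M H X by fact
  have n: "H * CARD('n) = 1" using assms(1,4) by (simp add: field_simps)
  \<comment> \<open>The intervals from \<open>b k\<close> to \<open>c k\<close> exhaust the positive
    times; already \<open>b 0 = 1\<close> is below \<open>c 0 = 2\<close>, so each is nondegenerate,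
    as \<open>hits_iff_image\<close> requires.\<close>
  define b where "b k = inverse (real (Suc k))" for k :: nat
  define c where "c k = 1 + real (Suc k)" for k :: nat
  have bc: "0 < b k" "b k < c k" for k
  proof -
    have "b k \<le> 1" unfolding b_def by (simp add: field_simps)
    then show "0 < b k" "b k < c k" by (auto simp: b_def c_def)
  qed
  \<comment> \<open>A countable union of events about rational times, so the set belongs to
    \<open>sets M\<close> itself and no completion is involved.\<close>
  have eq: "{\<omega> \<in> space M. \<exists>t>0. X t \<omega> = z} = {\<omega> \<in> space M. \<exists>k. hits (b k) (c k) z (path \<omega>)}"
  proof (intro Collect_cong conj_cong refl)
    fix \<omega> assume \<omega>: "\<omega> \<in> space M"
    have "hits (b k) (c k) z (path \<omega>) \<longleftrightarrow> z \<in> path \<omega> ` {b k..c k}" for k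
      using bc[of k] by (intro hits_iff_image continuous_paths[OF \<omega>]) auto
    moreover have "\<exists>k. z \<in> path \<omega> ` {b k..c k}" if "t > 0" "X t \<omega> = z" for t
    proof -
      obtain k1 where "inverse (real (Suc k1)) < t" using reals_Archimedean[OF \<open>t > 0\<close>] by blast
      moreover obtain k2 :: nat where "t < real k2" using reals_Archimedean2 by blast
      moreover have "b (max k1 k2) \<le> inverse (real (Suc k1))"
        unfolding b_def by (intro le_imp_inverse_le) auto
      ultimately have "t \<in> {b (max k1 k2)..c (max k1 k2)}" by (auto simp: c_def)
      then show ?thesis using that(2) by blast
    qed
    moreover have "0 < t" if "t \<in> {b k..c k}" for t k using that bc(1)[of k] by simp
    ultimately show "(\<exists>t>0. X t \<omega> = z) \<longleftrightarrow> (\<exists>k. hits (b k) (c k) z (path \<omega>))" by (auto simp: image_iff) metis+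
  qed
  have "Measurable.pred M (\<lambda>\<omega>. \<exists>k. hits (b k) (c k) z (path \<omega>))"
    using bc by (intro pred_intros_countable pred_hits_path) (auto intro: less_imp_le)
  then have sets: "{\<omega> \<in> space M. \<exists>t>0. X t \<omega> = z} \<in> sets M" unfolding eq by (simp add: pred_def)
  have "AE \<omega> in M. \<forall>k. \<not> hits (b k) (c k) z (path \<omega>)"
    unfolding AE_all_countable using AE_not_hits[OF assms(2) n bc] by blast
  then have "AE \<omega> in M. \<not> (\<exists>t>0. X t \<omega> = z)"
    using AE_space by eventually_elim (use eq in blast)
  then have "emeasure M {\<omega> \<in> space M. \<exists>t>0. X t \<omega> = z} = 0"
    using AE_iff_measurable[OF sets] by simp
  then show ?thesis using sets by (simp add: measure_def)
qed

end
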